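(* Let $\gamma>0$ and let $Q$ be a quantile function with $Q(1-s)=s^{-\gamma}\ell(s)$, $s\in(0,1)$, where $\ell$ is slowly varying at $0$. Assume that there is a function $a$ regularly varying at $0$ such that $$\limsup_{v\downarrow0}\ \sup_{u\in(0,1]}\frac{|\ell(uv)-\ell(v)|}{a(v)}<\infty\qquad\text{and}\qquad\lim_{v\downarrow0}\frac{a(v)}{\ell(v)}=0 .$$ Let $(k_n)$ be a sequence of integers with $1\le k_n\le n$, $k_n\to\infty$, $k_n/n\to0$, and let $p_n>0$, $p_n\to\infty$, be such that $$p_n\,\frac{a(k_n/n)}{\ell(k_n/n)}\to0 .$$ Put $\alpha=\liminf_{n\to\infty}\frac{\log k_n}{p_n}$, $m_p=\gamma^p\Gamma(p+1)$ and $\sigma_p^2=\gamma^{2p}\left(\Gamma(2p+1)-\Gamma(p+1)^2\right)$, with $\sigma_p>0$. If $\alpha>1$, then $$\frac1{k_n\,m_{p_n}}\sum_{i=1}^{k_n}\left(\log\frac{Q(1-U_{i,n})}{Q(1-U_{k_n+1,n})}\right)^{p_n}\longrightarrow1\quad\text{in probability.}$$ If $\alpha>2$ and additionally $$\limsup_{n\to\infty}\ p_n^{-1}\log\left(\sqrt{k_n}\,\frac{a(k_n/n)}{\ell(k_n/n)}\right)<\log2,$$ then $$\frac1{\sqrt{k_n}\,\sigma_{p_n}}\sum_{i=1}^{k_n}\left[\left(\log\frac{Q(1-U_{i,n})}{Q(1-U_{k_n+1,n})}\right)^{p_n}-m_{p_n}\right]\stackrel{\mathcal D}{\longrightarrow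}N(0,1).$$
   Context: $Q(s)=\inf\{x:F(x)\ge s\}$, $s\in(0,1)$, is the quantile function of a distribution function $F$. $U_1,U_2,\ldots$ are iid uniform$(0,1)$ and $U_{1,n}\le\ldots\le U_{n,n}$ are the order statistics of $U_1,\ldots,U_n$. All quantities are considered for $n$ large, so that $k_n<n$; with probability tending to $1$, $Q(1-U_{k_n+1,n})>0$. A positive measurable function $a$ on a right neighbourhood of $0$ is regularly varying at $0$ if for some $\rho\in\mathbb R$, $a(uv)/a(v)\to u^\rho$ as $v\downarrow0$ for each $u>0$; slowly varying means $\rho=0$. $\Gamma$ is the gamma function and $\stackrel{\mathcal D}{\to}$ is convergence in distribution. *)

theory Defs
  imports "HOL-Probability.Probability"
begin

definition quantile :: "(real \<Rightarrow> real) \<Rightarrow> real \<Rightarrow> real" where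
  "quantile F s = Inf {x. F x \<ge> s}"

(* The sample is X 1, X 2, ...; the index i runs from 1 to n, so that
   order_stat X 1 n is the minimum and order_stat X n n the maximum of X 1, ..., X n.
   For i > n the value is unspecified. *)
definition order_stat :: "(nat \<Rightarrow> 'a \<Rightarrow> real) \<Rightarrow> nat \<Rightarrow> nat \<Rightarrow> 'a \<Rightarrow> real" where
  "order_stat X i n \<omega> = sort (map (\<lambda>j. X j \<omega>) [1..<n+1]) ! (i - 1)"

(* Positivity and measurability are required on some right neighbourhood of 0 only. *)
definition regularly_varying_at_0 :: "real \<Rightarrow> (real \<Rightarrow> real) \<Rightarrow> bool" where
  "regularly_varying_at_0 \<rho> a \<longleftrightarrow>
     (\<exists>\<delta>>0. (\<forall>v\<in>{0<..<\<delta>}. a v > 0) \<and> a \<in> borel_measurable (restrict_space borel {0<..<\<delta>})) \<and>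
     (\<forall>u>0. ((\<lambda>v. a (u * v) / a v) \<longlongrightarrow> u powr \<rho>) (at_right 0))"

definition slowly_varying_at_0 :: "(real \<Rightarrow> real) \<Rightarrow> bool" where
  "slowly_varying_at_0 a \<longleftrightarrow> regularly_varying_at_0 0 a"

(* Measurability is part of the definition because the measure of a non-measurable set is 0;
   it is asked for eventually because the variables need only be meaningful for large n. *)
definition converges_in_probability :: "'a measure \<Rightarrow> (nat \<Rightarrow> 'a \<Rightarrow> real) \<Rightarrow> real \<Rightarrow> bool" where
  "converges_in_probability M X c \<longleftrightarrow>
     (\<forall>\<^sub>F n in sequentially. X n \<in> borel_measurable M) \<and>
     (\<forall>\<epsilon>>0. (\<lambda>n. measure M {\<omega> \<in> space M. \<bar>X n \<omega> - c\<bar> > \<epsilon>}) \<longlonglongrightarrow> 0)"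

definition m_const :: "real \<Rightarrow> real \<Rightarrow> real" where
  "m_const \<gamma> p = \<gamma> powr p * Gamma (p + 1)"

definition sigma_const :: "real \<Rightarrow> real \<Rightarrow> real" where
  "sigma_const \<gamma> p = sqrt (\<gamma> powr (2 * p) * (Gamma (2 * p + 1) - (Gamma (p + 1))\<^sup>2))"

end

theory Submission
  imports Defs
begin

text \<open>
  Given \<open>V = U\<^bsub>k+1,n\<^esub>\<close>, the ratios of the \<open>k\<close> smallest sample points to \<open>V\<close> behave like an unordered
  uniform sample (Renyi): for bounded \<open>F\<close>, \<open>E (\<Prod>i\<le>k. F (U\<^bsub>i,n\<^esub> / V)) = (\<integral> F)\<^sup>k\<close>. Hence sums over the
  spacings \<open>E\<^sub>i = - ln (U\<^bsub>i,n\<^esub> / V)\<close> have the characteristic function of sums of iid exponential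
  variables, and Levy's continuity theorem gives the law of large numbers and the central limit
  theorem for \<open>\<Sum>i\<le>k. E\<^sub>i\<^sup>p\<close> from moments of order \<open>s\<close> slightly above 1 (respectively 2). By Stirling-type
  bounds on \<open>Gamma\<close> these moments are small enough when \<open>ln k / p\<close> stays above 1 (respectively 2).

  The logarithmic excesses are \<open>\<gamma> E\<^sub>i + ln l (U\<^bsub>i,n\<^esub>) - ln l (V)\<close>. The hypothesis on \<open>l\<close> is uniform over
  \<open>u \<in> (0, 1]\<close>, so on the event \<open>V \<le> 2 k / n\<close> the perturbation is at most a constant times
  \<open>\<eta> = a (k / n) / l (k / n)\<close>; no uniform convergence theorem for regularly varying functions is needed.
  It changes the sum of \<open>p\<close>-th powers by at most the order of \<open>k \<eta> \<Gamma>(p + 1)\<close>, which is negligible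
  against \<open>k m\<^sub>p\<close>, and against \<open>\<surd>k \<sigma>\<^sub>p\<close> because \<open>\<Gamma>(p + 1) / \<surd>\<Gamma>(2 p + 1)\<close> decays almost like \<open>2\<^sup>-\<^sup>p\<close>.
\<close>

section \<open>Order statistics\<close>

text \<open>Independence of the spacings is never formalised: only expectations of products with one
  common factor F are computed, and every later estimate is arranged to need nothing else. For that
  formula the sample space is split according to which index has rank k + 1 and which k indices lie
  below it. On each piece, scaling by the threshold pulls out the k-th power of the integral of F,
  and the remaining factor does not depend on F; the case F = 1 evaluates it, so neither a beta
  integral nor a conditional law occurs. The obstacle in the limit theorems is that the exponent p
  grows with n. The summands form a triangular array, and the normalised moment of order s of the
  q-th power of an exponential variable grows like exp(q s ln s). Against it stands the factor k^(1
  - s), which wins when ln k / q exceeds s ln s / (s - 1), a quantity tending to 1 as s decreases to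
  1. The order s must therefore be a real number close to 1, and the bounds on characteristic
  functions are needed for fractional orders. The central limit theorem is the same computation for
  squares, with q = 2 p, whence the critical value 2.\<close>

lemma sorted_nth_le_iff:
  fixes ys :: "'a::linorder list"
  assumes s: "sorted ys" and i: "i < length ys"
  shows "ys ! i \<le> x \<longleftrightarrow> i < length (filter (\<lambda>y. y \<le> x) ys)"
proof -
  have len: "length (filter (\<lambda>y. y \<le> x) ys) = card {m. m < length ys \<and> ys ! m \<le> x}"
    by (rule length_filter_conv_card)
  show ?thesis
  proof
    assume "ys ! i \<le> x"
    then have "{..<Suc i} \<subseteq> {m. m < length ys \<and> ys ! m \<le> x}"
      using i by (auto simp: less_Suc_eq_le intro: order_trans[OF sorted_nth_mono[OF s]])
    from card_mono[OF _ this] show "i < length (filter (\<lambda>y. y \<le> x) ys)"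
      by (simp add: len)
  next
    assume lt: "i < length (filter (\<lambda>y. y \<le> x) ys)"
    show "ys ! i \<le> x"
    proof (rule ccontr)
      assume "\<not> ys ! i \<le> x"
      then have "m < i" if "m < length ys" "ys ! m \<le> x" for m
        using sorted_nth_mono[OF s, of i m] that by (meson leI order_trans)
      then have "{m. m < length ys \<and> ys ! m \<le> x} \<subseteq> {..<i}" by auto
      from card_mono[OF _ this] lt show False by (simp add: len)
    qed
  qed
qed

text \<open>Counting replaces sorting: measurability, monotonicity and the tail of the threshold all
  go through this count.\<close>

lemma order_stat_le_iff:
  assumes "1 \<le> i" "i \<le> n"
  shows "order_stat X i n \<omega> \<le> x \<longleftrightarrow> i \<le> card {j\<in>{1..n}. X j \<omega> \<le> x}"
proof -
  let ?L = "map (\<lambda>j. X j \<omega>) [1..<n+1]"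
  have "length (filter (\<lambda>y. y \<le> x) (sort ?L)) = length (filter (\<lambda>y. y \<le> x) ?L)"
    by (subst filter_sort) (rule length_sort)
  also have "\<dots> = length (filter (\<lambda>j. X j \<omega> \<le> x) [1..<n+1])"
    by (simp only: filter_map length_map comp_def)
  also have "\<dots> = card {j\<in>{1..n}. X j \<omega> \<le> x}"
    by (subst distinct_card[symmetric]) (auto intro!: arg_cong[where f=card] distinct_filter simp del: upt_Suc)
  finally have "length (filter (\<lambda>y. y \<le> x) (sort ?L)) = card {j\<in>{1..n}. X j \<omega> \<le> x}" .
  then show ?thesis
    using sorted_nth_le_iff[of "sort ?L" "i - 1" x] assms by (auto simp: order_stat_def)
qed

lemma borel_measurable_order_stat [measurable]:
  assumes X: "\<And>j. j \<in> {1..n} \<Longrightarrow> X j \<in> borel_measurable M" and i: "1 \<le> i" "i \<le> n"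
  shows "order_stat X i n \<in> borel_measurable M"
  unfolding borel_measurable_iff_le
proof
  fix x
  have [measurable]: "(\<lambda>\<omega>. if X j \<omega> \<le> x then 1 else 0 :: real) \<in> borel_measurable M"
    if "j \<in> {1..n}" for j
  proof -
    note X[OF that, measurable]
    show ?thesis by measurable
  qed
  have "{\<omega> \<in> space M. order_stat X i n \<omega> \<le> x} =
    {\<omega> \<in> space M. real i \<le> (\<Sum>j\<in>{1..n}. if X j \<omega> \<le> x then 1 else 0)}"
    by (simp add: order_stat_le_iff[OF i] sum.If_cases Int_def)
  also have "\<dots> \<in> sets M"
    by measurable
  finally show "{\<omega> \<in> space M. order_stat X i n \<omega> \<le> x} \<in> sets M" .
qed

text \<open>A sorted list is determined by its multiset, and the sorted values over
  \<open>S\<close>, then \<open>X j\<close>, then the sorted rest form a sorted permutation of the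
  sample. The order within \<open>S\<close> is irrelevant to a product over all of \<open>S\<close>.
  Later \<open>S\<close> is the set of the \<open>k\<close> indices below the threshold index
  \<open>j\<close>.\<close>

lemma order_stat_split:
  fixes f :: "real \<Rightarrow> 'b::comm_monoid_mult"
  assumes S: "S \<subseteq> {1..n}" and j: "j \<in> {1..n}" "j \<notin> S"
    and lo: "\<And>i. i \<in> S \<Longrightarrow> X i \<omega> \<le> X j \<omega>"
    and hi: "\<And>i. i \<in> {1..n} - {j} - S \<Longrightarrow> X j \<omega> \<le> X i \<omega>"
  shows "order_stat X (card S + 1) n \<omega> = X j \<omega>"
    and "(\<Prod>i=1..card S. f (order_stat X i n \<omega>)) = (\<Prod>i\<in>S. f (X i \<omega>))"
proof -
  let ?f = "\<lambda>j. X j \<omega>"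
  let ?R = "{1..n} - {j} - S"
  have fin: "finite S" using S finite_subset by blast
  have part: "{1..n} = insert j (S \<union> ?R)" using S j by auto
  let ?A = "sort (map ?f (sorted_list_of_set S))"
  let ?C = "sort (map ?f (sorted_list_of_set ?R))"
  have ms: "mset (sorted_list_of_set T) = mset_set T" for T :: "nat set"
    by (metis mset_sorted_list_of_multiset sorted_list_of_mset_set)
  have "mset [1..<n+1] = mset_set {1..n}"
    by (metis atLeastLessThanSuc_atLeastAtMost Suc_eq_plus1 mset_upt)
  also have "\<dots> = mset_set (insert j (S \<union> ?R))" using part by simp
  also have "\<dots> = add_mset j (mset_set S + mset_set ?R)"
    using fin j by (subst mset_set.insert) (auto intro!: mset_set_Union simp del: Un_Diff_cancel)
  finally have "mset [1..<n+1] = add_mset j (mset_set S + mset_set ?R)" .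
  then have "mset (?A @ [X j \<omega>] @ ?C) = mset (map ?f [1..<n+1])"
    using fin by (simp add: ms del: upt_Suc)
  moreover have "sorted (?A @ [X j \<omega>] @ ?C)"
    using fin lo hi by (fastforce simp: sorted_append)
  ultimately have so: "sort (map ?f [1..<n+1]) = ?A @ [X j \<omega>] @ ?C"
    by (rule properties_for_sort)
  have len: "length ?A = card S" by simp
  show "order_stat X (card S + 1) n \<omega> = X j \<omega>"
    unfolding order_stat_def so using len nth_append_length[of ?A "X j \<omega>" ?C] by simp
  have "(\<Prod>i=1..card S. f (order_stat X i n \<omega>)) = (\<Prod>i<card S. f (order_stat X (Suc i) n \<omega>))"
    by (simp add: prod.atLeast1_atMost_eq)
  also have "\<dots> = (\<Prod>i<length ?A. f (?A ! i))"
    unfolding order_stat_def so using len by (intro prod.cong) (auto simp: nth_append)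
  also have "\<dots> = prod_list (map f ?A)"
    by (subst prod.list_conv_set_nth) (auto simp: atLeast0LessThan)
  also have "\<dots> = prod_mset (mset (map f ?A))" by (simp only: prod_mset_prod_list)
  also have "\<dots> = (\<Prod>i\<in>S. f (X i \<omega>))"
    using fin by (simp add: ms prod_unfold_prod_mset image_mset.compositionality comp_def)
  finally show "(\<Prod>i=1..card S. f (order_stat X i n \<omega>)) = (\<Prod>i\<in>S. f (X i \<omega>))" .
qed

text \<open>The number of smaller values is strictly increasing in the value, hence injective, and
  it stays below \<open>card I\<close>; by cardinality it takes every value in
  \<open>{..<card I}\<close>.\<close>

lemma rank_unique:
  fixes x :: "nat \<Rightarrow> real"
  assumes fin: "finite I" and inj: "inj_on x I" and k: "k < card I"
  shows "\<exists>!j. j \<in> I \<and> card {i\<in>I. x i < x j} = k"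
proof -
  define r where "r j = card {i\<in>I. x i < x j}" for j
  have less: "r i < r j" if "i \<in> I" "x i < x j" for i j
    unfolding r_def using fin that by (intro psubset_card_mono) auto
  have inj_r: "inj_on r I"
    using less inj unfolding inj_on_def by (metis less_irrefl linorder_neqE)
  have "r j < card I" if "j \<in> I" for j
    unfolding r_def using fin that by (intro psubset_card_mono) auto
  then have "r ` I = {..<card I}"
    using fin inj_r by (intro card_subset_eq) (auto simp: card_image)
  then have "k \<in> r ` I" using k by simp
  then show ?thesis using inj_r unfolding r_def[symmetric] inj_on_def by auto
qed

section \<open>Ratios of uniform order statistics\<close>

abbreviation (input) unif01 :: "real measure" where
  "unif01 \<equiv> uniform_measure lborel {0<..<1}"

lemma prob_space_unif01: "prob_space unif01"
  by (rule prob_space_uniform_measure) auto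

lemma AE_unif01: "AE x in unif01. 0 < x \<and> x < 1"
  by (rule AE_uniform_measureI) auto

lemma uniform_measure_01: "unif01 = density lborel (\<lambda>x. ennreal (indicator {0<..<1} x))"
  by (simp add: uniform_measure_def divide_ennreal_def ennreal_indicator)

lemma integral_unif01:
  fixes f :: "real \<Rightarrow> 'b::{banach,second_countable_topology}"
  assumes [measurable]: "f \<in> borel_measurable borel"
  shows "(\<integral>x. f x \<partial>unif01) = (\<integral>x. indicator {0<..<1} x *\<^sub>R f x \<partial>lborel)"
  unfolding uniform_measure_01 by (subst integral_density) auto

text \<open>Substitution \<open>u = v * u'\<close>: the Jacobian \<open>v\<close> is the probability
  of falling below \<open>v\<close>, and the ratio to \<open>v\<close> is again uniform.\<close>

lemma integral_unif01_below:
  fixes F :: "real \<Rightarrow> 'b::{banach,second_countable_topology}"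
  assumes [measurable]: "F \<in> borel_measurable borel" and v: "0 < v" "v < 1"
  shows "(\<integral>u. (if u < v then F (u / v) else 0) \<partial>unif01) = v *\<^sub>R (\<integral>u. F u \<partial>unif01)"
proof -
  have "(\<integral>u. (if u < v then F (u / v) else 0) \<partial>unif01) =
      (\<integral>u. indicator {0<..<1} u *\<^sub>R (if u < v then F (u / v) else 0) \<partial>lborel)"
    by (rule integral_unif01) simp
  also have "\<dots> = v *\<^sub>R (\<integral>u. indicator {0<..<1} (v * u) *\<^sub>R (if v * u < v then F (v * u / v) else 0) \<partial>lborel)"
    using v by (subst lborel_integral_real_affine[where c=v and t=0]) (simp_all only: add_0_left, simp_all)
  also have "(\<lambda>u. indicator {0<..<1} (v * u) *\<^sub>R (if v * u < v then F (v * u / v) else 0)) =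
      (\<lambda>u. indicator {0<..<1} u *\<^sub>R F u)"
    using v by (auto simp: fun_eq_iff indicator_def zero_less_mult_iff mult_less_cancel_left1
        split: if_splits) (smt (verit, best) mult_left_le_one_le mult_less_cancel_left1)+
  finally show ?thesis by (simp add: integral_unif01)
qed

text \<open>Fubini with coordinate \<open>j\<close> outermost. For a fixed value \<open>v\<close> of
  it, each coordinate in \<open>S\<close> gives \<open>v\<close> times the integral of
  \<open>F\<close>, and each other one gives the probability of exceeding \<open>v\<close>. The
  integral of \<open>F\<close> does not depend on \<open>v\<close>, so it leaves the outer
  integral.\<close>

lemma integral_PiM_cell:
  fixes F :: "real \<Rightarrow> complex"
  assumes F[measurable]: "F \<in> borel_measurable borel" and bd: "\<And>x. norm (F x) \<le> 1"
    and I: "finite I" "j \<in> I" and S: "S \<subseteq> I - {j}"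
  shows "(\<integral>x. (\<Prod>i\<in>S. if x i < x j then F (x i / x j) else 0) *
               (\<Prod>i\<in>I-{j}-S. if x j < x i then 1 else 0) \<partial>(\<Pi>\<^sub>M i\<in>I. unif01)) =
    (\<integral>u. F u \<partial>unif01) ^ card S *
    (\<integral>v. of_real v ^ card S * (\<integral>u. (if v < u then 1 else 0) \<partial>unif01) ^ (card I - 1 - card S) \<partial>unif01)"
proof -
  interpret U: prob_space unif01 by (rule prob_space_unif01)
  interpret P: product_prob_space "\<lambda>_. unif01" I ..
  let ?R = "I - {j} - S" and ?J = "I - {j}"
  let ?h = "\<lambda>u v. if u < v then F (u / v) else 0"
  let ?r = "\<lambda>u v::real. if v < u then 1 else (0::complex)"
  let ?f = "\<lambda>x. (\<Prod>i\<in>S. ?h (x i) (x j)) * (\<Prod>i\<in>?R. ?r (x i) (x j))"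
  have fS: "finite S" using S I finite_subset by blast
  have Ij: "{j} \<union> ?J = I" using I by auto
  have PI: "prob_space (\<Pi>\<^sub>M i\<in>I. unif01)" by (rule prob_space_PiM) (rule prob_space_unif01)
  have meas: "?f \<in> borel_measurable (\<Pi>\<^sub>M i\<in>I. unif01)"
  proof -
    have [measurable]: "(\<lambda>x. x i) \<in> borel_measurable (\<Pi>\<^sub>M i\<in>I. unif01)" if "i \<in> I" for i
      using measurable_component_singleton[OF that, of "\<lambda>_. unif01"]
      unfolding measurable_cong_sets[OF refl sets_uniform_measure] by simp
    have 1: "(\<lambda>x. ?h (x i) (x j)) \<in> borel_measurable (\<Pi>\<^sub>M i\<in>I. unif01)" if "i \<in> I" for i
      using I(2) that by measurable
    have 2: "(\<lambda>x. ?r (x i) (x j)) \<in> borel_measurable (\<Pi>\<^sub>M i\<in>I. unif01)" if "i \<in> I" for i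
      using I(2) that by measurable
    show ?thesis using S
      by (intro borel_measurable_times borel_measurable_prod) (auto intro!: 1 2)
  qed
  have bdf: "norm (?f x) \<le> 1" for x
    unfolding norm_mult prod_norm[symmetric]
    by (intro mult_le_one prod_le_1 prod_nonneg) (auto simp: bd)
  have intf: "integrable (\<Pi>\<^sub>M i\<in>I. unif01) ?f"
    using meas bdf by (intro finite_measure.integrable_const_bound[OF prob_space.finite_measure[OF PI], of _ 1]) auto
  \<comment> \<open>One family for both kinds of coordinates makes the integrand a single product
    over \<open>I - {j}\<close>, the form in which an integral over a product measure
    factorises.\<close>
  define g where "g i u v = (if i \<in> S then ?h u v else ?r u v)" for i u v
  have g_meas: "(\<lambda>u. g i u v) \<in> borel_measurable borel" for i v
    unfolding g_def by measurable
  have "integral\<^sup>L (\<Pi>\<^sub>M i\<in>I. unif01) ?f =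
      (\<integral>x. (\<integral>y. ?f (merge {j} ?J (x, y)) \<partial>(\<Pi>\<^sub>M i\<in>?J. unif01)) \<partial>(\<Pi>\<^sub>M i\<in>{j}. unif01))"
    by (rule P.product_integral_fold[of "{j}" ?J ?f, unfolded Ij, OF _ _ _ intf]) (use I in auto)
  also have "\<dots> = (\<integral>x. (\<integral>y. (\<Prod>i\<in>?J. g i (y i) (x j)) \<partial>(\<Pi>\<^sub>M i\<in>?J. unif01)) \<partial>(\<Pi>\<^sub>M i\<in>{j}. unif01))"
  proof -
    have "?f (merge {j} ?J (x, y)) = (\<Prod>i\<in>?J. g i (y i) (x j))" for x y
    proof -
      have "(\<Prod>i\<in>?J. g i (y i) (x j)) = (\<Prod>i\<in>S \<union> ?R. g i (y i) (x j))"
        using S by (intro prod.cong) auto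
      also have "\<dots> = (\<Prod>i\<in>S. g i (y i) (x j)) * (\<Prod>i\<in>?R. g i (y i) (x j))"
        using fS I by (intro prod.union_disjoint) auto
      also have "(\<Prod>i\<in>S. g i (y i) (x j)) = (\<Prod>i\<in>S. ?h (merge {j} ?J (x, y) i) (merge {j} ?J (x, y) j))"
        using S by (intro prod.cong) (auto simp: g_def merge_def)
      also have "(\<Prod>i\<in>?R. g i (y i) (x j)) = (\<Prod>i\<in>?R. ?r (merge {j} ?J (x, y) i) (merge {j} ?J (x, y) j))"
        using S by (intro prod.cong) (auto simp: g_def merge_def)
      finally show ?thesis by simp
    qed
    then show ?thesis by simp
  qed
  also have "\<dots> = (\<integral>x. (\<Prod>i\<in>?J. (\<integral>u. g i u (x j) \<partial>unif01)) \<partial>(\<Pi>\<^sub>M i\<in>{j}. unif01))"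
  proof -
    have "integrable unif01 (\<lambda>u. g i u v)" for i v
      using g_meas[of i v] bd
      by (intro U.integrable_const_bound[of _ 1]) (auto simp: g_def)
    then show ?thesis using I by (subst P.product_integral_prod) auto
  qed
  also have "\<dots> = (\<integral>v. (\<Prod>i\<in>?J. (\<integral>u. g i u v \<partial>unif01)) \<partial>unif01)"
  proof (rule P.product_integral_singleton[of "\<lambda>v. \<Prod>i\<in>?J. (\<integral>u. g i u v \<partial>unif01)" j])
    have "(\<lambda>v. \<integral>u. g i u v \<partial>unif01) \<in> borel_measurable unif01" for i
      unfolding g_def by measurable
    then show "(\<lambda>v. \<Prod>i\<in>?J. (\<integral>u. g i u v \<partial>unif01)) \<in> borel_measurable unif01"
      by (intro borel_measurable_prod)
  qed
  also have "\<dots> = (\<integral>v. (\<integral>u. F u \<partial>unif01) ^ card S *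
      (of_real v ^ card S * (\<integral>u. ?r u v \<partial>unif01) ^ (card I - 1 - card S)) \<partial>unif01)"
  proof (rule integral_cong_AE)
    have "(\<lambda>v. \<integral>u. g i u v \<partial>unif01) \<in> borel_measurable unif01" for i
      unfolding g_def by measurable
    then show "(\<lambda>v. \<Prod>i\<in>?J. (\<integral>u. g i u v \<partial>unif01)) \<in> borel_measurable unif01"
      by (intro borel_measurable_prod)
    show "(\<lambda>v. (\<integral>u. F u \<partial>unif01) ^ card S *
      (of_real v ^ card S * (\<integral>u. ?r u v \<partial>unif01) ^ (card I - 1 - card S))) \<in> borel_measurable unif01"
      by measurable
    \<comment> \<open>Equality holds only almost everywhere, because the scaling needs
      \<open>0 < v < 1\<close>.\<close>
    show "AE v in unif01. (\<Prod>i\<in>?J. (\<integral>u. g i u v \<partial>unif01)) = (\<integral>u. F u \<partial>unif01) ^ card S *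
      (of_real v ^ card S * (\<integral>u. ?r u v \<partial>unif01) ^ (card I - 1 - card S))"
      using AE_unif01
    proof eventually_elim
      case (elim v)
      have "(\<Prod>i\<in>?J. (\<integral>u. g i u v \<partial>unif01)) = (\<Prod>i\<in>S \<union> ?R. (\<integral>u. g i u v \<partial>unif01))"
        using S by (intro prod.cong) auto
      also have "\<dots> = (\<Prod>i\<in>S. (\<integral>u. g i u v \<partial>unif01)) * (\<Prod>i\<in>?R. (\<integral>u. g i u v \<partial>unif01))"
        using fS I by (intro prod.union_disjoint) auto
      also have "(\<Prod>i\<in>S. (\<integral>u. g i u v \<partial>unif01)) = (\<Prod>i\<in>S. v *\<^sub>R (\<integral>u. F u \<partial>unif01))"
        using elim by (intro prod.cong) (auto simp: g_def integral_unif01_below)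
      also have "(\<Prod>i\<in>?R. (\<integral>u. g i u v \<partial>unif01)) = (\<Prod>i\<in>?R. (\<integral>u. ?r u v \<partial>unif01))"
        by (intro prod.cong) (auto simp: g_def)
      also have "card ?R = card I - 1 - card S"
        using S I fS by (simp add: card_Diff_subset)
      then have "(\<Prod>i\<in>?R. (\<integral>u. ?r u v \<partial>unif01)) = (\<integral>u. ?r u v \<partial>unif01) ^ (card I - 1 - card S)"
        by simp
      also have "(\<Prod>i\<in>S. v *\<^sub>R (\<integral>u. F u \<partial>unif01)) = of_real v ^ card S * (\<integral>u. F u \<partial>unif01) ^ card S"
        by (simp add: scaleR_conv_of_real power_mult_distrib)
      finally show ?case by (simp only: mult_ac)
    qed
  qed
  also have "\<dots> = (\<integral>u. F u \<partial>unif01) ^ card S *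
      (\<integral>v. of_real v ^ card S * (\<integral>u. ?r u v \<partial>unif01) ^ (card I - 1 - card S) \<partial>unif01)"
    by (rule integral_mult_right_zero)
  finally show ?thesis .
qed

lemma AE_unif01_neq: "AE x in unif01. x \<noteq> y"
  by (rule AE_uniform_measureI) (use AE_lborel_singleton[of y] in auto)

locale uniform_sample = prob_space +
  fixes U :: "nat \<Rightarrow> 'a \<Rightarrow> real"
  assumes indep: "indep_vars (\<lambda>_. borel) U {1..}"
    and unif: "\<And>i. 1 \<le> i \<Longrightarrow> distr M borel (U i) = unif01"
begin

lemma U_measurable [measurable]: "1 \<le> i \<Longrightarrow> U i \<in> borel_measurable M"
  using indep unfolding indep_vars_def by auto

lemma distr_U_vector:
  assumes "I \<subseteq> {1..}" "I \<noteq> {}"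
  shows "distr M (\<Pi>\<^sub>M i\<in>I. borel) (\<lambda>\<omega>. \<lambda>i\<in>I. U i \<omega>) = (\<Pi>\<^sub>M i\<in>I. unif01)"
proof -
  have "indep_vars (\<lambda>_. borel) U I"
    by (rule indep_vars_subset[OF indep]) (use assms in auto)
  then have "distr M (\<Pi>\<^sub>M i\<in>I. borel) (\<lambda>\<omega>. \<lambda>i\<in>I. U i \<omega>) =
      (\<Pi>\<^sub>M i\<in>I. distr M borel (U i))"
    using assms by (subst (asm) indep_vars_iff_distr_eq_PiM') auto
  also have "\<dots> = (\<Pi>\<^sub>M i\<in>I. unif01)"
    using assms by (intro PiM_cong) (auto simp: unif)
  finally show ?thesis .
qed

lemma AE_U: "1 \<le> i \<Longrightarrow> AE \<omega> in M. 0 < U i \<omega> \<and> U i \<omega> < 1"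
proof -
  assume i: "1 \<le> i"
  have "AE x in distr M borel (U i). 0 < x \<and> x < 1"
    unfolding unif[OF i] by (rule AE_unif01)
  then show ?thesis using i by (subst (asm) AE_distr_iff) auto
qed

text \<open>By independence the pair has a product law, and the diagonal is null for it since the
  uniform law has no atoms.\<close>

lemma AE_U_neq:
  assumes ij: "1 \<le> i" "1 \<le> j" "i \<noteq> j"
  shows "AE \<omega> in M. U i \<omega> \<noteq> U j \<omega>"
proof -
  interpret u: prob_space unif01 by (rule prob_space_unif01)
  interpret P: product_sigma_finite "\<lambda>_::nat. unif01" ..
  interpret Q: pair_sigma_finite unif01 unif01 ..
  let ?D = "distr M (\<Pi>\<^sub>M m\<in>{i, j}. borel) (\<lambda>\<omega>. \<lambda>m\<in>{i, j}. U m \<omega>)"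
  let ?d = "\<lambda>x y::real. if x = y then 1 else 0 :: ennreal"
  have [measurable]: "U i \<in> borel_measurable M" "U j \<in> borel_measurable M" using ij by auto
  have "(\<integral>\<^sup>+ \<omega>. ?d (U i \<omega>) (U j \<omega>) \<partial>M) = (\<integral>\<^sup>+ w. ?d (w i) (w j) \<partial>?D)"
  proof -
    have 1: "(\<lambda>\<omega>. \<lambda>m\<in>{i, j}. U m \<omega>) \<in> measurable M (\<Pi>\<^sub>M m\<in>{i, j}. borel)"
      using ij by (intro measurable_restrict) auto
    have 2: "(\<lambda>w. ?d (w i) (w j)) \<in> borel_measurable ?D"
      by (subst measurable_distr_eq1) measurable
    show ?thesis using nn_integral_distr[OF 1 2] by simp
  qed
  also have "?D = (\<Pi>\<^sub>M m\<in>{i, j}. unif01)" using ij by (intro distr_U_vector) auto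
  also have "(\<integral>\<^sup>+ w. ?d (w i) (w j) \<partial>(\<Pi>\<^sub>M m\<in>{i, j}. unif01)) =
      (\<integral>\<^sup>+ z. ?d (fst z) (snd z) \<partial>(unif01 \<Otimes>\<^sub>M unif01))"
    using ij by (intro P.product_nn_integral_pair) (auto simp: case_prod_beta)
  also have "\<dots> = (\<integral>\<^sup>+ y. \<integral>\<^sup>+ x. ?d x y \<partial>unif01 \<partial>unif01)"
    by (subst Q.nn_integral_snd[symmetric]) auto
  also have "\<dots> = 0"
  proof -
    have "(\<integral>\<^sup>+ x. ?d x y \<partial>unif01) = 0" for y
      using AE_unif01_neq[of y] by (subst nn_integral_0_iff_AE) auto
    then show ?thesis by simp
  qed
  finally have "AE \<omega> in M. ?d (U i \<omega>) (U j \<omega>) = 0"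
    by (subst (asm) nn_integral_0_iff_AE) auto
  then show ?thesis by eventually_elim (auto simp: indicator_def split: if_splits)
qed

lemma AE_U_inj: "AE \<omega> in M. inj_on (\<lambda>i. U i \<omega>) {1..n} \<and> (\<forall>i\<in>{1..n}. 0 < U i \<omega> \<and> U i \<omega> < 1)"
proof -
  have "AE \<omega> in M. \<forall>i\<in>{1..n}. \<forall>j\<in>{1..n} - {i}. U i \<omega> \<noteq> U j \<omega>"
    by (intro AE_finite_allI) (auto intro!: AE_U_neq)
  moreover have "AE \<omega> in M. \<forall>i\<in>{1..n}. 0 < U i \<omega> \<and> U i \<omega> < 1"
    by (intro AE_finite_allI AE_U) auto
  ultimately show ?thesis
    by eventually_elim (auto simp: inj_on_def)
qed

text \<open>All cells contribute the same amount. The indicators make a cell vanish unless its pair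
  is the true one, so almost surely the sum over all cells has a single nonzero term, which is the
  product over the \<open>k\<close> smallest points.\<close>

lemma expectation_prod_ratio:
  fixes F :: "real \<Rightarrow> complex"
  assumes F: "F \<in> borel_measurable borel" and bd: "\<And>x. norm (F x) \<le> 1" and k: "k < n"
  shows "expectation (\<lambda>\<omega>. \<Prod>i=1..k. F (order_stat U i n \<omega> / order_stat U (k + 1) n \<omega>)) =
    (\<integral>u. F u \<partial>unif01) ^ k"
proof -
  let ?I = "{1..n}"
  \<comment> \<open>A cell is a candidate \<open>(j, S)\<close>: the index \<open>j\<close> of the
    threshold, of rank \<open>k + 1\<close>, and the set \<open>S\<close> of the \<open>k\<close>
    indices below it.\<close>
  define cells where "cells = (SIGMA j:?I. {S. S \<subseteq> ?I - {j} \<and> card S = k})"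
  define cell where "cell G c x =
      (\<Prod>i\<in>snd c. if x i < x (fst c) then G (x i / x (fst c)) else 0) *
      (\<Prod>i\<in>?I-{fst c}-snd c. if x (fst c) < x i then 1 else 0)"
    for G :: "real \<Rightarrow> complex" and c :: "nat \<times> nat set" and x :: "nat \<Rightarrow> real"
  \<comment> \<open>Common weight of the cells: the probability that \<open>k\<close> given points
    lie below and \<open>n - 1 - k\<close> given points above one further point. It is never
    evaluated.\<close>
  define C where "C = (\<integral>v. of_real v ^ k *
      (\<integral>u. (if v < u then 1 else 0 :: complex) \<partial>unif01) ^ (n - 1 - k) \<partial>unif01)"
  have I1: "?I \<subseteq> {1..}" and I2: "?I \<noteq> {}" using k by auto
  have fin: "finite cells" unfolding cells_def by auto
  have [measurable]: "(\<lambda>x. x i) \<in> borel_measurable (\<Pi>\<^sub>M i\<in>?I. borel)" if "i \<in> ?I" for i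
    using measurable_component_singleton[OF that, of "\<lambda>_. borel"] by simp
  have cell_meas: "cell G c \<in> borel_measurable (\<Pi>\<^sub>M i\<in>?I. borel)"
    if c: "c \<in> cells" and G[measurable]: "G \<in> borel_measurable borel" for G c
  proof -
    obtain j S where c_eq: "c = (j, S)" by (cases c)
    then have j: "j \<in> ?I" and S: "S \<subseteq> ?I" using c by (auto simp: cells_def)
    have 1: "(\<lambda>x. if x i < x j then G (x i / x j) else 0) \<in> borel_measurable (\<Pi>\<^sub>M i\<in>?I. borel)" if "i \<in> ?I" for i
      using j that by measurable
    have 2: "(\<lambda>x::nat \<Rightarrow> real. if x j < x i then 1 else 0 :: complex) \<in> borel_measurable (\<Pi>\<^sub>M i\<in>?I. borel)" if "i \<in> ?I" for i
      using j that by measurable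
    show ?thesis unfolding cell_def c_eq fst_conv snd_conv
      by (intro borel_measurable_times borel_measurable_prod 1 2) (use S in auto)
  qed
  have vec_meas [measurable]: "(\<lambda>\<omega>. \<lambda>i\<in>?I. U i \<omega>) \<in> measurable M (\<Pi>\<^sub>M i\<in>?I. borel)"
    by (intro measurable_restrict) auto
  have cell_restrict: "cell G c (\<lambda>i\<in>?I. U i \<omega>) = cell G c (\<lambda>i. U i \<omega>)" if "c \<in> cells" for G c \<omega>
    using that unfolding cells_def cell_def by (intro arg_cong2[where f="(*)"] prod.cong) auto
  have cell_bd: "norm (cell G c x) \<le> 1" if "\<And>x. norm (G x) \<le> 1" for G c x
    unfolding cell_def norm_mult prod_norm[symmetric]
    by (intro mult_le_one prod_le_1 prod_nonneg) (auto simp: that)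
  have cell_int: "integrable M (\<lambda>\<omega>. cell G c (\<lambda>i. U i \<omega>))"
    if "c \<in> cells" "G \<in> borel_measurable borel" "\<And>x. norm (G x) \<le> 1" for G c
  proof (rule integrable_const_bound[of _ 1])
    show "(\<lambda>\<omega>. cell G c (\<lambda>i. U i \<omega>)) \<in> borel_measurable M"
      using measurable_compose[OF vec_meas cell_meas[OF that(1,2)]]
      by (simp only: cell_restrict[OF that(1)])
  qed (use cell_bd[OF that(3)] in auto)
  have cell_E: "expectation (\<lambda>\<omega>. cell G c (\<lambda>i. U i \<omega>)) = (\<integral>u. G u \<partial>unif01) ^ k * C"
    if c: "c \<in> cells" and G: "G \<in> borel_measurable borel" "\<And>x. norm (G x) \<le> 1" for G c
  proof -
    obtain j S where c_eq: "c = (j, S)" by (cases c)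
    then have j: "j \<in> ?I" and S: "S \<subseteq> ?I - {j}" "card S = k" using c by (auto simp: cells_def)
    have "expectation (\<lambda>\<omega>. cell G c (\<lambda>i. U i \<omega>)) = expectation (\<lambda>\<omega>. cell G c (\<lambda>i\<in>?I. U i \<omega>))"
      by (simp only: cell_restrict[OF c])
    also have "\<dots> = (\<integral>x. cell G c x \<partial>distr M (\<Pi>\<^sub>M i\<in>?I. borel) (\<lambda>\<omega>. \<lambda>i\<in>?I. U i \<omega>))"
      by (rule integral_distr[OF vec_meas cell_meas[OF c G(1)], symmetric])
    also have "\<dots> = (\<integral>x. cell G c x \<partial>(\<Pi>\<^sub>M i\<in>?I. unif01))"
      by (simp only: distr_U_vector[OF I1 I2])
    also have "\<dots> = (\<integral>u. G u \<partial>unif01) ^ k * C"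
      unfolding cell_def c_eq fst_conv snd_conv C_def
      using integral_PiM_cell[OF G _ j S(1)] S(2) by simp
    finally show ?thesis .
  qed
  have decomp: "AE \<omega> in M. (\<Prod>i=1..k. G (order_stat U i n \<omega> / order_stat U (k + 1) n \<omega>)) =
      (\<Sum>c\<in>cells. cell G c (\<lambda>i. U i \<omega>))" for G
    using AE_U_inj[of n]
  proof eventually_elim
    case (elim \<omega>)
    let ?x = "\<lambda>i. U i \<omega>"
    have "\<exists>!j. j \<in> ?I \<and> card {i\<in>?I. ?x i < ?x j} = k" (is "\<exists>!j. ?Q j")
      by (rule rank_unique) (use elim k in auto)
    then obtain j where Qj: "?Q j" and Q_uniq: "\<forall>j'. ?Q j' \<longrightarrow> j' = j"
      by (rule ex1E)
    have j: "j \<in> ?I" "card {i\<in>?I. ?x i < ?x j} = k" using Qj by auto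
    have uniq: "j' = j" if "j' \<in> ?I" "card {i\<in>?I. ?x i < ?x j'} = k" for j'
      by (rule Q_uniq[rule_format]) (rule conjI[OF that])
    define S where "S = {i\<in>?I. ?x i < ?x j}"
    have c: "(j, S) \<in> cells" using j by (auto simp: cells_def S_def)
    have hi: "?x j < ?x i" if "i \<in> ?I - {j} - S" for i
    proof -
      have "?x i \<noteq> ?x j" using elim that j(1) by (auto dest: inj_onD)
      moreover have "\<not> ?x i < ?x j" using that by (simp add: S_def)
      ultimately show ?thesis by simp
    qed
    \<comment> \<open>A nonzero cell satisfies all its strict inequalities, so \<open>S'\<close> is
      the whole set of indices below \<open>j'\<close> and \<open>j'\<close> has exactly
      \<open>k\<close> predecessors; uniqueness of ranks identifies the cell.\<close>
    have zero: "cell G c ?x = 0" if c: "c \<in> cells - {(j, S)}" for c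
    proof (rule ccontr)
      assume nz: "cell G c ?x \<noteq> 0"
      obtain j' S' where c_eq: "c = (j', S')" by (cases c)
      then have j': "j' \<in> ?I" "S' \<subseteq> ?I - {j'}" "card S' = k" "(j', S') \<noteq> (j, S)"
        using c by (auto simp: cells_def)
      have fS': "finite S'" using j' finite_subset by blast
      have lo': "?x i < ?x j'" if "i \<in> S'" for i
        using nz that fS' by (auto simp: cell_def c_eq split: if_splits)
      have hi': "?x j' < ?x i" if "i \<in> ?I - {j'} - S'" for i
        using nz that by (auto simp: cell_def c_eq split: if_splits)
      have S': "S' = {i\<in>?I. ?x i < ?x j'}"
      proof (intro equalityI subsetI)
        fix i assume i: "i \<in> {i\<in>?I. ?x i < ?x j'}"
        then show "i \<in> S'" using hi'[of i] by (cases "i = j'"; cases "i \<in> S'") auto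
      qed (use lo' j' in auto)
      then have "j' = j" using j' by (intro uniq) auto
      with S' j' show False by (simp add: S_def)
    qed
    have "(\<Sum>c\<in>cells. cell G c ?x) = cell G (j, S) ?x"
      using fin c zero by (subst sum.remove[of _ "(j, S)"]) auto
    also have "\<dots> = (\<Prod>i\<in>S. G (?x i / ?x j)) * (\<Prod>i\<in>?I - {j} - S. 1)"
      unfolding cell_def fst_conv snd_conv using hi
      by (intro arg_cong2[where f="(*)"] prod.cong) (auto simp: S_def)
    also have "\<dots> = (\<Prod>i\<in>S. G (?x i / ?x j))" by simp
    also have "\<dots> = (\<Prod>i=1..k. G (order_stat U i n \<omega> / order_stat U (k + 1) n \<omega>))"
    proof -
      have S: "S \<subseteq> ?I" "j \<notin> S" by (auto simp: S_def)
      have lo': "?x i \<le> ?x j" if "i \<in> S" for i using that by (simp add: S_def)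
      have hi': "?x j \<le> ?x i" if "i \<in> ?I - {j} - S" for i using hi[OF that] by simp
      have card: "card S = k" using j by (simp add: S_def)
      have os: "order_stat U (k + 1) n \<omega> = U j \<omega>"
        using order_stat_split(1)[where X=U and \<omega>=\<omega>, OF S(1) j(1) S(2) lo' hi'] unfolding card .
      show ?thesis
        using order_stat_split(2)[where X=U and \<omega>=\<omega> and f="\<lambda>u. G (u / ?x j)", OF S(1) j(1) S(2) lo' hi']
        unfolding card os by (rule sym)
    qed
    finally show ?case by (rule sym)
  qed
  have os_meas: "order_stat U i n \<in> borel_measurable M" if "1 \<le> i" "i \<le> n" for i
    by (rule borel_measurable_order_stat) (use that in auto)
  have E: "expectation (\<lambda>\<omega>. \<Prod>i=1..k. G (order_stat U i n \<omega> / order_stat U (k + 1) n \<omega>)) =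
      (\<integral>u. G u \<partial>unif01) ^ k * (of_nat (card cells) * C)"
    if G: "G \<in> borel_measurable borel" "\<And>x. norm (G x) \<le> 1" for G
  proof -
    have "expectation (\<lambda>\<omega>. \<Prod>i=1..k. G (order_stat U i n \<omega> / order_stat U (k + 1) n \<omega>)) =
        expectation (\<lambda>\<omega>. \<Sum>c\<in>cells. cell G c (\<lambda>i. U i \<omega>))"
    proof (rule integral_cong_AE)
      have "(\<lambda>\<omega>. G (order_stat U i n \<omega> / order_stat U (k + 1) n \<omega>)) \<in> borel_measurable M"
        if "i \<in> {1..k}" for i
        using k that by (intro measurable_compose[OF _ G(1)] borel_measurable_divide os_meas) auto
      then show "(\<lambda>\<omega>. \<Prod>i=1..k. G (order_stat U i n \<omega> / order_stat U (k + 1) n \<omega>)) \<in> borel_measurable M"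
        by (intro borel_measurable_prod)
    qed (use decomp[of G] in \<open>auto intro!: borel_measurable_sum borel_measurable_integrable cell_int G\<close>)
    also have "\<dots> = (\<Sum>c\<in>cells. (\<integral>u. G u \<partial>unif01) ^ k * C)"
      using G by (subst Bochner_Integration.integral_sum) (auto simp: cell_int cell_E)
    finally show ?thesis by simp
  qed
  interpret u: prob_space unif01 by (rule prob_space_unif01)
  \<comment> \<open>Normalisation: for the constant function 1 the left side is the expectation of
    1.\<close>
  have "of_nat (card cells) * C = 1"
    using E[of "\<lambda>_. 1"] u.prob_space by (simp add: prob_space)
  then show ?thesis using E[of F] F bd by simp
qed

end

section \<open>Exponential spacings\<close>

abbreviation (input) expo :: "real measure" where
  "expo \<equiv> density lborel (exponential_density 1)"

lemma prob_space_expo: "prob_space expo"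
  by (rule prob_space_exponential_density) simp

lemma distr_unif01_neg_ln: "distr unif01 borel (\<lambda>u. - ln u) = expo"
proof -
  interpret u: prob_space unif01 by (rule prob_space_unif01)
  have "distributed unif01 lborel (\<lambda>u. - ln u) (exponential_density 1)"
  proof (rule u.exponential_distributed_iff[OF zero_less_one, THEN iffD2], intro conjI allI impI)
    fix a :: real assume a: "0 \<le> a"
    have "measure unif01 {u \<in> space unif01. - ln u \<le> a} = measure unif01 {exp (- a)..}"
    proof (rule u.finite_measure_eq_AE)
      show "AE u in unif01. (u \<in> {u \<in> space unif01. - ln u \<le> a}) = (u \<in> {exp (- a)..})"
        using AE_unif01 by eventually_elim (simp add: ln_ge_iff minus_le_iff)
    qed auto
    also have "\<dots> = measure lborel ({0<..<1} \<inter> {exp (- a)..}) / measure lborel {0<..<1::real}"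
      by (rule measure_uniform_measure) auto
    also have "{0<..<1} \<inter> {exp (- a)..} = {exp (- a)..<1::real}"
      by (auto intro: less_le_trans[OF exp_gt_zero])
    finally show "measure unif01 {u \<in> space unif01. - ln u \<le> a} = 1 - exp (- a * 1)"
      using a by simp
  qed auto
  then have "distr unif01 lborel (\<lambda>u. - ln u) = expo"
    by (rule distributed_distr_eq_density)
  moreover have "distr unif01 borel (\<lambda>u. - ln u) = distr unif01 lborel (\<lambda>u. - ln u)"
    by (rule distr_cong) auto
  ultimately show ?thesis by simp
qed

context uniform_sample
begin

text \<open>Logarithmic distance \<open>ln V - ln U\<close> from a small order statistic to the
  threshold of rank \<open>k + 1\<close>; almost surely nonnegative and decreasing in
  \<open>i\<close>, so \<open>i = 1\<close> gives the largest one.\<close>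

definition spacing :: "nat \<Rightarrow> nat \<Rightarrow> nat \<Rightarrow> 'a \<Rightarrow> real" where
  "spacing k n i \<omega> = - ln (order_stat U i n \<omega> / order_stat U (k + 1) n \<omega>)"

lemma order_stat_U_measurable:
  assumes "1 \<le> i" "i \<le> n"
  shows "order_stat U i n \<in> borel_measurable M"
  by (rule borel_measurable_order_stat) (use assms in auto)

lemma spacing_measurable:
  assumes "k < n" "i \<in> {1..k}"
  shows "spacing k n i \<in> borel_measurable M"
proof -
  have [measurable]: "order_stat U i n \<in> borel_measurable M" "order_stat U (k + 1) n \<in> borel_measurable M"
    using assms by (auto intro!: order_stat_U_measurable)
  show ?thesis unfolding spacing_def by measurable
qed

lemma expectation_prod_spacing:
  fixes F :: "real \<Rightarrow> complex"
  assumes F[measurable]: "F \<in> borel_measurable borel" and bd: "\<And>x. norm (F x) \<le> 1" and k: "k < n"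
  shows "expectation (\<lambda>\<omega>. \<Prod>i=1..k. F (spacing k n i \<omega>)) = (\<integral>x. F x \<partial>expo) ^ k"
proof -
  have "expectation (\<lambda>\<omega>. \<Prod>i=1..k. F (spacing k n i \<omega>)) = (\<integral>u. F (- ln u) \<partial>unif01) ^ k"
    unfolding spacing_def by (rule expectation_prod_ratio) (use bd k in auto)
  also have "(\<integral>u. F (- ln u) \<partial>unif01) = (\<integral>x. F x \<partial>expo)"
    unfolding distr_unif01_neg_ln[symmetric] by (rule integral_distr[symmetric]) auto
  finally show ?thesis .
qed

text \<open>The spacings are ordered and hence dependent, but the exponential turns a symmetric sum
  into a product with one common factor. The sum therefore has the law of a sum of \<open>k\<close>
  iid terms.\<close>

lemma char_sum_spacing:
  assumes g[measurable]: "g \<in> borel_measurable borel" and k: "k < n"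
  shows "char (distr M borel (\<lambda>\<omega>. \<Sum>i=1..k. g (spacing k n i \<omega>))) t = char (distr expo borel g) t ^ k"
proof -
  have meas: "(\<lambda>\<omega>. \<Sum>i=1..k. g (spacing k n i \<omega>)) \<in> borel_measurable M"
    using spacing_measurable[OF k]
    by (intro borel_measurable_sum measurable_compose[OF _ g]) auto
  have "char (distr M borel (\<lambda>\<omega>. \<Sum>i=1..k. g (spacing k n i \<omega>))) t =
      expectation (\<lambda>\<omega>. iexp (t * (\<Sum>i=1..k. g (spacing k n i \<omega>))))"
    unfolding char_def using meas by (subst integral_distr) auto
  also have "\<dots> = expectation (\<lambda>\<omega>. \<Prod>i=1..k. iexp (t * g (spacing k n i \<omega>)))"
    by (simp add: exp_sum sum_distrib_left)
  also have "\<dots> = (\<integral>x. iexp (t * g x) \<partial>expo) ^ k"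
    by (rule expectation_prod_spacing[OF _ _ k]) auto
  also have "(\<integral>x. iexp (t * g x) \<partial>expo) = char (distr expo borel g) t"
    unfolding char_def by (subst integral_distr) auto
  finally show ?thesis .
qed

text \<open>Markov's inequality, obtained from the Laplace transform because only expectations of
  products over the spacings are available.\<close>

lemma prob_sum_spacing_ge:
  assumes g[measurable]: "g \<in> borel_measurable borel" and nn: "\<And>x. 0 \<le> g x"
    and int: "integrable expo g" and k: "k < n" and \<epsilon>: "\<epsilon> > 0"
  shows "prob {\<omega> \<in> space M. (\<Sum>i=1..k. g (spacing k n i \<omega>)) \<ge> \<epsilon>} * (1 - exp (- 1))
    \<le> real k * (\<integral>x. g x \<partial>expo) / \<epsilon>"
proof -
  interpret e: prob_space expo by (rule prob_space_expo)
  define S where "S \<omega> = (\<Sum>i=1..k. g (spacing k n i \<omega>))" for \<omega>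
  have S[measurable]: "S \<in> borel_measurable M"
    unfolding S_def using spacing_measurable[OF k]
    by (intro borel_measurable_sum measurable_compose[OF _ g]) auto
  have S0: "0 \<le> S \<omega>" for \<omega> unfolding S_def by (intro sum_nonneg nn)
  let ?F = "\<lambda>x. exp (- g x / \<epsilon>)"
  have intF: "integrable expo ?F"
    by (rule e.integrable_const_bound[of _ 1]) (use nn \<epsilon> in auto)
  have "of_real (expectation (\<lambda>\<omega>. exp (- S \<omega> / \<epsilon>))) = expectation (\<lambda>\<omega>. complex_of_real (exp (- S \<omega> / \<epsilon>)))"
    by simp
  also have "\<dots> = expectation (\<lambda>\<omega>. \<Prod>i=1..k. complex_of_real (?F (spacing k n i \<omega>)))"
    by (simp add: S_def sum_divide_distrib sum_negf[symmetric] exp_sum flip: of_real_prod)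
  also have "\<dots> = (\<integral>x. complex_of_real (?F x) \<partial>expo) ^ k"
    by (rule expectation_prod_spacing[OF _ _ k]) (use nn \<epsilon> in auto)
  also have "\<dots> = of_real ((\<integral>x. ?F x \<partial>expo) ^ k)" by simp
  finally have E: "expectation (\<lambda>\<omega>. exp (- S \<omega> / \<epsilon>)) = (\<integral>x. ?F x \<partial>expo) ^ k"
    by (simp only: of_real_eq_iff)
  have "1 - (\<integral>x. g x \<partial>expo) / \<epsilon> = (\<integral>x. 1 - g x / \<epsilon> \<partial>expo)"
    using int e.prob_space by (subst Bochner_Integration.integral_diff) auto
  also have "\<dots> \<le> (\<integral>x. ?F x \<partial>expo)"
    using int intF by (intro integral_mono) (auto intro: exp_ge_add_one_self[THEN order_trans[rotated]])
  finally have lower: "1 - (\<integral>x. g x \<partial>expo) / \<epsilon> \<le> (\<integral>x. ?F x \<partial>expo)" .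
  have F0: "0 \<le> (\<integral>x. ?F x \<partial>expo)" by simp
  \<comment> \<open>Bernoulli's inequality linearises the power:
    \<open>1 - z^k \<le> k (1 - z)\<close> for \<open>z \<ge> 0\<close>.\<close>
  have "1 + real k * ((\<integral>x. ?F x \<partial>expo) - 1) \<le> (1 + ((\<integral>x. ?F x \<partial>expo) - 1)) ^ k"
    by (rule Bernoulli_inequality) (use F0 in linarith)
  then have "1 - (\<integral>x. ?F x \<partial>expo) ^ k \<le> real k * (1 - (\<integral>x. ?F x \<partial>expo))"
    by (simp add: algebra_simps)
  also have "\<dots> \<le> real k * ((\<integral>x. g x \<partial>expo) / \<epsilon>)"
    using lower by (intro mult_left_mono) auto
  finally have up: "1 - expectation (\<lambda>\<omega>. exp (- S \<omega> / \<epsilon>)) \<le> real k * (\<integral>x. g x \<partial>expo) / \<epsilon>"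
    unfolding E by simp
  have intS: "integrable M (\<lambda>\<omega>. exp (- S \<omega> / \<epsilon>))"
    by (rule integrable_const_bound[of _ 1]) (use S0 \<epsilon> in auto)
  \<comment> \<open>On \<open>S \<ge> \<epsilon>\<close> the variable
    \<open>1 - exp (- S / \<epsilon>)\<close> is at least \<open>1 - exp (- 1)\<close>, the source
    of this constant.\<close>
  have "prob {\<omega> \<in> space M. S \<omega> \<ge> \<epsilon>} * (1 - exp (- 1)) =
      expectation (\<lambda>\<omega>. indicator {\<omega> \<in> space M. S \<omega> \<ge> \<epsilon>} \<omega> * (1 - exp (- 1)))"
    by simp
  also have "\<dots> \<le> expectation (\<lambda>\<omega>. 1 - exp (- S \<omega> / \<epsilon>))"
  proof (rule integral_mono)
    fix \<omega>
    show "indicator {\<omega> \<in> space M. S \<omega> \<ge> \<epsilon>} \<omega> * (1 - exp (- 1)) \<le> 1 - exp (- S \<omega> / \<epsilon>)"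
      using S0[of \<omega>] \<epsilon> by (auto simp: indicator_def)
  next
    show "integrable M (\<lambda>\<omega>. indicator {\<omega> \<in> space M. S \<omega> \<ge> \<epsilon>} \<omega> * (1 - exp (- 1 :: real)))"
      by (intro integrable_mult_left integrable_real_indicator) (auto simp: emeasure_eq_measure)
  qed (use intS in auto)
  also have "\<dots> = 1 - expectation (\<lambda>\<omega>. exp (- S \<omega> / \<epsilon>))"
    using intS by (simp add: prob_space)
  also note up
  finally show ?thesis by (simp add: S_def)
qed

end

section \<open>Limits of powers of characteristic functions\<close>

text \<open>Interpolates between the first and second order Taylor remainders. A second moment would
  be too costly: when \<open>ln k / p\<close> is only slightly above 1, the variance of the
  normalised powers is not beaten by \<open>k\<close>.\<close>

lemma (in real_distribution) char_minus_one_bound: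
  assumes int1: "integrable M (\<lambda>x. x)" and mean: "expectation (\<lambda>x. x) = 0"
    and s: "1 < s" "s \<le> 2" and ints: "integrable M (\<lambda>x. \<bar>x\<bar> powr s)"
  shows "cmod (char M t - 1) \<le> 2 * \<bar>t\<bar> powr s * expectation (\<lambda>x. \<bar>x\<bar> powr s)"
proof (cases "t = 0")
  case True
  then show ?thesis using s by (simp add: char_zero)
next
  case False
  have bound: "min (2 * \<bar>x\<bar> ^ 1 * real (Suc 1)) (\<bar>t\<bar> * \<bar>x\<bar> ^ Suc 1) \<le> 4 * \<bar>t\<bar> powr (s - 1) * \<bar>x\<bar> powr s" for x
  proof (cases "x = 0")
    case x: False
    define y where "y = \<bar>t\<bar> * \<bar>x\<bar>"
    have y: "y > 0" using False x by (simp add: y_def)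
    \<comment> \<open>As \<open>0 < s - 1 \<le> 1\<close>, this power dominates \<open>y\<close> for
      small \<open>y\<close> and 1 for large \<open>y\<close>.\<close>
    have "min 1 y \<le> y powr (s - 1)"
    proof (cases "y \<le> 1")
      case True
      then have "y powr 1 \<le> y powr (s - 1)" using y s by (intro powr_mono') auto
      then show ?thesis using y True by simp
    next
      case False
      then have "1 powr (s - 1) \<le> y powr (s - 1)" using s by (intro powr_mono2) auto
      then show ?thesis using False by simp
    qed
    then have "4 * \<bar>x\<bar> * min 1 y \<le> 4 * \<bar>x\<bar> * y powr (s - 1)"
      by (intro mult_left_mono) auto
    also have "\<dots> = 4 * \<bar>t\<bar> powr (s - 1) * (\<bar>x\<bar> powr 1 * \<bar>x\<bar> powr (s - 1))"
      using x False by (simp add: y_def powr_mult)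
    also have "\<bar>x\<bar> powr 1 * \<bar>x\<bar> powr (s - 1) = \<bar>x\<bar> powr s"
      using powr_add[of "\<bar>x\<bar>" 1 "s - 1"] by (simp only: add_diff_cancel_left' diff_add_cancel add.commute[of 1])
    finally have "4 * \<bar>x\<bar> * min 1 y \<le> 4 * \<bar>t\<bar> powr (s - 1) * \<bar>x\<bar> powr s" .
    moreover have "min (2 * \<bar>x\<bar> ^ 1 * real (Suc 1)) (\<bar>t\<bar> * \<bar>x\<bar> ^ Suc 1) \<le> 4 * \<bar>x\<bar> * min 1 y"
    proof -
      have "min (2 * \<bar>x\<bar> ^ 1 * real (Suc 1)) (\<bar>t\<bar> * \<bar>x\<bar> ^ Suc 1) = \<bar>x\<bar> * min 4 y"
        by (simp add: mult_min_right y_def mult_ac)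
      also have "\<dots> \<le> \<bar>x\<bar> * (4 * min 1 y)"
        using y by (intro mult_left_mono) auto
      finally show ?thesis by (simp add: mult_ac)
    qed
    ultimately show ?thesis by linarith
  qed simp
  have int_k: "integrable M (\<lambda>x. x ^ k)" if "k \<le> 1" for k
    using that int1 by (cases k) auto
  have "cmod (char M t - 1) = cmod (char M t - (\<Sum>k \<le> 1. ((\<i> * t)^k / fact k) * expectation (\<lambda>x. x^k)))"
    using mean prob_space by simp
  also have "\<dots> \<le> (\<bar>t\<bar>^1 / fact (Suc 1)) *
      expectation (\<lambda>x. min (2 * \<bar>x\<bar>^1 * Suc 1) (\<bar>t\<bar> * \<bar>x\<bar>^Suc 1))"
    by (rule char_approx2[OF int_k])
  also have "expectation (\<lambda>x. min (2 * \<bar>x\<bar>^1 * Suc 1) (\<bar>t\<bar> * \<bar>x\<bar>^Suc 1)) \<le>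
      expectation (\<lambda>x. 4 * \<bar>t\<bar> powr (s - 1) * \<bar>x\<bar> powr s)"
  proof (rule integral_mono)
    have "integrable M (\<lambda>x. 4 * \<bar>x\<bar>)" using int1 by auto
    then show "integrable M (\<lambda>x. min (2 * \<bar>x\<bar>^1 * Suc 1) (\<bar>t\<bar> * \<bar>x\<bar>^Suc 1))"
      by (rule Bochner_Integration.integrable_bound) auto
  qed (use ints bound in auto)
  then have "(\<bar>t\<bar>^1 / fact (Suc 1)) * expectation (\<lambda>x. min (2 * \<bar>x\<bar>^1 * Suc 1) (\<bar>t\<bar> * \<bar>x\<bar>^Suc 1)) \<le>
      (\<bar>t\<bar>^1 / fact (Suc 1)) * expectation (\<lambda>x. 4 * \<bar>t\<bar> powr (s - 1) * \<bar>x\<bar> powr s)"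
    by (rule mult_left_mono) simp
  also have "\<dots> = 2 * (\<bar>t\<bar> powr 1 * \<bar>t\<bar> powr (s - 1)) * expectation (\<lambda>x. \<bar>x\<bar> powr s)"
    by simp
  also have "\<bar>t\<bar> powr 1 * \<bar>t\<bar> powr (s - 1) = \<bar>t\<bar> powr s"
    using powr_add[of "\<bar>t\<bar>" 1 "s - 1"] by (simp only: add_diff_cancel_left' diff_add_cancel add.commute[of 1])
  finally show ?thesis .
qed

text \<open>The same interpolation one order higher, between the quadratic and the cubic remainder.
  The order must be free to approach 2, since third moments may be too large when
  \<open>ln k / p\<close> is close to 2.\<close>

lemma (in real_distribution) char_quadratic_bound:
  assumes int1: "integrable M (\<lambda>x. x)" and mean: "expectation (\<lambda>x. x) = 0"
    and int2: "integrable M (\<lambda>x. x\<^sup>2)" and var: "expectation (\<lambda>x. x\<^sup>2) = 1"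
    and s: "2 < s" "s \<le> 3" and ints: "integrable M (\<lambda>x. \<bar>x\<bar> powr s)"
  shows "cmod (char M t - (1 - t\<^sup>2 / 2)) \<le> \<bar>t\<bar> powr s * expectation (\<lambda>x. \<bar>x\<bar> powr s)"
proof (cases "t = 0")
  case True
  then show ?thesis using s by (simp add: char_zero)
next
  case False
  have bound: "min (6 * x\<^sup>2) (\<bar>t\<bar> * \<bar>x\<bar> ^ 3) \<le> 6 * \<bar>t\<bar> powr (s - 2) * \<bar>x\<bar> powr s" for x
  proof (cases "x = 0")
    case x: False
    define y where "y = \<bar>t\<bar> * \<bar>x\<bar>"
    have y: "y > 0" using False x by (simp add: y_def)
    have "min 1 y \<le> y powr (s - 2)"
    proof (cases "y \<le> 1")
      case True
      then have "y powr 1 \<le> y powr (s - 2)" using y s by (intro powr_mono') auto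
      then show ?thesis using y True by simp
    next
      case False
      then have "1 powr (s - 2) \<le> y powr (s - 2)" using s by (intro powr_mono2) auto
      then show ?thesis using False by simp
    qed
    then have "6 * \<bar>x\<bar> ^ 2 * min 1 y \<le> 6 * \<bar>x\<bar> ^ 2 * y powr (s - 2)"
      by (intro mult_left_mono) auto
    also have "\<dots> = 6 * \<bar>t\<bar> powr (s - 2) * (\<bar>x\<bar> powr 2 * \<bar>x\<bar> powr (s - 2))"
      using x False by (simp add: y_def powr_mult)
    also have "\<bar>x\<bar> powr 2 * \<bar>x\<bar> powr (s - 2) = \<bar>x\<bar> powr s"
      using powr_add[of "\<bar>x\<bar>" 2 "s - 2"] by (simp only: diff_add_cancel add.commute[of 2])
    finally have "6 * \<bar>x\<bar> ^ 2 * min 1 y \<le> 6 * \<bar>t\<bar> powr (s - 2) * \<bar>x\<bar> powr s" .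
    moreover have "min (6 * x\<^sup>2) (\<bar>t\<bar> * \<bar>x\<bar> ^ 3) \<le> 6 * \<bar>x\<bar> ^ 2 * min 1 y"
    proof -
      have "min (6 * x\<^sup>2) (\<bar>t\<bar> * \<bar>x\<bar> ^ 3) = \<bar>x\<bar>\<^sup>2 * min 6 y"
      proof (subst mult_min_right)
        have "\<bar>x\<bar> ^ 3 = \<bar>x\<bar>\<^sup>2 * \<bar>x\<bar>" by (simp only: power3_eq_cube power2_eq_square)
        then show "min (6 * x\<^sup>2) (\<bar>t\<bar> * \<bar>x\<bar> ^ 3) = min (\<bar>x\<bar>\<^sup>2 * 6) (\<bar>x\<bar>\<^sup>2 * y)"
          by (simp add: y_def mult_ac)
      qed simp
      also have "\<dots> \<le> \<bar>x\<bar>\<^sup>2 * (6 * min 1 y)"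
        using y by (intro mult_left_mono) auto
      finally show ?thesis by (simp add: mult_ac)
    qed
    ultimately show ?thesis by linarith
  qed simp
  have "cmod (char M t - (1 - t\<^sup>2 * 1 / 2)) \<le>
      (t\<^sup>2 / 6) * expectation (\<lambda>x. min (6 * x\<^sup>2) (\<bar>t\<bar> * \<bar>x\<bar>^3))"
    using char_approx3[OF int1 mean int2, of 1 t] var mean by simp
  also have "expectation (\<lambda>x. min (6 * x\<^sup>2) (\<bar>t\<bar> * \<bar>x\<bar>^3)) \<le>
      expectation (\<lambda>x. 6 * \<bar>t\<bar> powr (s - 2) * \<bar>x\<bar> powr s)"
  proof (rule integral_mono)
    have "integrable M (\<lambda>x. 6 * x\<^sup>2)" using int2 by auto
    then show "integrable M (\<lambda>x. min (6 * x\<^sup>2) (\<bar>t\<bar> * \<bar>x\<bar>^3))"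
      by (rule Bochner_Integration.integrable_bound) auto
  qed (use ints bound in auto)
  then have "(t\<^sup>2 / 6) * expectation (\<lambda>x. min (6 * x\<^sup>2) (\<bar>t\<bar> * \<bar>x\<bar>^3)) \<le>
      (t\<^sup>2 / 6) * expectation (\<lambda>x. 6 * \<bar>t\<bar> powr (s - 2) * \<bar>x\<bar> powr s)"
    by (rule mult_left_mono) simp
  also have "\<dots> = (\<bar>t\<bar> powr 2 * \<bar>t\<bar> powr (s - 2)) * expectation (\<lambda>x. \<bar>x\<bar> powr s)"
    using False by simp
  also have "\<bar>t\<bar> powr 2 * \<bar>t\<bar> powr (s - 2) = \<bar>t\<bar> powr s"
    using powr_add[of "\<bar>t\<bar>" 2 "s - 2"] by (simp only: diff_add_cancel add.commute[of 2])
  finally show ?thesis by simp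
qed

text \<open>On the unit disc \<open>|z^k - 1| \<le> k |z - 1|\<close>, and
  \<open>k (|t| / k)^s\<close> is \<open>|t|^s k^(1 - s)\<close>. The law may change with
  \<open>n\<close>, as required by an exponent depending on \<open>n\<close>.\<close>

lemma char_power_LLN:
  fixes \<mu> :: "nat \<Rightarrow> real measure" and k :: "nat \<Rightarrow> nat"
  assumes \<mu>: "\<And>n. real_distribution (\<mu> n)"
    and int1: "\<And>n. integrable (\<mu> n) (\<lambda>x. x)" and mean: "\<And>n. (\<integral>x. x \<partial>\<mu> n) = 0"
    and s: "1 < s" "s \<le> 2" and ints: "\<And>n. integrable (\<mu> n) (\<lambda>x. \<bar>x\<bar> powr s)"
    and k: "filterlim k at_top sequentially"
    and lim: "(\<lambda>n. real (k n) powr (1 - s) * (\<integral>x. \<bar>x\<bar> powr s \<partial>\<mu> n)) \<longlonglongrightarrow> 0"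
  shows "(\<lambda>n. char (\<mu> n) (t / real (k n)) ^ k n) \<longlonglongrightarrow> 1"
proof -
  have "(\<lambda>n. char (\<mu> n) (t / real (k n)) ^ k n - 1) \<longlonglongrightarrow> 0"
  proof (rule Lim_null_comparison)
    show "(\<lambda>n. 2 * \<bar>t\<bar> powr s * (real (k n) powr (1 - s) * (\<integral>x. \<bar>x\<bar> powr s \<partial>\<mu> n))) \<longlonglongrightarrow> 0"
      by (rule tendsto_mult_right_zero[OF lim])
    have "\<forall>\<^sub>F n in sequentially. k n > 0"
      by (rule eventually_compose_filterlim[OF eventually_gt_at_top k])
    then show "\<forall>\<^sub>F n in sequentially. norm (char (\<mu> n) (t / real (k n)) ^ k n - 1) \<le>
        2 * \<bar>t\<bar> powr s * (real (k n) powr (1 - s) * (\<integral>x. \<bar>x\<bar> powr s \<partial>\<mu> n))"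
    proof eventually_elim
      case (elim n)
      interpret real_distribution "\<mu> n" by (rule \<mu>)
      have "norm (char (\<mu> n) (t / real (k n)) ^ k n - 1 ^ k n) \<le> k n * norm (char (\<mu> n) (t / real (k n)) - 1)"
        by (rule norm_power_diff) (auto simp: cmod_char_le_1)
      also have "\<dots> \<le> k n * (2 * \<bar>t / real (k n)\<bar> powr s * (\<integral>x. \<bar>x\<bar> powr s \<partial>\<mu> n))"
        by (intro mult_left_mono char_minus_one_bound int1 mean s ints) auto
      also have "\<dots> = 2 * \<bar>t\<bar> powr s * ((real (k n) powr 1 / real (k n) powr s) * (\<integral>x. \<bar>x\<bar> powr s \<partial>\<mu> n))"
        using elim by (simp add: powr_divide)
      also have "real (k n) powr 1 / real (k n) powr s = real (k n) powr (1 - s)"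
        by (simp only: powr_diff)
      finally show ?case by simp
    qed
  qed
  then show ?thesis using Lim_null by blast
qed

text \<open>Comparison with \<open>(1 - t^2 / (2 k))^k\<close> by the inequality for differences of
  \<open>k\<close>-th powers on the unit disc; the error is \<open>k (|t| / sqrt k)^s\<close> times
  the moment.\<close>

lemma char_power_CLT:
  fixes \<mu> :: "nat \<Rightarrow> real measure" and k :: "nat \<Rightarrow> nat"
  assumes \<mu>: "\<And>n. real_distribution (\<mu> n)"
    and int1: "\<And>n. integrable (\<mu> n) (\<lambda>x. x)" and mean: "\<And>n. (\<integral>x. x \<partial>\<mu> n) = 0"
    and int2: "\<And>n. integrable (\<mu> n) (\<lambda>x. x\<^sup>2)" and var: "\<And>n. (\<integral>x. x\<^sup>2 \<partial>\<mu> n) = 1"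
    and s: "2 < s" "s \<le> 3" and ints: "\<And>n. integrable (\<mu> n) (\<lambda>x. \<bar>x\<bar> powr s)"
    and k: "filterlim k at_top sequentially"
    and lim: "(\<lambda>n. real (k n) powr (1 - s / 2) * (\<integral>x. \<bar>x\<bar> powr s \<partial>\<mu> n)) \<longlonglongrightarrow> 0"
  shows "(\<lambda>n. char (\<mu> n) (t / sqrt (real (k n))) ^ k n) \<longlonglongrightarrow> exp (- t\<^sup>2 / 2)"
proof -
  let ?a = "\<lambda>n. complex_of_real (1 + (- t\<^sup>2 / 2) / real (k n))"
  have diff: "(\<lambda>n. char (\<mu> n) (t / sqrt (real (k n))) ^ k n - ?a n ^ k n) \<longlonglongrightarrow> 0"
  proof (rule Lim_null_comparison)
    show "(\<lambda>n. \<bar>t\<bar> powr s * (real (k n) powr (1 - s / 2) * (\<integral>x. \<bar>x\<bar> powr s \<partial>\<mu> n))) \<longlonglongrightarrow> 0"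
      by (rule tendsto_mult_right_zero[OF lim])
    \<comment> \<open>Once \<open>k \<ge> t^2\<close>, the number \<open>1 - t^2 / (2 k)\<close> has
      modulus at most 1, as the inequality for differences of powers demands.\<close>
    have "\<forall>\<^sub>F n in sequentially. k n > nat \<lceil>t\<^sup>2\<rceil>"
      by (rule eventually_compose_filterlim[OF eventually_gt_at_top k])
    then show "\<forall>\<^sub>F n in sequentially. norm (char (\<mu> n) (t / sqrt (real (k n))) ^ k n - ?a n ^ k n) \<le>
        \<bar>t\<bar> powr s * (real (k n) powr (1 - s / 2) * (\<integral>x. \<bar>x\<bar> powr s \<partial>\<mu> n))"
    proof eventually_elim
      case (elim n)
      interpret real_distribution "\<mu> n" by (rule \<mu>)
      have k0: "k n > 0" and kt: "t\<^sup>2 \<le> real (k n)" using elim by linarith+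
      have a1: "norm (?a n) \<le> 1"
        unfolding norm_of_real using k0 kt by (intro abs_leI) (auto simp: field_simps)
      have a_eq: "?a n = 1 - (t / sqrt (real (k n)))\<^sup>2 / 2"
        using k0 by (simp add: power_divide)
      have "norm (char (\<mu> n) (t / sqrt (real (k n))) ^ k n - ?a n ^ k n) \<le>
          k n * norm (char (\<mu> n) (t / sqrt (real (k n))) - ?a n)"
        by (rule norm_power_diff) (use a1 in \<open>auto simp: cmod_char_le_1\<close>)
      also have "\<dots> \<le> k n * (\<bar>t / sqrt (real (k n))\<bar> powr s * (\<integral>x. \<bar>x\<bar> powr s \<partial>\<mu> n))"
        unfolding a_eq by (intro mult_left_mono char_quadratic_bound int1 mean int2 var s ints) auto
      also have "\<dots> = \<bar>t\<bar> powr s * ((real (k n) powr 1 / real (k n) powr (s / 2)) * (\<integral>x. \<bar>x\<bar> powr s \<partial>\<mu> n))"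
        using k0 by (simp add: powr_divide powr_half_sqrt[symmetric] powr_powr)
      also have "real (k n) powr 1 / real (k n) powr (s / 2) = real (k n) powr (1 - s / 2)"
        by (simp only: powr_diff)
      finally show ?case by simp
    qed
  qed
  have "(\<lambda>n. (1 + (- t\<^sup>2 / 2) / real (k n)) ^ k n) \<longlonglongrightarrow> exp (- t\<^sup>2 / 2)"
    by (rule filterlim_compose[OF tendsto_exp_limit_sequentially k])
  then have "(\<lambda>n. ?a n ^ k n) \<longlonglongrightarrow> complex_of_real (exp (- t\<^sup>2 / 2))"
    by (simp only: of_real_power[symmetric] tendsto_of_real_iff)
  from tendsto_add[OF diff this] show ?thesis by simp
qed

section \<open>Exponential moments and the Gamma function\<close>

lemma nn_integral_expo:
  assumes [measurable]: "f \<in> borel_measurable borel"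
  shows "(\<integral>\<^sup>+x. ennreal (f x) \<partial>expo) = (\<integral>\<^sup>+x. ennreal (indicator {0..} x * exp (- x) * f x) \<partial>lborel)"
  by (subst nn_integral_density)
    (auto intro!: nn_integral_cong simp: exponential_density_def indicator_def ennreal_mult')

lemma expo_moment:
  assumes q: "0 \<le> q"
  shows "has_bochner_integral expo (\<lambda>x. x powr q) (Gamma (q + 1))"
proof (rule has_bochner_integral_nn_integral)
  show "(\<integral>\<^sup>+x. ennreal (x powr q) \<partial>expo) = ennreal (Gamma (q + 1))"
    using q by (subst nn_integral_expo, simp, subst Gamma_conv_nn_integral_real)
      (auto intro!: nn_integral_cong simp: exp_minus field_simps)
qed (use q in \<open>auto intro!: less_imp_le Gamma_real_pos\<close>)

text \<open>Substituting \<open>y = x + c\<close> changes the weight \<open>exp (- x)\<close> into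
  \<open>exp c * exp (- y)\<close>. The shift thus costs the factor \<open>exp c\<close> only,
  uniformly in \<open>q\<close>, which matters because \<open>q\<close> tends to infinity.\<close>

lemma expo_shifted_moment:
  assumes q: "0 \<le> q" and c: "0 \<le> c"
  shows "integrable expo (\<lambda>x. (x + c) powr q)"
    and "(\<integral>x. (x + c) powr q \<partial>expo) \<le> exp c * Gamma (q + 1)"
proof -
  let ?h = "\<lambda>y. indicator {c..} y * exp (- (y - c)) * y powr q"
  have "(\<integral>\<^sup>+x. ennreal ((x + c) powr q) \<partial>expo) =
      (\<integral>\<^sup>+x. ennreal (indicator {0..} x * exp (- x) * (x + c) powr q) \<partial>lborel)"
    by (rule nn_integral_expo) simp
  also have "\<dots> = (\<integral>\<^sup>+x. ennreal (?h (c + 1 * x)) \<partial>lborel)"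
    by (intro nn_integral_cong) (auto simp: indicator_def add.commute)
  also have "\<dots> = (\<integral>\<^sup>+y. ennreal (?h y) \<partial>lborel)"
    using nn_integral_real_affine[of "\<lambda>y. ennreal (?h y)" 1 c] by simp
  also have "\<dots> \<le> (\<integral>\<^sup>+y. ennreal (exp c) * ennreal (indicator {0..} y * exp (- y) * y powr q) \<partial>lborel)"
    using c by (intro nn_integral_mono)
      (auto simp: indicator_def exp_diff exp_minus field_simps simp flip: ennreal_mult'')
  also have "\<dots> = ennreal (exp c) * (\<integral>\<^sup>+x. ennreal (x powr q) \<partial>expo)"
    by (subst nn_integral_cmult) (auto simp: nn_integral_expo)
  also have "(\<integral>\<^sup>+x. ennreal (x powr q) \<partial>expo) = ennreal (Gamma (q + 1))"
    using expo_moment[OF q] by (subst nn_integral_eq_integral)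
      (auto simp: has_bochner_integral_iff)
  finally have le: "(\<integral>\<^sup>+x. ennreal ((x + c) powr q) \<partial>expo) \<le> ennreal (exp c * Gamma (q + 1))"
    using c by (subst ennreal_mult') auto
  show int: "integrable expo (\<lambda>x. (x + c) powr q)"
    using le by (intro integrableI_bounded) (auto simp: less_top[symmetric] top_unique)
  have G: "0 \<le> exp c * Gamma (q + 1)"
    using q by (auto intro!: less_imp_le Gamma_real_pos)
  show "(\<integral>x. (x + c) powr q \<partial>expo) \<le> exp c * Gamma (q + 1)"
    using le G by (subst (asm) nn_integral_eq_integral[OF int]) auto
qed

text \<open>Lower half of Stirling: an exponential variable exceeds \<open>q\<close> with
  probability \<open>exp (- q)\<close>, and there its \<open>q\<close>-th power is at least
  \<open>q powr q\<close>.\<close>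

lemma Gamma_ge_powr_self:
  fixes q :: real
  assumes q: "0 < q"
  shows "q powr q * exp (- q) \<le> Gamma (q + 1)"
proof -
  interpret e: prob_space expo by (rule prob_space_expo)
  have "e.prob {x \<in> space expo. q < x} = exp (- q * 1)"
  proof (rule e.exponential_distributedD_gt)
    show "distributed expo lborel (\<lambda>x. x) (exponential_density 1)"
      by (auto simp: distributed_def exponential_density_def intro!: distr_id2[THEN trans] density_cong)
  qed (use q in auto)
  then have "q powr q * exp (- q) = (\<integral>x. q powr q * indicator {x \<in> space expo. q < x} x \<partial>expo)"
    by simp
  also have "\<dots> \<le> (\<integral>x. x powr q \<partial>expo)"
  proof (rule integral_mono)
    show "integrable expo (\<lambda>x. q powr q * indicator {x \<in> space expo. q < x} x)"
      by (intro integrable_mult_right integrable_real_indicator) (auto simp: e.emeasure_eq_measure)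
    show "integrable expo (\<lambda>x. x powr q)"
      using expo_moment[of q] q by (simp add: has_bochner_integral_iff)
    show "q powr q * indicator {x \<in> space expo. q < x} x \<le> x powr q" for x
      using q by (auto simp: indicator_def intro!: powr_mono2)
  qed
  also have "\<dots> = Gamma (q + 1)"
    using expo_moment[of q] q by (simp add: has_bochner_integral_iff)
  finally show ?thesis .
qed

text \<open>Upper half of Stirling: \<open>x powr q * exp (- c * x)\<close> is maximal at
  \<open>x = q / c\<close>, and the remaining weight \<open>exp (- (1 - c) * x)\<close> has integral
  \<open>1 / (1 - c)\<close>. The loss \<open>c powr (- q)\<close> has an arbitrarily small
  exponential rate as \<open>c\<close> approaches 1.\<close>

lemma Gamma_le_powr_self:
  fixes q c :: real
  assumes q: "0 < q" and c: "0 < c" "c < 1"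
  shows "Gamma (q + 1) \<le> (q / c) powr q * exp (- q) / (1 - c)"
proof -
  interpret e: prob_space "density lborel (exponential_density (1 - c))"
    by (rule prob_space_exponential_density) (use c in simp)
  let ?K = "(q / c) powr q * exp (- q)"
  have bound: "x powr q \<le> ?K * exp (c * x)" if "0 \<le> x" for x
  proof (cases "x = 0")
    case False
    then have x: "0 < x" using that by simp
    \<comment> \<open>The tangent of \<open>ln\<close> at 1, attained at the maximiser
      \<open>x = q / c\<close>.\<close>
    have "ln (x * c / q) \<le> x * c / q - 1"
      using x c q by (intro ln_le_minus_one) auto
    then have "q * ln (x * c / q) \<le> x * c - q"
      using q by (simp add: field_simps)
    then have "q * ln x \<le> q * ln (q / c) - q + c * x"
      using x c q by (simp add: ln_div ln_mult algebra_simps)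
    then have "exp (q * ln x) \<le> exp (q * ln (q / c) - q + c * x)" by simp
    then show ?thesis using x c q by (simp add: powr_def exp_add exp_diff exp_minus field_simps)
  qed simp
  have "ennreal (Gamma (q + 1)) = (\<integral>\<^sup>+x. ennreal (x powr q) \<partial>expo)"
    using expo_moment[of q] q by (subst nn_integral_eq_integral) (auto simp: has_bochner_integral_iff)
  also have "\<dots> = (\<integral>\<^sup>+x. ennreal (indicator {0..} x * exp (- x) * x powr q) \<partial>lborel)"
    by (rule nn_integral_expo) simp
  also have "\<dots> \<le> (\<integral>\<^sup>+x. ennreal (?K / (1 - c)) * ennreal (exponential_density (1 - c) x) \<partial>lborel)"
  proof (rule nn_integral_mono)
    fix x :: real
    show "ennreal (indicator {0..} x * exp (- x) * x powr q) \<le>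
        ennreal (?K / (1 - c)) * ennreal (exponential_density (1 - c) x)"
    proof (cases "0 \<le> x")
      case True
      have "exp (- x) * x powr q \<le> exp (- x) * (?K * exp (c * x))"
        by (intro mult_left_mono bound True) auto
      also have "\<dots> = ?K / (1 - c) * ((1 - c) * exp (- x * (1 - c)))"
        using c by (simp add: algebra_simps exp_diff exp_minus field_simps)
      finally show ?thesis using True c
        by (simp add: exponential_density_def ennreal_mult''[symmetric] ennreal_leI del: times_divide_eq_left)
    qed simp
  qed
  also have "\<dots> = ennreal (?K / (1 - c)) * emeasure (density lborel (exponential_density (1 - c))) UNIV"
    by (subst nn_integral_cmult) (auto simp: emeasure_density)
  also have "\<dots> = ennreal (?K / (1 - c))"
    using e.emeasure_space_1 by simp
  finally show ?thesis
    using c by (subst (asm) ennreal_le_iff) auto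
qed

text \<open>The terms \<open>q ln q - q\<close> of the two Stirling bounds cancel. What remains is
  proportional to \<open>s - 1\<close>, as is the exponent of \<open>k powr (1 - s)\<close>, so only
  \<open>s\<^sup>2\<close> has to be compared with the growth rate of \<open>ln k\<close>.\<close>

lemma Gamma_ratio_bound:
  fixes q s :: real
  assumes q: "0 < q" and s: "1 < s"
  shows "Gamma (s * q + 1) / Gamma (q + 1) powr s \<le> exp (q * (s - 1) * s\<^sup>2) / (1 - exp (- (s - 1)\<^sup>2))"
proof -
  \<comment> \<open>With this choice the loss is \<open>s q (s - 1)^2\<close>; together with
    \<open>s q ln s \<le> s q (s - 1)\<close> it gives exactly \<open>q (s - 1) s^2\<close>.\<close>
  define c where "c = exp (- (s - 1)\<^sup>2)"
  have c: "0 < c" "c < 1" using s by (auto simp: c_def)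
  have G: "Gamma (q + 1) > 0" using q by (intro Gamma_real_pos) simp
  have "exp (s * (q * ln q - q)) = (q powr q * exp (- q)) powr s"
    using q by (simp add: powr_def ln_mult exp_add[symmetric] algebra_simps)
  also have "\<dots> \<le> Gamma (q + 1) powr s"
    using s by (intro powr_mono2 Gamma_ge_powr_self q) auto
  finally have lower: "exp (s * (q * ln q - q)) \<le> Gamma (q + 1) powr s" .
  have "Gamma (s * q + 1) \<le> (s * q / c) powr (s * q) * exp (- (s * q)) / (1 - c)"
    using q s c by (intro Gamma_le_powr_self) auto
  also have "(s * q / c) powr (s * q) * exp (- (s * q)) = exp (s * q * (ln s + ln q + (s - 1)\<^sup>2) - s * q)"
    using q s c by (simp add: powr_def ln_mult ln_div exp_diff exp_minus field_simps c_def)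
  also have "s * q * (ln s + ln q + (s - 1)\<^sup>2) - s * q \<le> s * q * ((s - 1) + ln q + (s - 1)\<^sup>2) - s * q"
    using q s ln_le_minus_one[of s] by (intro diff_right_mono mult_left_mono add_right_mono) auto
  also have "\<dots> = s * (q * ln q - q) + q * (s - 1) * s\<^sup>2"
    by (simp add: power2_eq_square algebra_simps)
  finally have upper: "Gamma (s * q + 1) \<le> exp (s * (q * ln q - q) + q * (s - 1) * s\<^sup>2) / (1 - c)"
    using c by (simp add: divide_right_mono)
  have "Gamma (s * q + 1) / Gamma (q + 1) powr s \<le>
      (exp (s * (q * ln q - q) + q * (s - 1) * s\<^sup>2) / (1 - c)) / exp (s * (q * ln q - q))"
    using upper lower c by (intro frac_le) auto
  also have "\<dots> = exp (q * (s - 1) * s\<^sup>2) / (1 - c)"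
    by (simp add: exp_add)
  finally show ?thesis by (simp add: c_def)
qed

text \<open>Squaring doubles the argument: \<open>(2 p) powr p\<close> in the square root stands
  against \<open>p powr p\<close> in the numerator, which leaves the decay
  \<open>2 powr (- p)\<close> up to the loss from \<open>c\<close>.\<close>

lemma Gamma_square_ratio_bound:
  fixes p c :: real
  assumes p: "0 < p" and c: "0 < c" "c < 1"
  shows "Gamma (p + 1) / sqrt (Gamma (2 * p + 1)) \<le> (2 * c) powr (- p) / (1 - c)"
proof -
  have "exp (p * ln (2 * p) - p) \<le> sqrt (Gamma (2 * p + 1))"
  proof (rule real_le_rsqrt)
    have "(exp (p * ln (2 * p) - p))\<^sup>2 = (2 * p) powr (2 * p) * exp (- (2 * p))"
      using p by (simp add: powr_def power2_eq_square exp_add[symmetric] algebra_simps)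
    also have "\<dots> \<le> Gamma (2 * p + 1)" using p by (intro Gamma_ge_powr_self) simp
    finally show "(exp (p * ln (2 * p) - p))\<^sup>2 \<le> Gamma (2 * p + 1)" .
  qed
  then have "Gamma (p + 1) / sqrt (Gamma (2 * p + 1)) \<le>
      ((p / c) powr p * exp (- p) / (1 - c)) / exp (p * ln (2 * p) - p)"
    using p c by (intro frac_le Gamma_le_powr_self) (auto intro!: divide_nonneg_pos)
  also have "\<dots> = (2 * c) powr (- p) / (1 - c)"
    using p c by (simp add: powr_def ln_mult ln_div exp_diff exp_minus exp_add field_simps)
  finally show ?thesis .
qed

text \<open>Growth gives \<open>k powr (1 - s) \<le> exp (- (s - 1) \<beta> q)\<close>, and the
  Gamma ratio is at most a constant times \<open>exp ((s - 1) s^2 q)\<close>; the condition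
  \<open>s\<^sup>2 < \<beta>\<close> makes the product decay.\<close>

lemma Gamma_Lyapunov:
  fixes k :: "nat \<Rightarrow> nat" and q :: "nat \<Rightarrow> real"
  assumes q: "filterlim q at_top sequentially" and k: "filterlim k at_top sequentially"
    and growth: "\<forall>\<^sub>F n in sequentially. \<beta> * q n \<le> ln (real (k n))"
    and s: "1 < s" "s\<^sup>2 < \<beta>"
  shows "(\<lambda>n. real (k n) powr (1 - s) * (Gamma (s * q n + 1) / Gamma (q n + 1) powr s)) \<longlonglongrightarrow> 0"
proof (rule Lim_null_comparison)
  let ?K = "1 / (1 - exp (- (s - 1)\<^sup>2))"
  have "filterlim (\<lambda>n. - ((s - 1) * (\<beta> - s\<^sup>2)) * q n) at_bot sequentially"
    using s by (intro filterlim_tendsto_neg_mult_at_bot[OF tendsto_const _ q]) auto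
  then have "(\<lambda>n. exp (- ((s - 1) * (\<beta> - s\<^sup>2)) * q n)) \<longlonglongrightarrow> 0"
    by (rule filterlim_compose[OF exp_at_bot])
  then show "(\<lambda>n. ?K * exp (- ((s - 1) * (\<beta> - s\<^sup>2)) * q n)) \<longlonglongrightarrow> 0"
    by (rule tendsto_mult_right_zero)
  have "\<forall>\<^sub>F n in sequentially. q n > 0"
    by (rule eventually_compose_filterlim[OF eventually_gt_at_top q])
  moreover have "\<forall>\<^sub>F n in sequentially. k n > 0"
    by (rule eventually_compose_filterlim[OF eventually_gt_at_top k])
  ultimately show "\<forall>\<^sub>F n in sequentially. norm (real (k n) powr (1 - s) * (Gamma (s * q n + 1) / Gamma (q n + 1) powr s))
      \<le> ?K * exp (- ((s - 1) * (\<beta> - s\<^sup>2)) * q n)"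
    using growth
  proof eventually_elim
    case (elim n)
    have G: "Gamma (s * q n + 1) > 0" "Gamma (q n + 1) > 0"
      using elim s by (auto intro!: Gamma_real_pos add_pos_pos)
    have "real (k n) powr (1 - s) = exp ((1 - s) * ln (real (k n)))"
      using elim by (simp add: powr_def)
    also have "\<dots> \<le> exp ((1 - s) * (\<beta> * q n))"
      using elim s by (auto intro!: mult_left_mono_neg)
    finally have "real (k n) powr (1 - s) * (Gamma (s * q n + 1) / Gamma (q n + 1) powr s) \<le>
        exp ((1 - s) * (\<beta> * q n)) * (exp (q n * (s - 1) * s\<^sup>2) * ?K)"
      using Gamma_ratio_bound[of "q n" s] elim s G by (intro mult_mono) auto
    also have "\<dots> = ?K * exp (- ((s - 1) * (\<beta> - s\<^sup>2)) * q n)"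
      by (simp add: exp_add[symmetric] algebra_simps)
    finally show ?case using G by simp
  qed
qed

lemma abs_diff_powr_le:
  fixes x y s :: real
  assumes "0 \<le> x" "0 \<le> y" "0 < s"
  shows "\<bar>x - y\<bar> powr s \<le> x powr s + y powr s"
proof -
  have "\<bar>x - y\<bar> powr s \<le> max x y powr s"
    using assms by (intro powr_mono2) auto
  also have "\<dots> \<le> x powr s + y powr s" by (auto simp: max_def)
  finally show ?thesis .
qed

text \<open>Makes the variance of the \<open>p\<close>-th power comparable to its second moment, so
  that \<open>sigma_const\<close> can be replaced by a single Gamma value.\<close>

lemma Gamma_square_le_half:
  fixes p :: real
  assumes p: "5 \<le> p"
  shows "(Gamma (p + 1))\<^sup>2 \<le> Gamma (2 * p + 1) / 2"
proof -
  have G: "Gamma (p + 1) > 0" "Gamma (2 * p + 1) > 0"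
    using p by (auto intro!: Gamma_real_pos)
  \<comment> \<open>With \<open>c = 3/4\<close> the bound is \<open>4 (2/3)^p\<close>; at
    \<open>p = 5\<close> it is 128/243, and the square of 7/10 is still below 1/2.\<close>
  have "Gamma (p + 1) / sqrt (Gamma (2 * p + 1)) \<le> (2 * (3/4)) powr (- p) / (1 - 3/4)"
    using p by (intro Gamma_square_ratio_bound) auto
  also have "\<dots> \<le> (2 * (3/4)) powr (- 5) / (1 - 3/4)"
    using p by (intro divide_right_mono powr_mono) auto
  also have "\<dots> \<le> 7 / 10"
    by (simp add: powr_minus powr_numeral) (simp add: power_divide eval_nat_numeral)
  finally have "(Gamma (p + 1) / sqrt (Gamma (2 * p + 1)))\<^sup>2 \<le> (7 / 10)\<^sup>2"
    using G by (intro power_mono) auto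
  then have "(Gamma (p + 1))\<^sup>2 / Gamma (2 * p + 1) \<le> (7 / 10)\<^sup>2"
    using G by (simp only: power_divide real_sqrt_pow2 less_imp_le)
  also have "\<dots> \<le> (1 / 2 :: real)" by (simp add: power_divide)
  finally show ?thesis using G by (simp add: field_simps)
qed

text \<open>The scale \<open>d\<close> is free: the mean for the law of large numbers, the standard
  deviation for the central limit theorem.\<close>

lemma expo_centered_powr:
  assumes p: "0 \<le> p" and s: "1 \<le> s" and d: "0 < d"
  shows "integrable expo (\<lambda>x. (x powr p - Gamma (p + 1)) / d)"
    and "(\<integral>x. (x powr p - Gamma (p + 1)) / d \<partial>expo) = 0"
    and "integrable expo (\<lambda>x. \<bar>(x powr p - Gamma (p + 1)) / d\<bar> powr s)"
    and "(\<integral>x. \<bar>(x powr p - Gamma (p + 1)) / d\<bar> powr s \<partial>expo) \<le>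
      (Gamma (s * p + 1) + Gamma (p + 1) powr s) / d powr s"
proof -
  interpret e: prob_space expo by (rule prob_space_expo)
  have G: "Gamma (p + 1) > 0" using p by (intro Gamma_real_pos) simp
  have ip: "integrable expo (\<lambda>x. x powr p)" and mp: "(\<integral>x. x powr p \<partial>expo) = Gamma (p + 1)"
    using expo_moment[OF p] by (auto simp: has_bochner_integral_iff)
  have isp: "integrable expo (\<lambda>x. x powr (s * p))" and msp: "(\<integral>x. x powr (s * p) \<partial>expo) = Gamma (s * p + 1)"
    using expo_moment[of "s * p"] p s by (auto simp: has_bochner_integral_iff)
  show "integrable expo (\<lambda>x. (x powr p - Gamma (p + 1)) / d)" using ip by simp
  show "(\<integral>x. (x powr p - Gamma (p + 1)) / d \<partial>expo) = 0"
    using ip mp e.prob_space by simp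
  let ?b = "\<lambda>x. (x powr (s * p) + Gamma (p + 1) powr s) / d powr s"
  have ib: "integrable expo ?b" using isp by simp
  have bound: "\<bar>(x powr p - Gamma (p + 1)) / d\<bar> powr s \<le> ?b x" for x
  proof -
    have "\<bar>(x powr p - Gamma (p + 1)) / d\<bar> powr s = \<bar>x powr p - Gamma (p + 1)\<bar> powr s / d powr s"
      using d by (simp add: powr_divide)
    also have "\<dots> \<le> ((x powr p) powr s + Gamma (p + 1) powr s) / d powr s"
      using G s by (intro divide_right_mono abs_diff_powr_le) auto
    finally show ?thesis by (simp add: powr_powr mult.commute)
  qed
  show i: "integrable expo (\<lambda>x. \<bar>(x powr p - Gamma (p + 1)) / d\<bar> powr s)"
    by (rule Bochner_Integration.integrable_bound[OF ib]) (use bound in \<open>auto intro: order_trans[OF _ abs_ge_self]\<close>)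
  have "(\<integral>x. \<bar>(x powr p - Gamma (p + 1)) / d\<bar> powr s \<partial>expo) \<le> (\<integral>x. ?b x \<partial>expo)"
    by (rule integral_mono[OF i ib bound])
  also have "\<dots> = (Gamma (s * p + 1) + Gamma (p + 1) powr s) / d powr s"
    using isp msp e.prob_space by simp
  finally show "(\<integral>x. \<bar>(x powr p - Gamma (p + 1)) / d\<bar> powr s \<partial>expo) \<le>
      (Gamma (s * p + 1) + Gamma (p + 1) powr s) / d powr s" .
qed

text \<open>Here \<open>d\<close> is \<open>sigma_const\<close> without its factor
  \<open>\<gamma> powr p\<close>.\<close>

lemma expo_powr_variance:
  fixes p :: real
  assumes p: "5 \<le> p"
  defines "d \<equiv> sqrt (Gamma (2 * p + 1) - (Gamma (p + 1))\<^sup>2)"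
  shows "0 < d" "Gamma (2 * p + 1) \<le> 2 * d\<^sup>2"
    and "integrable expo (\<lambda>x. ((x powr p - Gamma (p + 1)) / d)\<^sup>2)"
    and "(\<integral>x. ((x powr p - Gamma (p + 1)) / d)\<^sup>2 \<partial>expo) = 1"
proof -
  interpret e: prob_space expo by (rule prob_space_expo)
  have G: "Gamma (2 * p + 1) > 0" using p by (intro Gamma_real_pos) simp
  have half: "Gamma (2 * p + 1) / 2 \<le> Gamma (2 * p + 1) - (Gamma (p + 1))\<^sup>2"
    using Gamma_square_le_half[OF p] by simp
  then have d2: "d\<^sup>2 = Gamma (2 * p + 1) - (Gamma (p + 1))\<^sup>2"
    unfolding d_def using G by (intro real_sqrt_pow2) simp
  show d: "0 < d" unfolding d_def using half G by simp
  show "Gamma (2 * p + 1) \<le> 2 * d\<^sup>2" using half d2 by simp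
  have ip: "integrable expo (\<lambda>x. x powr p)" and mp: "(\<integral>x. x powr p \<partial>expo) = Gamma (p + 1)"
    using expo_moment[of p] p by (auto simp: has_bochner_integral_iff)
  have i2p: "integrable expo (\<lambda>x. x powr (2 * p))" and m2p: "(\<integral>x. x powr (2 * p) \<partial>expo) = Gamma (2 * p + 1)"
    using expo_moment[of "2 * p"] p by (auto simp: has_bochner_integral_iff)
  have eq: "((x powr p - Gamma (p + 1)) / d)\<^sup>2 =
      (x powr (2 * p) - 2 * Gamma (p + 1) * x powr p + (Gamma (p + 1))\<^sup>2) / d\<^sup>2" for x
  proof -
    have "(x powr p)\<^sup>2 = x powr (2 * p)" by (simp add: power2_eq_square flip: powr_add)
    then show ?thesis by (simp add: power_divide power2_diff mult_ac)
  qed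
  show "integrable expo (\<lambda>x. ((x powr p - Gamma (p + 1)) / d)\<^sup>2)"
    unfolding eq using ip i2p by simp
  have "(\<integral>x. x powr (2 * p) - 2 * Gamma (p + 1) * x powr p + (Gamma (p + 1))\<^sup>2 \<partial>expo) = d\<^sup>2"
    using ip i2p mp m2p e.prob_space d2 by (simp add: power2_eq_square)
  then show "(\<integral>x. ((x powr p - Gamma (p + 1)) / d)\<^sup>2 \<partial>expo) = 1"
    unfolding eq using d by simp
qed

lemma real_distribution_distr_expo:
  "g \<in> borel_measurable borel \<Longrightarrow> real_distribution (distr expo borel g)"
  using prob_space.real_distribution_distr[OF prob_space_expo, of g] by simp

lemma char_powr_LLN:
  fixes k :: "nat \<Rightarrow> nat" and p :: "nat \<Rightarrow> real"
  assumes p: "\<And>n. 5 \<le> p n" "filterlim p at_top sequentially"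
    and k: "filterlim k at_top sequentially"
    and growth: "\<forall>\<^sub>F n in sequentially. \<beta> * p n \<le> ln (real (k n))" and \<beta>: "1 < \<beta>"
  shows "(\<lambda>n. char (distr expo borel (\<lambda>x. (x powr p n - Gamma (p n + 1)) / Gamma (p n + 1)))
      (t / real (k n)) ^ k n) \<longlonglongrightarrow> 1"
proof -
  \<comment> \<open>Room for an order \<open>s\<close> with \<open>1 < s < 2\<close> and
    \<open>s\<^sup>2 < \<beta>\<close>; this is where \<open>\<beta> > 1\<close> enters.\<close>
  have "1 < min 2 (sqrt \<beta>)" using \<beta> by simp
  then obtain s where s: "1 < s" "s < min 2 (sqrt \<beta>)" using dense by blast
  then have s2: "s\<^sup>2 < \<beta>"
    using power_strict_mono[of s "sqrt \<beta>" 2] \<beta> by simp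
  have p0: "0 \<le> p n" for n using p(1)[of n] by simp
  have G: "Gamma (p n + 1) > 0" for n using p0[of n] by (intro Gamma_real_pos) simp
  let ?g = "\<lambda>n x. (x powr p n - Gamma (p n + 1)) / Gamma (p n + 1)"
  let ?\<mu> = "\<lambda>n. distr expo borel (?g n)"
  note c = expo_centered_powr[OF p0 less_imp_le[OF s(1)] G]
  show ?thesis
  proof (rule char_power_LLN[of ?\<mu> s])
    show "real_distribution (?\<mu> n)" for n by (rule real_distribution_distr_expo) simp
    show "integrable (?\<mu> n) (\<lambda>x. x)" for n using c(1) by (simp add: integrable_distr_eq)
    show "(\<integral>x. x \<partial>?\<mu> n) = 0" for n using c(2) by (simp add: integral_distr)
    show "integrable (?\<mu> n) (\<lambda>x. \<bar>x\<bar> powr s)" for n using c(3) by (simp add: integrable_distr_eq)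
    have "(\<lambda>n. real (k n) powr (1 - s) * (\<integral>x. \<bar>?g n x\<bar> powr s \<partial>expo)) \<longlonglongrightarrow> 0"
    proof (rule Lim_null_comparison)
      \<comment> \<open>This extra term is due to the centring: the mean and the scale are equal, so
        their ratio is 1.\<close>
      have "(\<lambda>n. real (k n) powr (1 - s)) \<longlonglongrightarrow> 0"
        using s by (intro tendsto_neg_powr filterlim_compose[OF filterlim_real_sequentially k]) auto
      then show "(\<lambda>n. real (k n) powr (1 - s) * (Gamma (s * p n + 1) / Gamma (p n + 1) powr s) + real (k n) powr (1 - s)) \<longlonglongrightarrow> 0"
        using tendsto_add[OF Gamma_Lyapunov[OF p(2) k growth s(1) s2]] by simp
      show "\<forall>\<^sub>F n in sequentially. norm (real (k n) powr (1 - s) * (\<integral>x. \<bar>?g n x\<bar> powr s \<partial>expo)) \<le>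
          real (k n) powr (1 - s) * (Gamma (s * p n + 1) / Gamma (p n + 1) powr s) + real (k n) powr (1 - s)"
      proof (rule always_eventually, rule allI)
        fix n
        have "real (k n) powr (1 - s) * (\<integral>x. \<bar>?g n x\<bar> powr s \<partial>expo) \<le>
            real (k n) powr (1 - s) * ((Gamma (s * p n + 1) + Gamma (p n + 1) powr s) / Gamma (p n + 1) powr s)"
          by (intro mult_left_mono c(4)) auto
        also have "(Gamma (s * p n + 1) + Gamma (p n + 1) powr s) / Gamma (p n + 1) powr s =
            Gamma (s * p n + 1) / Gamma (p n + 1) powr s + 1"
          using G[of n] by (simp add: add_divide_distrib)
        finally show "norm (real (k n) powr (1 - s) * (\<integral>x. \<bar>?g n x\<bar> powr s \<partial>expo)) \<le>
            real (k n) powr (1 - s) * (Gamma (s * p n + 1) / Gamma (p n + 1) powr s) + real (k n) powr (1 - s)"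
          by (simp add: distrib_left)
      qed
    qed
    then show "(\<lambda>n. real (k n) powr (1 - s) * (\<integral>x. \<bar>x\<bar> powr s \<partial>?\<mu> n)) \<longlonglongrightarrow> 0"
      by (simp add: integral_distr)
  qed (use s k in auto)
qed

text \<open>A moment of order \<open>s = 2 r\<close> of the \<open>p\<close>-th power is a moment of
  order \<open>r\<close> of the power \<open>2 p\<close>. Hence \<open>Gamma_Lyapunov\<close>
  applies to \<open>2 p\<close> with the rate \<open>\<beta> / 2\<close>, which exceeds 1 because
  \<open>\<beta> > 2\<close>.\<close>

lemma char_powr_CLT:
  fixes k :: "nat \<Rightarrow> nat" and p :: "nat \<Rightarrow> real"
  assumes p: "\<And>n. 5 \<le> p n" "filterlim p at_top sequentially"
    and k: "filterlim k at_top sequentially"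
    and growth: "\<forall>\<^sub>F n in sequentially. \<beta> * p n \<le> ln (real (k n))" and \<beta>: "2 < \<beta>"
  defines "d \<equiv> \<lambda>n. sqrt (Gamma (2 * p n + 1) - (Gamma (p n + 1))\<^sup>2)"
  shows "(\<lambda>n. char (distr expo borel (\<lambda>x. (x powr p n - Gamma (p n + 1)) / d n))
      (t / sqrt (real (k n))) ^ k n) \<longlonglongrightarrow> exp (- t\<^sup>2 / 2)"
proof -
  \<comment> \<open>The bound 3/2 keeps \<open>s = 2 r\<close> at most 3; the other one ensures
    \<open>r\<^sup>2 < \<beta> / 2\<close>.\<close>
  have "1 < min (3/2) (sqrt (\<beta> / 2))" using \<beta> by simp
  then obtain r where r: "1 < r" "r < min (3/2) (sqrt (\<beta> / 2))" using dense by blast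
  then have r2: "r\<^sup>2 < \<beta> / 2"
    using power_strict_mono[of r "sqrt (\<beta> / 2)" 2] \<beta> by simp
  define s where "s = 2 * r"
  have s: "2 < s" "s \<le> 3" using r by (auto simp: s_def)
  then have s1: "1 \<le> s" by simp
  have p0: "0 \<le> p n" for n using p(1)[of n] by simp
  have G: "Gamma (p n + 1) > 0" "Gamma (2 * p n + 1) > 0" "Gamma (s * p n + 1) > 0" for n
    using p0[of n] s by (auto intro!: Gamma_real_pos add_nonneg_pos)
  have d: "0 < d n" "Gamma (2 * p n + 1) \<le> 2 * (d n)\<^sup>2"
    "(\<integral>x. ((x powr p n - Gamma (p n + 1)) / d n)\<^sup>2 \<partial>expo) = 1"
    "integrable expo (\<lambda>x. ((x powr p n - Gamma (p n + 1)) / d n)\<^sup>2)" for n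
    using expo_powr_variance[OF p(1)[of n]] unfolding d_def by simp_all
  let ?g = "\<lambda>n x. (x powr p n - Gamma (p n + 1)) / d n"
  let ?\<mu> = "\<lambda>n. distr expo borel (?g n)"
  note c = expo_centered_powr[OF p0 s1 d(1)]
  show ?thesis
  proof (rule char_power_CLT[of ?\<mu> s])
    show "real_distribution (?\<mu> n)" for n by (rule real_distribution_distr_expo) simp
    show "integrable (?\<mu> n) (\<lambda>x. x)" for n using c(1) by (simp add: integrable_distr_eq)
    show "(\<integral>x. x \<partial>?\<mu> n) = 0" for n using c(2) by (simp add: integral_distr)
    show "integrable (?\<mu> n) (\<lambda>x. x\<^sup>2)" for n using d(4) by (simp add: integrable_distr_eq)
    show "(\<integral>x. x\<^sup>2 \<partial>?\<mu> n) = 1" for n using d(3) by (simp add: integral_distr)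
    show "integrable (?\<mu> n) (\<lambda>x. \<bar>x\<bar> powr s)" for n using c(3) by (simp add: integrable_distr_eq)
    let ?R = "\<lambda>n. Gamma (r * (2 * p n) + 1) / Gamma (2 * p n + 1) powr r"
    let ?w = "\<lambda>n. real (k n) powr (1 - r)"
    have "(\<lambda>n. ?w n * (\<integral>x. \<bar>?g n x\<bar> powr s \<partial>expo)) \<longlonglongrightarrow> 0"
    proof (rule Lim_null_comparison)
      have w: "?w \<longlonglongrightarrow> 0"
        using r by (intro tendsto_neg_powr filterlim_compose[OF filterlim_real_sequentially k]) auto
      have "filterlim (\<lambda>n. 2 * p n) at_top sequentially"
        by (rule filterlim_tendsto_pos_mult_at_top[OF tendsto_const _ p(2)]) simp
      then have "(\<lambda>n. ?w n * ?R n) \<longlonglongrightarrow> 0"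
        by (rule Gamma_Lyapunov[OF _ k _ r(1) r2]) (use growth in simp)
      then have "(\<lambda>n. 2 powr r * (?w n * ?R n + ?w n)) \<longlonglongrightarrow> 2 powr r * (0 + 0)"
        by (intro tendsto_intros w)
      then show "(\<lambda>n. 2 powr r * (?w n * ?R n + ?w n)) \<longlonglongrightarrow> 0" by simp
      show "\<forall>\<^sub>F n in sequentially. norm (?w n * (\<integral>x. \<bar>?g n x\<bar> powr s \<partial>expo)) \<le>
          2 powr r * (?w n * ?R n + ?w n)"
      proof (rule always_eventually, rule allI)
        fix n
        \<comment> \<open>Mean and standard deviation are both measured by
          \<open>Gamma (2 p + 1) powr r\<close>: the mean from above, the deviation from below with
          the loss \<open>2 powr r\<close>.\<close>
        have "(Gamma (p n + 1))\<^sup>2 powr r \<le> Gamma (2 * p n + 1) powr r"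
          using Gamma_square_le_half[OF p(1)[of n]] r G[of n] by (intro powr_mono2) auto
        then have m: "Gamma (p n + 1) powr s \<le> Gamma (2 * p n + 1) powr r"
          using G[of n] by (simp add: s_def powr_powr[symmetric] powr_numeral)
        have "Gamma (2 * p n + 1) powr r \<le> (2 * (d n)\<^sup>2) powr r"
          using d(2)[of n] r G[of n] by (intro powr_mono2) auto
        also have "\<dots> = 2 powr r * d n powr s"
          using d(1)[of n] by (simp add: powr_mult s_def powr_powr[symmetric] powr_numeral)
        finally have ds: "Gamma (2 * p n + 1) powr r / 2 powr r \<le> d n powr s"
          by (simp add: field_simps)
        have "(\<integral>x. \<bar>?g n x\<bar> powr s \<partial>expo) \<le> (Gamma (s * p n + 1) + Gamma (p n + 1) powr s) / d n powr s"
          by (rule c(4))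
        also have "\<dots> \<le> (Gamma (s * p n + 1) + Gamma (2 * p n + 1) powr r) / (Gamma (2 * p n + 1) powr r / 2 powr r)"
          using m ds G[of n] by (intro frac_le) auto
        also have "\<dots> = 2 powr r * (?R n + 1)"
          using G[of n] by (simp add: field_simps s_def)
        finally have "?w n * (\<integral>x. \<bar>?g n x\<bar> powr s \<partial>expo) \<le> ?w n * (2 powr r * (?R n + 1))"
          by (rule mult_left_mono) simp
        then show "norm (?w n * (\<integral>x. \<bar>?g n x\<bar> powr s \<partial>expo)) \<le> 2 powr r * (?w n * ?R n + ?w n)"
          by (simp add: algebra_simps)
      qed
    qed
    then show "(\<lambda>n. real (k n) powr (1 - s / 2) * (\<integral>x. \<bar>x\<bar> powr s \<partial>?\<mu> n)) \<longlonglongrightarrow> 0"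
      by (simp add: integral_distr s_def)
  qed (use s k in auto)
qed

section \<open>Weak limits of sums over spacings\<close>

lemma weak_conv_m_eventually_cong:
  assumes "weak_conv_m \<mu> N" "\<forall>\<^sub>F n in sequentially. \<mu> n = \<nu> n"
  shows "weak_conv_m \<nu> N"
  unfolding weak_conv_m_def weak_conv_def
proof (intro allI impI)
  fix x assume "isCont (cdf N) x"
  then have "(\<lambda>n. cdf (\<mu> n) x) \<longlonglongrightarrow> cdf N x"
    using assms(1) by (simp add: weak_conv_m_def weak_conv_def)
  moreover have "\<forall>\<^sub>F n in sequentially. cdf (\<mu> n) x = cdf (\<nu> n) x"
    using assms(2) by eventually_elim simp
  ultimately show "(\<lambda>n. cdf (\<nu> n) x) \<longlonglongrightarrow> cdf N x"
    by (rule Lim_transform_eventually)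
qed

lemma (in uniform_sample) weak_conv_sum_spacing:
  fixes k :: "nat \<Rightarrow> nat" and b :: "nat \<Rightarrow> real"
  assumes N: "real_distribution N"
    and g: "\<And>n. g n \<in> borel_measurable borel"
    and k: "\<forall>\<^sub>F n in sequentially. k n < n"
    and lim: "\<And>t. (\<lambda>n. char (distr expo borel (g n)) (t / b n) ^ k n) \<longlonglongrightarrow> char N t"
  shows "weak_conv_m (\<lambda>n. distr M borel (\<lambda>\<omega>. (\<Sum>i=1..k n. g n (spacing (k n) n i \<omega>)) / b n)) N"
proof -
  let ?T = "\<lambda>n \<omega>. (\<Sum>i=1..k n. g n (spacing (k n) n i \<omega>)) / b n"
  \<comment> \<open>Levy's theorem wants a probability law at every index; the finitely many
    \<open>n\<close> with \<open>k n \<ge> n\<close> receive the limit law.\<close>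
  let ?\<mu> = "\<lambda>n. if k n < n then distr M borel (?T n) else N"
  have S: "(\<lambda>\<omega>. \<Sum>i=1..k n. g n (spacing (k n) n i \<omega>)) \<in> borel_measurable M" if "k n < n" for n
    using spacing_measurable[OF that]
    by (intro borel_measurable_sum measurable_compose[OF _ g[of n]]) auto
  have "weak_conv_m ?\<mu> N"
  proof (rule levy_continuity[OF _ N])
    show "real_distribution (?\<mu> n)" for n
      using N S[of n] by (auto intro!: real_distribution_distr)
    fix t
    show "(\<lambda>n. char (?\<mu> n) t) \<longlonglongrightarrow> char N t"
    proof (rule Lim_transform_eventually[OF lim[of t]])
      show "\<forall>\<^sub>F n in sequentially. char (distr expo borel (g n)) (t / b n) ^ k n = char (?\<mu> n) t"
        using k
      proof eventually_elim
        case (elim n)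
        have "char (distr M borel (?T n)) t =
            char (distr M borel (\<lambda>\<omega>. \<Sum>i=1..k n. g n (spacing (k n) n i \<omega>))) (t / b n)"
          unfolding char_def using S[OF elim] by (simp add: integral_distr)
        also have "\<dots> = char (distr expo borel (g n)) (t / b n) ^ k n"
          by (rule char_sum_spacing[OF g elim])
        finally show ?case using elim by simp
      qed
    qed
  qed
  moreover have "\<forall>\<^sub>F n in sequentially. ?\<mu> n = distr M borel (?T n)"
    using k by eventually_elim simp
  ultimately show ?thesis by (rule weak_conv_m_eventually_cong)
qed

text \<open>Up to the probability of \<open>|T - T'| > \<epsilon>\<close>, the distribution function
  of \<open>T\<close> at \<open>x\<close> lies between those of \<open>T'\<close> at
  \<open>x - \<epsilon>\<close> and \<open>x + \<epsilon>\<close>. As the limit is continuous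
  everywhere, these points need not be selected.\<close>

lemma (in prob_space) slutsky:
  fixes T T' :: "nat \<Rightarrow> 'a \<Rightarrow> real"
  assumes conv: "weak_conv_m (\<lambda>n. distr M borel (T' n)) N"
    and cont: "\<And>x. isCont (cdf N) x"
    and T: "\<forall>\<^sub>F n in sequentially. T n \<in> borel_measurable M"
    and T': "\<forall>\<^sub>F n in sequentially. T' n \<in> borel_measurable M"
    and diff: "\<And>\<epsilon>. 0 < \<epsilon> \<Longrightarrow> (\<lambda>n. prob {\<omega> \<in> space M. \<bar>T n \<omega> - T' n \<omega>\<bar> > \<epsilon>}) \<longlonglongrightarrow> 0"
  shows "weak_conv_m (\<lambda>n. distr M borel (T n)) N"
  unfolding weak_conv_m_def weak_conv_def
proof (intro allI impI, rule LIMSEQ_I)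
  fix x r :: real assume r: "0 < r"
  let ?F = "\<lambda>n x. cdf (distr M borel (T n)) x" and ?F' = "\<lambda>n x. cdf (distr M borel (T' n)) x"
  let ?P = "\<lambda>\<epsilon> n. prob {\<omega> \<in> space M. \<bar>T n \<omega> - T' n \<omega>\<bar> > \<epsilon>}"
  have conv': "(\<lambda>n. ?F' n y) \<longlonglongrightarrow> cdf N y" for y
    by (rule conv[unfolded weak_conv_m_def weak_conv_def, rule_format, OF cont])
  have "cdf N \<midarrow>x\<rightarrow> cdf N x" using cont[of x] by (simp add: isCont_def)
  from LIM_D[OF this, of "r / 3"] r
  obtain \<delta> where \<delta>: "\<delta> > 0" "\<And>y. y \<noteq> x \<Longrightarrow> norm (y - x) < \<delta> \<Longrightarrow> norm (cdf N y - cdf N x) < r / 3"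
    by auto
  define \<epsilon> where "\<epsilon> = \<delta> / 2"
  have \<epsilon>: "\<epsilon> > 0" "\<bar>cdf N (x + \<epsilon>) - cdf N x\<bar> < r / 3" "\<bar>cdf N (x - \<epsilon>) - cdf N x\<bar> < r / 3"
    using \<delta>(1) \<delta>(2)[of "x + \<epsilon>"] \<delta>(2)[of "x - \<epsilon>"] by (simp_all add: \<epsilon>_def)
  have E1: "\<forall>\<^sub>F n in sequentially. \<bar>?F' n y - cdf N y\<bar> < r / 3" for y
    using tendstoD[OF conv', of "r / 3" y] r by (simp add: dist_real_def)
  have E2: "\<forall>\<^sub>F n in sequentially. ?P \<epsilon> n < r / 3"
    using order_tendstoD(2)[OF diff[OF \<epsilon>(1)], of "r / 3"] r by simp
  have "\<forall>\<^sub>F n in sequentially. norm (?F n x - cdf N x) < r"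
    using T T' E1[of "x + \<epsilon>"] E1[of "x - \<epsilon>"] E2
  proof eventually_elim
    case (elim n)
    note [measurable] = elim(1,2)
    have cdfT: "?F n y = prob {\<omega> \<in> space M. T n \<omega> \<le> y}" for y
      unfolding cdf_def by (subst measure_distr) (auto intro!: arg_cong[where f=prob])
    have cdfT': "?F' n y = prob {\<omega> \<in> space M. T' n \<omega> \<le> y}" for y
      unfolding cdf_def by (subst measure_distr) (auto intro!: arg_cong[where f=prob])
    have "?F n x \<le> prob ({\<omega> \<in> space M. T' n \<omega> \<le> x + \<epsilon>} \<union> {\<omega> \<in> space M. \<bar>T n \<omega> - T' n \<omega>\<bar> > \<epsilon>})"
      unfolding cdfT by (intro finite_measure_mono) auto
    also have "\<dots> \<le> ?F' n (x + \<epsilon>) + ?P \<epsilon> n"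
      unfolding cdfT' by (intro measure_Un_le) auto
    finally have up: "?F n x \<le> ?F' n (x + \<epsilon>) + ?P \<epsilon> n" .
    have "?F' n (x - \<epsilon>) \<le> prob ({\<omega> \<in> space M. T n \<omega> \<le> x} \<union> {\<omega> \<in> space M. \<bar>T n \<omega> - T' n \<omega>\<bar> > \<epsilon>})"
      unfolding cdfT' by (intro finite_measure_mono) auto
    also have "\<dots> \<le> ?F n x + ?P \<epsilon> n"
      unfolding cdfT by (intro measure_Un_le) auto
    finally have "?F' n (x - \<epsilon>) \<le> ?F n x + ?P \<epsilon> n" .
    with up elim(3-5) \<epsilon> show ?case
      unfolding real_norm_def by linarith
  qed
  then show "\<exists>n0. \<forall>n\<ge>n0. norm (?F n x - cdf N x) < r"
    by (simp add: eventually_sequentially)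
qed

lemma isCont_cdf_std_normal: "isCont (cdf std_normal_distribution) x"
proof -
  interpret real_distribution std_normal_distribution by (rule real_dist_normal_dist)
  have "emeasure std_normal_distribution {x} = 0"
  proof -
    have "absolutely_continuous lborel std_normal_distribution"
      by (rule absolutely_continuousI_density) simp
    moreover have "{x} \<in> null_sets lborel" by (simp add: null_sets_def)
    ultimately have "{x} \<in> null_sets std_normal_distribution"
      unfolding absolutely_continuous_def by (rule subsetD)
    then show ?thesis by (rule null_setsD1)
  qed
  then show ?thesis by (simp add: isCont_cdf measure_def)
qed

text \<open>The point mass at 0 has its only jump at 0, so the distribution functions converge to 0
  at \<open>- \<epsilon>\<close> and to 1 at \<open>\<epsilon>\<close>.\<close>

lemma (in prob_space) weak_conv_0_imp_prob:
  fixes T :: "nat \<Rightarrow> 'a \<Rightarrow> real"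
  assumes conv: "weak_conv_m (\<lambda>n. distr M borel (T n)) (return borel 0)"
    and T: "\<forall>\<^sub>F n in sequentially. T n \<in> borel_measurable M" and \<epsilon>: "0 < \<epsilon>"
  shows "(\<lambda>n. prob {\<omega> \<in> space M. \<bar>T n \<omega>\<bar> > \<epsilon>}) \<longlonglongrightarrow> 0"
proof -
  interpret N: prob_space "return borel (0::real)" by (rule prob_space_return) simp
  interpret N: real_distribution "return borel (0::real)" by standard auto
  let ?F = "\<lambda>n x. cdf (distr M borel (T n)) x"
  have cont: "isCont (cdf (return borel 0)) x" if "x \<noteq> 0" for x :: real
    using that by (simp add: N.isCont_cdf measure_return)
  have lim: "(\<lambda>n. ?F n x) \<longlonglongrightarrow> cdf (return borel 0) x" if "x \<noteq> 0" for x
    by (rule conv[unfolded weak_conv_m_def weak_conv_def, rule_format, OF cont[OF that]])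
  have "(\<lambda>n. ?F n (- \<epsilon>) + (1 - ?F n \<epsilon>)) \<longlonglongrightarrow> 0 + (1 - 1)"
    using lim[of "- \<epsilon>"] lim[of \<epsilon>] \<epsilon> by (intro tendsto_intros) (simp_all add: cdf_def measure_return)
  then have "(\<lambda>n. ?F n (- \<epsilon>) + (1 - ?F n \<epsilon>)) \<longlonglongrightarrow> 0" by simp
  then show ?thesis
  proof (rule Lim_null_comparison[rotated])
    show "\<forall>\<^sub>F n in sequentially. norm (prob {\<omega> \<in> space M. \<bar>T n \<omega>\<bar> > \<epsilon>}) \<le> ?F n (- \<epsilon>) + (1 - ?F n \<epsilon>)"
      using T
    proof eventually_elim
      case (elim n)
      note [measurable] = elim
      have cdfT: "?F n y = prob {\<omega> \<in> space M. T n \<omega> \<le> y}" for y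
        unfolding cdf_def by (subst measure_distr) (auto intro!: arg_cong[where f=prob])
      have "prob {\<omega> \<in> space M. \<bar>T n \<omega>\<bar> > \<epsilon>} \<le>
          prob ({\<omega> \<in> space M. T n \<omega> \<le> - \<epsilon>} \<union> (space M - {\<omega> \<in> space M. T n \<omega> \<le> \<epsilon>}))"
        by (intro finite_measure_mono) auto
      also have "\<dots> \<le> prob {\<omega> \<in> space M. T n \<omega> \<le> - \<epsilon>} + prob (space M - {\<omega> \<in> space M. T n \<omega> \<le> \<epsilon>})"
        by (intro measure_Un_le) auto
      also have "prob (space M - {\<omega> \<in> space M. T n \<omega> \<le> \<epsilon>}) = 1 - prob {\<omega> \<in> space M. T n \<omega> \<le> \<epsilon>}"
        by (intro prob_compl) auto
      finally show ?case by (simp add: cdfT)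
    qed
  qed
qed

section \<open>Slow variation, quantile functions and the location of the threshold\<close>

lemma regularly_varying_eventually_pos:
  assumes "regularly_varying_at_0 \<rho> a"
  shows "\<forall>\<^sub>F v in at_right 0. 0 < a v"
  using assms unfolding regularly_varying_at_0_def
  by (auto simp: eventually_at_right_field)

lemma eventually_at_right_0_scale:
  fixes c :: real
  assumes P: "eventually P (at_right 0)" and c: "0 < c"
  shows "\<forall>\<^sub>F v in at_right 0. P (c * v)"
proof -
  obtain b where b: "0 < b" "\<And>y. 0 < y \<Longrightarrow> y < b \<Longrightarrow> P y"
    using P by (auto simp: eventually_at_right_field)
  show ?thesis unfolding eventually_at_right_field
    using b c by (intro exI[of _ "b / c"]) (auto simp: field_simps)
qed

text \<open>The hypothesis is applied at the right end \<open>2 v\<close>: every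
  \<open>w \<le> 2 v\<close> is \<open>u * (2 * v)\<close> with \<open>u \<le> 1\<close>, so both
  points are compared with \<open>l (2 * v)\<close>. The return from \<open>2 v\<close> to
  \<open>v\<close> needs regular variation for the single ratio 2.\<close>

lemma log_increment_bound:
  fixes l a :: "real \<Rightarrow> real"
  assumes l: "slowly_varying_at_0 l" and a: "regularly_varying_at_0 \<rho> a"
    and l_a: "Limsup (at_right 0) (\<lambda>v. SUP u\<in>{0<..1}. ereal (\<bar>l (u * v) - l v\<bar> / a v)) < \<infinity>"
    and a_l: "((\<lambda>v. a v / l v) \<longlongrightarrow> 0) (at_right 0)"
  shows "\<exists>C>0. \<forall>\<^sub>F v in at_right 0. \<forall>w\<in>{0<..2 * v}. \<forall>w'\<in>{0<..2 * v}.
    0 < l w \<and> 0 < l w' \<and> \<bar>ln (l w) - ln (l w')\<bar> \<le> C * (a v / l v)"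
proof -
  let ?S = "\<lambda>v. SUP u\<in>{0<..1}. ereal (\<bar>l (u * v) - l v\<bar> / a v)"
  have l': "regularly_varying_at_0 0 l" using l by (simp add: slowly_varying_at_0_def)
  have pos: "\<forall>\<^sub>F v in at_right 0. 0 < a v" "\<forall>\<^sub>F v in at_right 0. 0 < l v"
    using regularly_varying_eventually_pos[OF a] regularly_varying_eventually_pos[OF l'] by auto
  from l_a obtain B :: ereal where B: "Limsup (at_right 0) ?S < B" "B < \<infinity>"
    using dense by blast
  obtain C1 where "B \<le> ereal C1" using B(2) by (cases B) auto
  define C0 where "C0 = max C1 1"
  have C0: "C0 > 0" "B \<le> ereal C0"
    using \<open>B \<le> ereal C1\<close> by (auto simp: C0_def intro: order_trans)
  have evS: "\<forall>\<^sub>F v in at_right 0. ?S v < B"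
    using B(1) by (rule Limsup_lessD)
  have ev1: "\<forall>\<^sub>F v in at_right 0. \<forall>u\<in>{0<..1}. \<bar>l (u * v) - l v\<bar> \<le> C0 * a v"
    using evS pos(1)
  proof eventually_elim
    case (elim v)
    show ?case
    proof
      fix u :: real assume u: "u \<in> {0<..1}"
      have "ereal (\<bar>l (u * v) - l v\<bar> / a v) \<le> ?S v"
        by (rule SUP_upper[OF u])
      also have "\<dots> < ereal C0" using elim(1) C0(2) by (rule less_le_trans)
      finally show "\<bar>l (u * v) - l v\<bar> \<le> C0 * a v"
        using elim(2) by (simp add: field_simps)
    qed
  qed
  \<comment> \<open>Makes the oscillation \<open>C0 * a\<close> at most half of \<open>l\<close> at
    \<open>2 v\<close>, so \<open>l\<close> stays above \<open>l (2 * v) / 2\<close> on the whole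
    interval and its logarithm makes sense there.\<close>
  have ev2: "\<forall>\<^sub>F v in at_right 0. a v / l v < 1 / (2 * C0)"
    using order_tendstoD(2)[OF a_l, of "1 / (2 * C0)"] C0(1) by simp
  have "((\<lambda>v. a (2 * v) / a v) \<longlongrightarrow> 2 powr \<rho>) (at_right 0)"
    using a by (simp add: regularly_varying_at_0_def)
  then have ra: "\<forall>\<^sub>F v in at_right 0. a (2 * v) / a v < 2 powr \<rho> + 1"
    by (rule order_tendstoD) simp
  have "((\<lambda>v. l (2 * v) / l v) \<longlongrightarrow> 2 powr 0) (at_right 0)"
    using l' unfolding regularly_varying_at_0_def by (metis zero_less_numeral)
  then have rl: "\<forall>\<^sub>F v in at_right 0. 1 / 2 < l (2 * v) / l v"
    by (rule order_tendstoD) simp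
  \<comment> \<open>Three factors 2: two increments to \<open>l (2 * v)\<close>, the denominator
    \<open>l (2 * v) / 2\<close>, and \<open>l (2 * v) \<ge> l v / 2\<close>.\<close>
  define C where "C = 8 * C0 * (2 powr \<rho> + 1)"
  have two: "(0::real) < 2" by simp
  have "\<forall>\<^sub>F v in at_right 0. \<forall>w\<in>{0<..2 * v}. \<forall>w'\<in>{0<..2 * v}.
      0 < l w \<and> 0 < l w' \<and> \<bar>ln (l w) - ln (l w')\<bar> \<le> C * (a v / l v)"
    using pos eventually_at_right_0_scale[OF pos(1) two] eventually_at_right_0_scale[OF pos(2) two]
      eventually_at_right_0_scale[OF ev1 two] eventually_at_right_0_scale[OF ev2 two] ra rl
      eventually_at_right_less[of "0::real"]
  proof eventually_elim
    case (elim v)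
    have small: "C0 * a (2 * v) \<le> l (2 * v) / 2"
      using elim(4,6) C0 by (simp add: field_simps)
    have near: "\<bar>l w - l (2 * v)\<bar> \<le> C0 * a (2 * v)" if "w \<in> {0<..2 * v}" for w
      using elim(5)[rule_format, of "w / (2 * v)"] that elim(9) by simp
    have "a (2 * v) / l (2 * v) \<le> ((2 powr \<rho> + 1) * a v) / (l v / 2)"
      using elim by (intro frac_le) (auto simp: field_simps)
    then have ratio: "a (2 * v) / l (2 * v) \<le> 2 * (2 powr \<rho> + 1) * (a v / l v)"
      by (simp add: algebra_simps add_divide_distrib)
    have one: "ln (l w) - ln (l w') \<le> C * (a v / l v)"
      if w: "w \<in> {0<..2 * v}" "w' \<in> {0<..2 * v}" "0 < l w" "l (2 * v) / 2 \<le> l w'" for w w'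
    proof -
      have lw': "0 < l w'" using w(4) elim(4) by linarith
      have "ln (l w) - ln (l w') = ln (l w / l w')" using w(3) lw' by (simp add: ln_div)
      also have "\<dots> \<le> l w / l w' - 1" using w(3) lw' by (intro ln_le_minus_one) simp
      also have "\<dots> = (l w - l w') / l w'" using lw' by (simp add: field_simps)
      also have "\<dots> \<le> (2 * (C0 * a (2 * v))) / (l (2 * v) / 2)"
      proof (rule frac_le)
        show "l w - l w' \<le> 2 * (C0 * a (2 * v))" using near[OF w(1)] near[OF w(2)] by linarith
      qed (use w elim C0 in auto)
      also have "\<dots> = 4 * C0 * (a (2 * v) / l (2 * v))" by simp
      also have "\<dots> \<le> 4 * C0 * (2 * (2 powr \<rho> + 1) * (a v / l v))"
        using ratio C0 by (intro mult_left_mono) auto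
      finally show ?thesis by (simp add: C_def mult_ac)
    qed
    have big: "l (2 * v) / 2 \<le> l w" "0 < l w" if "w \<in> {0<..2 * v}" for w
      using near[OF that] small elim(4) by linarith+
    show ?case
      using big one by (auto simp: abs_le_iff)
  qed
  moreover have "C > 0" using C0 by (auto simp: C_def intro!: mult_pos_pos add_pos_pos)
  ultimately show ?thesis by blast
qed

text \<open>Mean value theorem. For \<open>p \<ge> 1\<close> the derivative is increasing, so it may
  be evaluated at \<open>max x y \<le> x + c\<close>; the bound then involves \<open>x\<close> alone
  and has a computable exponential moment.\<close>

lemma powr_increment_bound:
  fixes x y c p :: real
  assumes xy: "0 \<le> x" "0 \<le> y" "\<bar>y - x\<bar> \<le> c" and p: "1 \<le> p"
  shows "\<bar>y powr p - x powr p\<bar> \<le> p * c * (x + c) powr (p - 1)"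
proof -
  have main: "z powr p - w powr p \<le> p * (z - w) * z powr (p - 1)" if "0 \<le> w" "w \<le> z" for w z :: real
  proof (cases "w = 0 \<or> w = z")
    case True
    have "z powr p = z * z powr (p - 1)" if "0 < z"
      using that powr_add[of z 1 "p - 1"] by simp
    then have "z powr p \<le> p * z * z powr (p - 1)"
      using p \<open>0 \<le> w\<close> \<open>w \<le> z\<close> by (cases "z = 0") (auto intro!: mult_right_mono)
    with True show ?thesis by auto
  next
    case False
    then have wz: "0 < w" "w < z" using that by auto
    have "\<exists>\<xi>. w < \<xi> \<and> \<xi> < z \<and> z powr p - w powr p = (z - w) * (p * \<xi> powr (p - 1))"
      using wz by (intro MVT2) (auto intro!: derivative_eq_intros)
    then obtain \<xi> where \<xi>: "w < \<xi>" "\<xi> < z" "z powr p - w powr p = (z - w) * (p * \<xi> powr (p - 1))"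
      by blast
    have "(z - w) * (p * \<xi> powr (p - 1)) \<le> (z - w) * (p * z powr (p - 1))"
      using \<xi> wz p by (intro mult_left_mono powr_mono2) auto
    then show ?thesis using \<xi>(3) by (simp add: mult_ac)
  qed
  have "\<bar>y powr p - x powr p\<bar> \<le> p * \<bar>y - x\<bar> * max x y powr (p - 1)"
  proof (cases "x \<le> y")
    case True
    then have "x powr p \<le> y powr p" using xy p by (intro powr_mono2) auto
    then show ?thesis using main[of x y] True xy by simp
  next
    case False
    then have "y powr p \<le> x powr p" using xy p by (intro powr_mono2) auto
    then show ?thesis using main[of y x] False xy by (simp add: abs_if)
  qed
  also have "\<dots> \<le> p * c * (x + c) powr (p - 1)"
    using xy p by (intro mult_mono powr_mono2) auto
  finally show ?thesis .
qed

section \<open>Monotonicity and measurability of the quantile function\<close>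

context
  fixes D :: "real measure"
  assumes D: "real_distribution D"
begin

interpretation real_distribution D by (rule D)

lemma quantile_cdf_mono:
  assumes st: "0 < s" "s \<le> t" "t < 1"
  shows "quantile (cdf D) s \<le> quantile (cdf D) t"
  unfolding quantile_def
proof (rule cInf_superset_mono)
  have "\<forall>\<^sub>F x in at_top. t < cdf D x"
    using cdf_lim_at_top_prob st by (intro order_tendstoD(1)) auto
  then show "{x. t \<le> cdf D x} \<noteq> {}"
    by (auto dest!: eventually_happens' [OF trivial_limit_at_top_linorder] intro: less_imp_le)
  have "\<forall>\<^sub>F x in at_bot. cdf D x < s"
    using cdf_lim_at_bot st by (intro order_tendstoD(2)) auto
  then obtain b where b: "\<And>x. x \<le> b \<Longrightarrow> cdf D x < s"
    by (auto simp: eventually_at_bot_linorder)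
  show "bdd_below {x. s \<le> cdf D x}"
    using b by (intro bdd_belowI[of _ b]) (metis linorder_le_cases mem_Collect_eq not_le)
qed (use st in auto)

lemma quantile_cdf_measurable: "quantile (cdf D) \<in> borel_measurable borel"
proof -
  let ?Q = "quantile (cdf D)"
  have "mono_on {0<..<1} ?Q"
    by (intro mono_onI quantile_cdf_mono) auto
  then have "?Q \<in> borel_measurable (restrict_space borel {0<..<1})"
    by (rule borel_measurable_mono_on_fnc)
  then have [measurable]: "(\<lambda>s. if s \<in> {0<..<1} then ?Q s else 0) \<in> borel_measurable borel"
    by (subst (asm) measurable_restrict_space_iff[where c=0]) auto
  \<comment> \<open>Outside the unit interval the infimum is over the whole line or the empty set:
    an unspecified value, but a constant one. This gives measurability on all of the line.\<close>
  have "?Q = (\<lambda>s. if s \<in> {0<..<1} then (if s \<in> {0<..<1} then ?Q s else 0)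
      else if s \<le> 0 then Inf UNIV else if s = 1 then ?Q 1 else Inf {})"
  proof
    fix s
    have "{x. s \<le> cdf D x} = UNIV" if "s \<le> 0"
      using that cdf_nonneg order_trans by blast
    moreover have "{x. s \<le> cdf D x} = {}" if "1 < s"
      using that cdf_bounded_prob by (auto simp: not_le intro: le_less_trans)
    ultimately show "?Q s = (if s \<in> {0<..<1} then (if s \<in> {0<..<1} then ?Q s else 0)
        else if s \<le> 0 then Inf UNIV else if s = 1 then ?Q 1 else Inf {})"
      by (auto simp: quantile_def)
  qed
  also have "\<dots> \<in> borel_measurable borel" by measurable
  finally show ?thesis .
qed

end

section \<open>Exponential tail bound for the threshold\<close>

context uniform_sample
begin

text \<open>Chernoff bound: the event means that at most \<open>k\<close> sample points lie in an
  interval where \<open>2 k\<close> are expected. The Laplace transform of the count at 1 is at most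
  \<open>exp (- 2 k (1 - exp (- 1)))\<close>, against the factor \<open>exp k\<close>.\<close>

lemma prob_order_stat_gt:
  assumes k: "1 \<le> k" "2 * k \<le> n"
  shows "prob {\<omega> \<in> space M. order_stat U (k + 1) n \<omega> > 2 * (real k / real n)}
    \<le> exp (- (real k * (1 - 2 * exp (- 1))))"
proof -
  interpret u: prob_space unif01 by (rule prob_space_unif01)
  define x where "x = 2 * (real k / real n)"
  have n: "0 < n" "k < n" using k by auto
  have x: "0 < x" "x \<le> 1" using k n by (auto simp: x_def field_simps)
  \<comment> \<open>The product of \<open>f\<close> over the sample is \<open>exp\<close> of minus
    the number of points in \<open>{..x}\<close>.\<close>
  define f where "f u = exp (- (if u \<le> x then 1 else 0 :: real))" for u
  have f[measurable]: "f \<in> borel_measurable borel" unfolding f_def by measurable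
  have f01: "0 < f u" "f u \<le> 1" for u by (auto simp: f_def)
  have Ef: "expectation (\<lambda>\<omega>. f (U j \<omega>)) = 1 - x * (1 - exp (- 1))" if j: "1 \<le> j" for j
  proof -
    have "expectation (\<lambda>\<omega>. f (U j \<omega>)) = (\<integral>u. f u \<partial>unif01)"
      using j by (subst unif[OF j, symmetric]) (rule integral_distr[symmetric], auto)
    also have "\<dots> = (\<integral>u. 1 - indicator {..x} u * (1 - exp (- 1)) \<partial>unif01)"
      by (intro Bochner_Integration.integral_cong) (auto simp: f_def)
    also have "\<dots> = 1 - measure unif01 {..x} * (1 - exp (- 1))"
      by (subst Bochner_Integration.integral_diff)
        (auto simp: u.prob_space[simplified] u.emeasure_eq_measure intro!: integrable_mult_left integrable_real_indicator)
    also have "measure unif01 {..x} = measure lborel ({0<..<1} \<inter> {..x}) / measure lborel {0<..<1::real}"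
      by (rule measure_uniform_measure) auto
    also have "measure lborel ({0<..<1} \<inter> {..x}) = x"
    proof (cases "x = 1")
      case True
      then have "{0<..<1} \<inter> {..x} = {0<..<1}" by auto
      then show ?thesis using True by simp
    next
      case False
      then have "{0<..<1} \<inter> {..x} = {0<..x}" using x by auto
      then show ?thesis using x by simp
    qed
    finally show ?thesis by simp
  qed
  have fU: "(\<lambda>\<omega>. f (U j \<omega>)) \<in> borel_measurable M" if "j \<in> {1..n}" for j
    using that by (intro measurable_compose[OF _ f]) auto
  have "indep_vars (\<lambda>_. borel) (\<lambda>j \<omega>. f (U j \<omega>)) {1..n}"
    by (rule indep_vars_compose2[OF indep_vars_subset[OF indep]]) auto
  then have "expectation (\<lambda>\<omega>. \<Prod>j\<in>{1..n}. f (U j \<omega>)) = (\<Prod>j\<in>{1..n}. expectation (\<lambda>\<omega>. f (U j \<omega>)))"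
    using fU f01 by (intro indep_vars_lebesgue_integral)
      (auto intro!: integrable_const_bound[of _ 1] simp: abs_of_pos)
  also have "\<dots> = (1 - x * (1 - exp (- 1))) ^ n"
    using Ef by simp
  also have "\<dots> \<le> exp (- (x * (1 - exp (- 1)))) ^ n"
  proof (rule power_mono)
    show "1 - x * (1 - exp (- 1)) \<le> exp (- (x * (1 - exp (- 1))))"
      using exp_ge_add_one_self[of "- (x * (1 - exp (- 1)))"] by simp
    show "0 \<le> 1 - x * (1 - exp (- 1))"
      using mult_mono[of x 1 "1 - exp (-1)" 1] x by simp
  qed
  also have "\<dots> = exp (- (2 * real k * (1 - exp (- 1))))"
    using n by (simp add: exp_of_nat_mult[symmetric] x_def)
  finally have E: "expectation (\<lambda>\<omega>. \<Prod>j\<in>{1..n}. f (U j \<omega>)) \<le> exp (- (2 * real k * (1 - exp (- 1))))" .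
  let ?A = "{\<omega> \<in> space M. order_stat U (k + 1) n \<omega> > x}"
  have [measurable]: "order_stat U (k + 1) n \<in> borel_measurable M"
    using n by (intro order_stat_U_measurable) auto
  have A: "?A \<in> events" by measurable
  have prod_f: "(\<Prod>j\<in>{1..n}. f (U j \<omega>)) = exp (- real (card {j\<in>{1..n}. U j \<omega> \<le> x}))" for \<omega>
    unfolding f_def by (subst exp_sum[symmetric]) (auto simp: sum_negf sum.If_cases Int_def)
  have "exp (- real k) * prob ?A = expectation (\<lambda>\<omega>. exp (- real k) * indicator ?A \<omega>)"
    by simp (auto intro!: arg_cong[where f=prob])
  also have "\<dots> \<le> expectation (\<lambda>\<omega>. \<Prod>j\<in>{1..n}. f (U j \<omega>))"
  proof (rule integral_mono)
    show "integrable M (\<lambda>\<omega>. exp (- real k) * indicator ?A \<omega>)"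
      by (intro integrable_mult_right integrable_real_indicator A) (simp add: emeasure_eq_measure)
    show "integrable M (\<lambda>\<omega>. \<Prod>j\<in>{1..n}. f (U j \<omega>))"
    proof (rule integrable_const_bound[of _ 1])
      show "AE \<omega> in M. norm (\<Prod>j\<in>{1..n}. f (U j \<omega>)) \<le> 1"
        unfolding prod_f by simp
    qed (intro borel_measurable_prod fU)
    fix \<omega>
    show "exp (- real k) * indicator ?A \<omega> \<le> (\<Prod>j\<in>{1..n}. f (U j \<omega>))"
    proof (cases "\<omega> \<in> ?A")
      case True
      then have "\<not> k + 1 \<le> card {j\<in>{1..n}. U j \<omega> \<le> x}"
        using order_stat_le_iff[of "k + 1" n U \<omega> x] n by simp
      then have "card {j\<in>{1..n}. U j \<omega> \<le> x} \<le> k" by simp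
      then show ?thesis using True unfolding prod_f by simp
    qed (simp add: prod_f del: One_nat_def)
  qed
  also note E
  finally have "prob ?A \<le> exp (- (2 * real k * (1 - exp (- 1)))) / exp (- real k)"
    by (simp add: field_simps)
  also have "\<dots> = exp (- (real k * (1 - 2 * exp (- 1))))"
    by (simp add: exp_diff[symmetric] algebra_simps)
  finally show ?thesis by (simp add: x_def)
qed

end

section \<open>Comparison of logarithmic excesses and spacings\<close>

context uniform_sample
begin

lemma order_stat_U_bounds:
  assumes U: "\<forall>i\<in>{1..n}. 0 < U i \<omega>" and i: "1 \<le> i" "i \<le> j" "j \<le> n"
  shows "0 < order_stat U i n \<omega>" "order_stat U i n \<omega> \<le> order_stat U j n \<omega>"
proof -
  have "{m\<in>{1..n}. U m \<omega> \<le> 0} = {}" using U by (auto simp: not_le)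
  then show "0 < order_stat U i n \<omega>"
    using order_stat_le_iff[of i n U \<omega> 0] i by (simp only: card.empty not_le[symmetric])
  have "j \<le> card {m\<in>{1..n}. U m \<omega> \<le> order_stat U j n \<omega>}"
    using order_stat_le_iff[of j n U \<omega> "order_stat U j n \<omega>"] i by simp
  then show "order_stat U i n \<omega> \<le> order_stat U j n \<omega>"
    using order_stat_le_iff[of i n U \<omega> "order_stat U j n \<omega>"] i by simp
qed

definition log_excess :: "(real \<Rightarrow> real) \<Rightarrow> nat \<Rightarrow> nat \<Rightarrow> nat \<Rightarrow> 'a \<Rightarrow> real" where
  "log_excess Q k n i \<omega> = ln (Q (1 - order_stat U i n \<omega>) / Q (1 - order_stat U (k + 1) n \<omega>))"

lemma log_excess_measurable:
  assumes Q: "Q \<in> borel_measurable borel" and k: "k < n" and i: "i \<in> {1..k}"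
  shows "log_excess Q k n i \<in> borel_measurable M"
proof -
  have "(\<lambda>\<omega>. Q (1 - order_stat U j n \<omega>)) \<in> borel_measurable M" if "1 \<le> j" "j \<le> n" for j
    by (intro measurable_compose[OF _ Q] borel_measurable_diff borel_measurable_const order_stat_U_measurable that)
  then show ?thesis unfolding log_excess_def using k i
    by (intro borel_measurable_ln borel_measurable_divide) auto
qed

text \<open>When the threshold is at most \<open>V0\<close>, each
  \<open>log_excess / \<gamma>\<close> differs from its spacing by at most \<open>c\<close>. The
  increments of the \<open>p\<close>-th powers are then dominated by a sum over spacings, to which
  the Markov-type inequality applies.\<close>

lemma prob_log_excess_diff:
  fixes Q l :: "real \<Rightarrow> real" and k n :: nat
  assumes \<gamma>: "0 < \<gamma>" and mono: "\<And>s t. 0 < s \<Longrightarrow> s \<le> t \<Longrightarrow> t < 1 \<Longrightarrow> Q s \<le> Q t"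
    and Q_l: "\<And>s. s \<in> {0<..<1} \<Longrightarrow> Q (1 - s) = s powr (- \<gamma>) * l s"
    and k: "k < n" and V0: "V0 < 1"
    and osc: "\<And>w w'. w \<in> {0<..V0} \<Longrightarrow> w' \<in> {0<..V0} \<Longrightarrow>
      0 < l w \<and> 0 < l w' \<and> \<bar>ln (l w) - ln (l w')\<bar> \<le> \<gamma> * c"
    and p: "1 \<le> p" and c: "0 \<le> c" and \<delta>: "0 < \<delta>"
  shows "prob {\<omega> \<in> space M. \<bar>(\<Sum>i=1..k. log_excess Q k n i \<omega> powr p) / \<gamma> powr p
        - (\<Sum>i=1..k. spacing k n i \<omega> powr p)\<bar> > \<delta>}
    \<le> prob {\<omega> \<in> space M. order_stat U (k + 1) n \<omega> > V0}
      + real k * c * Gamma (p + 1) / \<delta> * (exp c / (1 - exp (- 1)))"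
proof -
  let ?A = "\<lambda>\<omega>. (\<Sum>i=1..k. log_excess Q k n i \<omega> powr p) / \<gamma> powr p"
  let ?B = "\<lambda>\<omega>. \<Sum>i=1..k. spacing k n i \<omega> powr p"
  let ?h = "\<lambda>x. p * c * (x + c) powr (p - 1)"
  let ?H = "\<lambda>\<omega>. \<Sum>i=1..k. ?h (spacing k n i \<omega>)"
  let ?V = "{\<omega> \<in> space M. order_stat U (k + 1) n \<omega> > V0}"
  have [measurable]: "order_stat U (k + 1) n \<in> borel_measurable M"
    using k by (intro order_stat_U_measurable) auto
  have sp[measurable]: "\<And>i. i \<in> {1..k} \<Longrightarrow> spacing k n i \<in> borel_measurable M"
    by (rule spacing_measurable[OF k])
  have diff: "\<bar>?A \<omega> - ?B \<omega>\<bar> \<le> ?H \<omega>"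
    if U: "\<forall>i\<in>{1..n}. 0 < U i \<omega> \<and> U i \<omega> < 1" and V: "order_stat U (k + 1) n \<omega> \<le> V0" for \<omega>
  proof -
    let ?v = "order_stat U (k + 1) n \<omega>"
    have v: "0 < ?v" "?v \<le> V0" using order_stat_U_bounds[of n \<omega> "k + 1" "k + 1"] U V k by auto
    have bound: "\<bar>log_excess Q k n i \<omega> powr p / \<gamma> powr p - spacing k n i \<omega> powr p\<bar> \<le> ?h (spacing k n i \<omega>)"
      if i: "i \<in> {1..k}" for i
    proof -
      let ?u = "order_stat U i n \<omega>"
      have u: "0 < ?u" "?u \<le> ?v" using order_stat_U_bounds[of n \<omega> i "k + 1"] U k i by auto
      have l_uv: "0 < l ?u" "0 < l ?v" "\<bar>ln (l ?u) - ln (l ?v)\<bar> \<le> \<gamma> * c"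
        using osc[of ?u ?v] u v by auto
      have Qu: "Q (1 - ?u) = ?u powr (- \<gamma>) * l ?u" "Q (1 - ?v) = ?v powr (- \<gamma>) * l ?v"
        using u v V0 by (auto intro!: Q_l)
      have pos: "0 < Q (1 - ?u)" "0 < Q (1 - ?v)" unfolding Qu using l_uv u v by auto
      \<comment> \<open>Monotonicity of the quantile function makes the excess nonnegative, as the
        increment bound for powers requires.\<close>
      have "Q (1 - ?v) \<le> Q (1 - ?u)" by (rule mono) (use u v V0 in auto)
      then have y0: "0 \<le> log_excess Q k n i \<omega>"
        unfolding log_excess_def using pos by simp
      have x_eq: "spacing k n i \<omega> = ln ?v - ln ?u"
        unfolding spacing_def using u v by (simp add: ln_div)
      then have x0: "0 \<le> spacing k n i \<omega>" using u by simp
      have "log_excess Q k n i \<omega> = ln (Q (1 - ?u)) - ln (Q (1 - ?v))"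
        unfolding log_excess_def using pos by (simp add: ln_div)
      also have "\<dots> = \<gamma> * spacing k n i \<omega> + (ln (l ?u) - ln (l ?v))"
        unfolding Qu x_eq using u v l_uv by (simp add: ln_mult ln_powr algebra_simps)
      finally have y_eq: "log_excess Q k n i \<omega> / \<gamma> - spacing k n i \<omega> = (ln (l ?u) - ln (l ?v)) / \<gamma>"
        using \<gamma> by (simp add: field_simps)
      have "\<bar>log_excess Q k n i \<omega> / \<gamma> - spacing k n i \<omega>\<bar> \<le> c"
        unfolding y_eq using l_uv(3) \<gamma> by (simp add: abs_divide field_simps)
      then have "\<bar>(log_excess Q k n i \<omega> / \<gamma>) powr p - spacing k n i \<omega> powr p\<bar> \<le> ?h (spacing k n i \<omega>)"
        using x0 y0 \<gamma> p by (intro powr_increment_bound) auto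
      then show ?thesis using y0 \<gamma> by (simp add: powr_divide)
    qed
    have "\<bar>?A \<omega> - ?B \<omega>\<bar> = \<bar>\<Sum>i=1..k. log_excess Q k n i \<omega> powr p / \<gamma> powr p - spacing k n i \<omega> powr p\<bar>"
      by (simp add: sum_divide_distrib sum_subtractf)
    also have "\<dots> \<le> ?H \<omega>"
      by (rule order_trans[OF sum_abs sum_mono[OF bound]])
    finally show ?thesis .
  qed
  have "prob {\<omega> \<in> space M. \<bar>?A \<omega> - ?B \<omega>\<bar> > \<delta>} \<le> prob (?V \<union> {\<omega> \<in> space M. ?H \<omega> \<ge> \<delta>})"
  proof (rule finite_measure_mono_AE)
    show "AE \<omega> in M. \<omega> \<in> {\<omega> \<in> space M. \<bar>?A \<omega> - ?B \<omega>\<bar> > \<delta>} \<longrightarrow> \<omega> \<in> ?V \<union> {\<omega> \<in> space M. ?H \<omega> \<ge> \<delta>}"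
      using AE_U_inj[of n]
    proof eventually_elim
      case (elim \<omega>)
      show ?case using diff[of \<omega>] elim by (cases "order_stat U (k + 1) n \<omega> \<le> V0") auto
    qed
  qed measurable
  also have "\<dots> \<le> prob ?V + prob {\<omega> \<in> space M. ?H \<omega> \<ge> \<delta>}"
    by (rule measure_Un_le) measurable
  also have "prob {\<omega> \<in> space M. ?H \<omega> \<ge> \<delta>} \<le> real k * c * Gamma (p + 1) / \<delta> * (exp c / (1 - exp (- 1)))"
  proof -
    have p1: "0 \<le> p - 1" using p by simp
    note shifted = expo_shifted_moment[OF p1 c]
    \<comment> \<open>The factor \<open>p\<close> from differentiating is absorbed here: the shifted
      moment of order \<open>p - 1\<close> is of size \<open>Gamma p\<close>, so the error is of
      order \<open>k c Gamma (p + 1)\<close> without an additional \<open>p\<close>.\<close>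
    have G: "Gamma (p + 1) = p * Gamma p"
      using p by (intro Gamma_plus1) (auto elim!: nonpos_Ints_cases)
    have "(\<integral>x. ?h x \<partial>expo) = p * c * (\<integral>x. (x + c) powr (p - 1) \<partial>expo)" by simp
    also have "\<dots> \<le> p * c * (exp c * Gamma (p - 1 + 1))"
      using p c by (intro mult_left_mono shifted(2)) auto
    also have "\<dots> = c * exp c * Gamma (p + 1)" using G by simp
    finally have int_h: "(\<integral>x. ?h x \<partial>expo) \<le> c * exp c * Gamma (p + 1)" .
    have "prob {\<omega> \<in> space M. ?H \<omega> \<ge> \<delta>} * (1 - exp (- 1)) \<le> real k * (\<integral>x. ?h x \<partial>expo) / \<delta>"
      using shifted(1) p c by (intro prob_sum_spacing_ge \<delta> k) auto
    also have "\<dots> \<le> real k * (c * exp c * Gamma (p + 1)) / \<delta>"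
      using \<delta> by (intro divide_right_mono mult_left_mono int_h) auto
    finally have "prob {\<omega> \<in> space M. ?H \<omega> \<ge> \<delta>} \<le> real k * (c * exp c * Gamma (p + 1)) / \<delta> / (1 - exp (- 1))"
      by (subst pos_le_divide_eq) simp_all
    then show ?thesis by (simp only: times_divide_eq_left times_divide_eq_right mult_ac divide_divide_eq_left)
  qed
  finally show ?thesis by simp
qed

lemma log_excess_diff_tendsto_0:
  fixes Q l :: "real \<Rightarrow> real" and k :: "nat \<Rightarrow> nat" and p c \<delta> :: "nat \<Rightarrow> real"
  assumes \<gamma>: "0 < \<gamma>" and mono: "\<And>s t. 0 < s \<Longrightarrow> s \<le> t \<Longrightarrow> t < 1 \<Longrightarrow> Q s \<le> Q t"
    and Q_l: "\<And>s. s \<in> {0<..<1} \<Longrightarrow> Q (1 - s) = s powr (- \<gamma>) * l s"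
    and k: "\<forall>\<^sub>F n in sequentially. 1 \<le> k n \<and> 2 * k n < n" "filterlim k at_top sequentially"
    and osc: "\<forall>\<^sub>F n in sequentially. \<forall>w\<in>{0<..2 * (real (k n) / real n)}. \<forall>w'\<in>{0<..2 * (real (k n) / real n)}.
      0 < l w \<and> 0 < l w' \<and> \<bar>ln (l w) - ln (l w')\<bar> \<le> \<gamma> * c n"
    and p: "\<forall>\<^sub>F n in sequentially. 1 \<le> p n" and c: "\<forall>\<^sub>F n in sequentially. 0 \<le> c n" "c \<longlonglongrightarrow> 0"
    and \<delta>: "\<forall>\<^sub>F n in sequentially. 0 < \<delta> n"
    and lim: "(\<lambda>n. real (k n) * c n * Gamma (p n + 1) / \<delta> n) \<longlonglongrightarrow> 0"
  shows "(\<lambda>n. prob {\<omega> \<in> space M. \<bar>(\<Sum>i=1..k n. log_excess Q (k n) n i \<omega> powr p n) / \<gamma> powr p n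
        - (\<Sum>i=1..k n. spacing (k n) n i \<omega> powr p n)\<bar> > \<delta> n}) \<longlonglongrightarrow> 0"
proof (rule Lim_null_comparison)
  let ?b = "\<lambda>n. exp (- (real (k n) * (1 - 2 * exp (- 1)))) +
    real (k n) * c n * Gamma (p n + 1) / \<delta> n * (exp (c n) / (1 - exp (- 1)))"
  \<comment> \<open>That is, \<open>e > 2\<close>: the Chernoff exponent is positive and the
    threshold event is negligible as \<open>k\<close> tends to infinity.\<close>
  have e: "0 < 1 - 2 * exp (- 1 :: real)"
    using exp_ge_add_one_self[of "1::real"] exp_lower_Taylor_quadratic[of "1::real"]
    by (simp add: exp_minus field_simps)
  have "filterlim (\<lambda>n. real (k n) * (1 - 2 * exp (- 1))) at_top sequentially"
    by (rule filterlim_at_top_mult_tendsto_pos[OF tendsto_const e filterlim_compose[OF filterlim_real_sequentially k(2)]])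
  then have "(\<lambda>n. exp (- (real (k n) * (1 - 2 * exp (- 1))))) \<longlonglongrightarrow> 0"
    by (intro filterlim_compose[OF exp_at_bot]) (simp add: filterlim_uminus_at_bot)
  moreover have "(\<lambda>n. exp (c n) / (1 - exp (- 1))) \<longlonglongrightarrow> exp 0 / (1 - exp (- 1))"
    by (intro tendsto_intros c(2)) auto
  ultimately have "?b \<longlonglongrightarrow> 0 + 0 * (exp 0 / (1 - exp (- 1)))"
    by (intro tendsto_add tendsto_mult lim)
  then show "?b \<longlonglongrightarrow> 0" by simp
  show "\<forall>\<^sub>F n in sequentially. norm (prob {\<omega> \<in> space M. \<bar>(\<Sum>i=1..k n. log_excess Q (k n) n i \<omega> powr p n) / \<gamma> powr p n
        - (\<Sum>i=1..k n. spacing (k n) n i \<omega> powr p n)\<bar> > \<delta> n}) \<le> ?b n"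
    using k(1) osc p c(1) \<delta>
  proof eventually_elim
    case (elim n)
    have kn: "k n < n" "1 \<le> k n" "2 * k n \<le> n" using elim(1) by auto
    have V0: "2 * (real (k n) / real n) < 1" using elim(1) by (simp add: field_simps)
    have "prob {\<omega> \<in> space M. \<bar>(\<Sum>i=1..k n. log_excess Q (k n) n i \<omega> powr p n) / \<gamma> powr p n
        - (\<Sum>i=1..k n. spacing (k n) n i \<omega> powr p n)\<bar> > \<delta> n} \<le>
      prob {\<omega> \<in> space M. order_stat U (k n + 1) n \<omega> > 2 * (real (k n) / real n)}
      + real (k n) * c n * Gamma (p n + 1) / \<delta> n * (exp (c n) / (1 - exp (- 1)))"
      by (rule prob_log_excess_diff[OF \<gamma> mono Q_l kn(1) V0]) (use elim in auto)
    also have "prob {\<omega> \<in> space M. order_stat U (k n + 1) n \<omega> > 2 * (real (k n) / real n)} \<le>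
        exp (- (real (k n) * (1 - 2 * exp (- 1))))"
      by (rule prob_order_stat_gt[OF kn(2,3)])
    finally show ?case by simp
  qed
qed

end

text \<open>The strict inequality survives as the gap \<open>L < b\<close>, which later yields
  exponential decay in \<open>p\<close>.\<close>

lemma eventually_le_exp_of_limsup:
  fixes p f :: "nat \<Rightarrow> real"
  assumes "limsup (\<lambda>n. ereal (1 / p n * ln (f n))) < ereal b"
    and p: "\<forall>\<^sub>F n in sequentially. 0 < p n" and f: "\<forall>\<^sub>F n in sequentially. 0 < f n"
  shows "\<exists>L<b. \<forall>\<^sub>F n in sequentially. f n \<le> exp (L * p n)"
proof -
  obtain L' where L': "limsup (\<lambda>n. ereal (1 / p n * ln (f n))) < L'" "L' < ereal b"
    using dense[OF assms(1)] by blast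
  have "\<exists>L. L' \<le> ereal L \<and> L < b"
  proof (cases L')
    case MInf
    then show ?thesis by (intro exI[of _ "b - 1"]) auto
  qed (use L' in auto)
  then obtain L where L: "L' \<le> ereal L" "L < b" by blast
  have "\<forall>\<^sub>F n in sequentially. ereal (1 / p n * ln (f n)) < L'"
    by (rule Limsup_lessD[OF L'(1)])
  then have "\<forall>\<^sub>F n in sequentially. f n \<le> exp (L * p n)"
    using p f
  proof eventually_elim
    case (elim n)
    have "ereal (1 / p n * ln (f n)) < ereal L" using elim(1) L(1) by (rule less_le_trans)
    then have "ln (f n) \<le> L * p n" using elim(2) by (simp add: field_simps)
    then show ?case using elim(3) exp_le_cancel_iff[of "ln (f n)" "L * p n"] by simp
  qed
  with L(2) show ?thesis by blast
qed

text \<open>The gap \<open>\<beta> > b\<close> leaves room for a moment order above the critical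
  one; the lower limit may be infinite.\<close>

lemma eventually_growth_of_liminf:
  fixes p f :: "nat \<Rightarrow> real"
  assumes "ereal b < liminf (\<lambda>n. ereal (f n / p n))" and p: "\<forall>\<^sub>F n in sequentially. 0 < p n"
  shows "\<exists>\<beta>>b. \<forall>\<^sub>F n in sequentially. \<beta> * p n \<le> f n"
proof -
  obtain B where B: "ereal b < B" "B < liminf (\<lambda>n. ereal (f n / p n))"
    using dense[OF assms(1)] by blast
  have "\<exists>\<beta>. ereal \<beta> \<le> B \<and> b < \<beta>"
  proof (cases B)
    case PInf
    then show ?thesis by (intro exI[of _ "b + 1"]) auto
  qed (use B in auto)
  then obtain \<beta> where \<beta>: "ereal \<beta> \<le> B" "b < \<beta>" by blast
  have "\<forall>\<^sub>F n in sequentially. B < ereal (f n / p n)"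
    by (rule less_LiminfD[OF B(2)])
  then have "\<forall>\<^sub>F n in sequentially. \<beta> * p n \<le> f n"
    using p
  proof eventually_elim
    case (elim n)
    have "ereal \<beta> < ereal (f n / p n)" using \<beta>(1) elim(1) by (rule le_less_trans)
    then show ?case using elim(2) by (simp add: field_simps)
  qed
  with \<beta>(2) show ?thesis by blast
qed

section \<open>The limit theorem\<close>

theorem theorem4p5:
  fixes M :: "'a measure" and U :: "nat \<Rightarrow> 'a \<Rightarrow> real"
    and D :: "real measure" and Q l a :: "real \<Rightarrow> real"
    and \<gamma> \<rho> :: real and k :: "nat \<Rightarrow> nat" and p :: "nat \<Rightarrow> real" and \<alpha> :: ereal
  assumes "prob_space M"
    and U_indep: "prob_space.indep_vars M (\<lambda>_. borel) U {1..}"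
    and U_unif: "\<And>i. i \<ge> 1 \<Longrightarrow> distr M borel (U i) = uniform_measure lborel {0<..<1}"
    and D: "real_distribution D"
    and Q: "Q = quantile (cdf D)"
    and gamma: "\<gamma> > 0"
    and Q_l: "\<And>s. s \<in> {0<..<1} \<Longrightarrow> Q (1 - s) = s powr (- \<gamma>) * l s"
    and l_sv: "slowly_varying_at_0 l"
    and a_rv: "regularly_varying_at_0 \<rho> a"
    and l_a: "Limsup (at_right 0) (\<lambda>v. SUP u\<in>{0<..1}. ereal (\<bar>l (u * v) - l v\<bar> / a v)) < \<infinity>"
    and a_l: "((\<lambda>v. a v / l v) \<longlongrightarrow> 0) (at_right 0)"
    and k_bounds: "\<And>n. n \<ge> 1 \<Longrightarrow> 1 \<le> k n \<and> k n \<le> n"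
    and k_inf: "filterlim k at_top sequentially"
    and k_n: "(\<lambda>n. real (k n) / real n) \<longlonglongrightarrow> 0"
    and p_pos: "\<And>n. n \<ge> 1 \<Longrightarrow> p n > 0"
    and p_inf: "filterlim p at_top sequentially"
    and p_a: "(\<lambda>n. p n * (a (real (k n) / real n) / l (real (k n) / real n))) \<longlonglongrightarrow> 0"
    and alpha: "\<alpha> = liminf (\<lambda>n. ereal (ln (real (k n)) / p n))"
  shows "(\<alpha> > 1 \<longrightarrow>
      converges_in_probability M
        (\<lambda>n \<omega>. 1 / (real (k n) * m_const \<gamma> (p n)) *
          (\<Sum>i=1..k n.
             (ln (Q (1 - order_stat U i n \<omega>) / Q (1 - order_stat U (k n + 1) n \<omega>))) powr (p n)))
        1) \<and>
    (\<alpha> > 2 \<and>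
     limsup (\<lambda>n. ereal (1 / p n *
        ln (sqrt (real (k n)) * (a (real (k n) / real n) / l (real (k n) / real n))))) < ereal (ln 2)
     \<longrightarrow>
      weak_conv_m
        (\<lambda>n. distr M borel
          (\<lambda>\<omega>. 1 / (sqrt (real (k n)) * sigma_const \<gamma> (p n)) *
            (\<Sum>i=1..k n.
               (ln (Q (1 - order_stat U i n \<omega>) / Q (1 - order_stat U (k n + 1) n \<omega>))) powr (p n)
               - m_const \<gamma> (p n))))
        std_normal_distribution)"
proof -

  \<comment> \<open>Set-up and asymptotics shared by the two limits\<close>
  interpret uniform_sample M U
    by (intro uniform_sample.intro uniform_sample_axioms.intro assms(1) U_indep U_unif)
  have mono: "\<And>s t. 0 < s \<Longrightarrow> s \<le> t \<Longrightarrow> t < 1 \<Longrightarrow> Q s \<le> Q t"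
    unfolding Q by (rule quantile_cdf_mono[OF D])
  have Q_meas: "Q \<in> borel_measurable borel" unfolding Q by (rule quantile_cdf_measurable[OF D])
  have l_rv: "regularly_varying_at_0 0 l" using l_sv by (simp add: slowly_varying_at_0_def)
  define v where "v n = real (k n) / real n" for n
  define \<eta> where "\<eta> n = a (v n) / l (v n)" for n
  have k1: "\<forall>\<^sub>F n in sequentially. 1 \<le> k n"
    by (rule eventually_compose_filterlim[OF eventually_ge_at_top k_inf])
  have "v \<longlonglongrightarrow> 0" using k_n by (simp add: v_def[abs_def])
  moreover have "\<forall>\<^sub>F n in sequentially. 0 < v n"
    using k1 eventually_gt_at_top[of 0] by eventually_elim (simp add: v_def)
  ultimately have v0: "filterlim v (at_right 0) sequentially"
    by (rule tendsto_imp_filterlim_at_right)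
  have "\<forall>\<^sub>F n in sequentially. v n < 1 / 2"
    using order_tendstoD(2)[OF \<open>v \<longlonglongrightarrow> 0\<close>, of "1 / 2"] by simp
  then have kn: "\<forall>\<^sub>F n in sequentially. 1 \<le> k n \<and> 2 * k n < n"
    using k1 eventually_gt_at_top[of 0]
  proof eventually_elim
    case (elim n)
    then have "2 * real (k n) < real n" by (simp add: v_def field_simps)
    with elim show ?case by linarith
  qed
  have \<eta>_pos: "\<forall>\<^sub>F n in sequentially. 0 < \<eta> n"
    using eventually_compose_filterlim[OF regularly_varying_eventually_pos[OF a_rv] v0]
      eventually_compose_filterlim[OF regularly_varying_eventually_pos[OF l_rv] v0]
    by eventually_elim (simp add: \<eta>_def)
  obtain C where C: "0 < C" "\<forall>\<^sub>F v in at_right 0. \<forall>w\<in>{0<..2 * v}. \<forall>w'\<in>{0<..2 * v}.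
      0 < l w \<and> 0 < l w' \<and> \<bar>ln (l w) - ln (l w')\<bar> \<le> C * (a v / l v)"
    using log_increment_bound[OF l_sv a_rv l_a a_l] by blast
  \<comment> \<open>Bound for the perturbation after division by \<open>\<gamma>\<close>, so that
    \<open>\<gamma> * c n\<close> is the bound on the increments of \<open>ln l\<close>.\<close>
  define c where "c n = C * \<eta> n / \<gamma>" for n
  have osc: "\<forall>\<^sub>F n in sequentially. \<forall>w\<in>{0<..2 * (real (k n) / real n)}. \<forall>w'\<in>{0<..2 * (real (k n) / real n)}.
      0 < l w \<and> 0 < l w' \<and> \<bar>ln (l w) - ln (l w')\<bar> \<le> \<gamma> * c n"
    using eventually_compose_filterlim[OF C(2) v0] gamma by (simp add: c_def \<eta>_def v_def)
  have c_nonneg: "\<forall>\<^sub>F n in sequentially. 0 \<le> c n"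
    using \<eta>_pos by eventually_elim (use C(1) gamma in \<open>simp add: c_def\<close>)
  \<comment> \<open>Eventually equal to \<open>p\<close>, but at least 5 for every \<open>n\<close>,
    as the variance and characteristic function lemmas demand.\<close>
  define p' where "p' n = max 5 (p n)" for n
  have p'5: "5 \<le> p' n" for n by (simp add: p'_def)
  have "\<forall>\<^sub>F n in sequentially. 5 \<le> p n"
    by (rule eventually_compose_filterlim[OF eventually_ge_at_top p_inf])
  then have p'_eq: "\<forall>\<^sub>F n in sequentially. p' n = p n"
    by eventually_elim (simp add: p'_def)
  have p'_inf: "filterlim p' at_top sequentially"
    using p_inf by (rule filterlim_at_top_mono) (simp add: p'_def)
  have p_ev: "\<forall>\<^sub>F n in sequentially. 0 < p n"
    by (rule eventually_compose_filterlim[OF eventually_gt_at_top p_inf])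
  have p'1: "\<forall>\<^sub>F n in sequentially. 1 \<le> p' n"
    using p'5 by (auto intro!: always_eventually order_trans[OF _ p'5])
  have c_0: "c \<longlonglongrightarrow> 0"
  proof (rule Lim_null_comparison)
    have "(\<lambda>n. p n * \<eta> n) \<longlonglongrightarrow> 0" using p_a by (simp add: \<eta>_def v_def)
    then show "(\<lambda>n. C / \<gamma> * (p n * \<eta> n)) \<longlonglongrightarrow> 0" by (rule tendsto_mult_right_zero)
    show "\<forall>\<^sub>F n in sequentially. norm (c n) \<le> C / \<gamma> * (p n * \<eta> n)"
      using \<eta>_pos p'_eq
    proof eventually_elim
      case (elim n)
      have "1 * \<eta> n \<le> p n * \<eta> n" using elim p'5[of n] by (intro mult_right_mono) auto
      then have "C / \<gamma> * \<eta> n \<le> C / \<gamma> * (p n * \<eta> n)"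
        using C(1) gamma by (intro mult_left_mono) auto
      then show ?case using elim C(1) gamma by (simp add: c_def)
    qed
  qed
  \<comment> \<open>Dividing by \<open>\<gamma> powr p'\<close> puts the observed sum on the scale
    of its exponential model \<open>B\<close>, whose summands correspond to the mean
    \<open>G\<close>.\<close>
  define A where "A n \<omega> = (\<Sum>i=1..k n. log_excess Q (k n) n i \<omega> powr p' n) / \<gamma> powr p' n" for n \<omega>
  define B where "B n \<omega> = (\<Sum>i=1..k n. spacing (k n) n i \<omega> powr p' n)" for n \<omega>
  define G where "G n = Gamma (p' n + 1)" for n
  have G0: "0 < G n" for n unfolding G_def using p'5[of n] by (intro Gamma_real_pos) simp
  have G2: "0 < Gamma (2 * p' n + 1)" for n using p'5[of n] by (intro Gamma_real_pos) simp
  have AB: "(\<lambda>n. prob {\<omega> \<in> space M. \<bar>A n \<omega> - B n \<omega>\<bar> > \<delta> n}) \<longlonglongrightarrow> 0"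
    if "\<forall>\<^sub>F n in sequentially. 0 < \<delta> n" "(\<lambda>n. real (k n) * c n * G n / \<delta> n) \<longlonglongrightarrow> 0" for \<delta>
    unfolding A_def B_def
    by (rule log_excess_diff_tendsto_0[OF gamma mono Q_l kn k_inf osc p'1 c_nonneg c_0 that[unfolded G_def]])
  have kn': "\<forall>\<^sub>F n in sequentially. k n < n" using kn by eventually_elim auto
  have A_meas: "\<forall>\<^sub>F n in sequentially. A n \<in> borel_measurable M"
    using kn'
  proof eventually_elim
    case (elim n)
    have "log_excess Q (k n) n i \<in> borel_measurable M" if "i \<in> {1..k n}" for i
      by (rule log_excess_measurable[OF Q_meas elim that])
    then show ?case unfolding A_def
      by (intro borel_measurable_divide borel_measurable_sum powr_real_measurable borel_measurable_const)
  qed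
  have B_meas: "\<forall>\<^sub>F n in sequentially. B n \<in> borel_measurable M"
    using kn'
  proof eventually_elim
    case (elim n)
    have "spacing (k n) n i \<in> borel_measurable M" if "i \<in> {1..k n}" for i
      by (rule spacing_measurable[OF elim that])
    then show ?case unfolding B_def
      by (intro borel_measurable_sum powr_real_measurable borel_measurable_const)
  qed

  \<comment> \<open>Law of large numbers\<close>
  have part1: "converges_in_probability M (\<lambda>n \<omega>. 1 / (real (k n) * m_const \<gamma> (p n)) *
      (\<Sum>i=1..k n. log_excess Q (k n) n i \<omega> powr p n)) 1" if \<alpha>1: "1 < \<alpha>"
  proof -
    let ?T = "\<lambda>n \<omega>. 1 / (real (k n) * m_const \<gamma> (p n)) * (\<Sum>i=1..k n. log_excess Q (k n) n i \<omega> powr p n)"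
    \<comment> \<open>Centring and scaling each summand gives a sum of one function of the spacings;
      eventually it is \<open>B / (k G) - 1\<close>.\<close>
    let ?T' = "\<lambda>n \<omega>. (\<Sum>i=1..k n. (spacing (k n) n i \<omega> powr p' n - G n) / G n) / real (k n)"
    have "ereal 1 < liminf (\<lambda>n. ereal (ln (real (k n)) / p n))"
      using \<alpha>1 alpha by (simp add: one_ereal_def)
    from eventually_growth_of_liminf[OF this p_ev]
    obtain \<beta> where \<beta>: "1 < \<beta>" "\<forall>\<^sub>F n in sequentially. \<beta> * p n \<le> ln (real (k n))" by blast
    have growth: "\<forall>\<^sub>F n in sequentially. \<beta> * p' n \<le> ln (real (k n))"
      using \<beta>(2) p'_eq by eventually_elim simp
    have N: "real_distribution (return borel (0::real))"
      by (intro real_distribution.intro prob_space_return real_distribution_axioms.intro) auto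
    have "char (return borel 0) t = 1" for t
      unfolding char_def by (subst integral_return) auto
    then have "weak_conv_m (\<lambda>n. distr M borel (?T' n)) (return borel 0)"
      using char_powr_LLN[OF p'5 p'_inf k_inf growth \<beta>(1)]
      by (intro weak_conv_sum_spacing[OF N _ kn']) (auto simp: G_def)
    moreover have T'_eq: "\<forall>\<^sub>F n in sequentially. \<forall>\<omega>. ?T' n \<omega> = B n \<omega> / (real (k n) * G n) - 1"
      using k1
    proof eventually_elim
      case (elim n)
      have "?T' n \<omega> = B n \<omega> / (real (k n) * G n) - 1" for \<omega>
        using elim G0[of n]
        by (simp add: B_def sum_subtractf flip: sum_divide_distrib) (simp add: field_simps)
      then show ?case by blast
    qed
    moreover have T'_meas: "\<forall>\<^sub>F n in sequentially. ?T' n \<in> borel_measurable M"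
      using T'_eq B_meas
    proof eventually_elim
      case (elim n)
      then have "?T' n = (\<lambda>\<omega>. B n \<omega> / (real (k n) * G n) - 1)" by (intro ext) blast
      then show ?case using elim(2) by simp
    qed
    ultimately have T'_0: "(\<lambda>n. prob {\<omega> \<in> space M. \<bar>?T' n \<omega>\<bar> > \<epsilon>}) \<longlonglongrightarrow> 0" if "0 < \<epsilon>" for \<epsilon>
      using that by (intro weak_conv_0_imp_prob)
    have T_eq: "\<forall>\<^sub>F n in sequentially. \<forall>\<omega>. ?T n \<omega> = A n \<omega> / (real (k n) * G n)"
      using p'_eq by eventually_elim (simp add: A_def G_def m_const_def mult_ac)
    have T_meas: "\<forall>\<^sub>F n in sequentially. ?T n \<in> borel_measurable M"
      using T_eq A_meas
    proof eventually_elim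
      case (elim n)
      then have "?T n = (\<lambda>\<omega>. A n \<omega> / (real (k n) * G n))" by (intro ext) blast
      then show ?case using elim(2) by simp
    qed
    have "(\<lambda>n. prob {\<omega> \<in> space M. \<bar>?T n \<omega> - 1\<bar> > \<epsilon>}) \<longlonglongrightarrow> 0" if \<epsilon>: "0 < \<epsilon>" for \<epsilon>
    proof (rule Lim_null_comparison)
      \<comment> \<open>Half of \<open>\<epsilon>\<close> is for replacing \<open>A\<close> by
        \<open>B\<close>, the other half for the fluctuation of \<open>B\<close>.\<close>
      define \<delta> where "\<delta> n = \<epsilon> / 2 * (real (k n) * G n)" for n
      have \<delta>: "\<forall>\<^sub>F n in sequentially. 0 < \<delta> n"
        using k1 by eventually_elim (use \<epsilon> G0 in \<open>simp add: \<delta>_def\<close>)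
      have "(\<lambda>n. c n / (\<epsilon> / 2)) \<longlonglongrightarrow> 0 / (\<epsilon> / 2)" using \<epsilon> by (intro tendsto_intros c_0) auto
      moreover have "\<forall>\<^sub>F n in sequentially. c n / (\<epsilon> / 2) = real (k n) * c n * G n / \<delta> n"
        using k1
      proof eventually_elim
        case (elim n)
        then show ?case using \<epsilon> G0[of n] by (simp add: \<delta>_def field_simps)
      qed
      ultimately have "(\<lambda>n. real (k n) * c n * G n / \<delta> n) \<longlonglongrightarrow> 0"
        by (simp add: tendsto_cong)
      note AB' = AB[OF \<delta> this]
      have "(\<lambda>n. prob {\<omega> \<in> space M. \<bar>?T' n \<omega>\<bar> > \<epsilon> / 2} + prob {\<omega> \<in> space M. \<bar>A n \<omega> - B n \<omega>\<bar> > \<delta> n}) \<longlonglongrightarrow> 0 + 0"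
        using \<epsilon> by (intro tendsto_add T'_0 AB') simp
      then show "(\<lambda>n. prob {\<omega> \<in> space M. \<bar>?T' n \<omega>\<bar> > \<epsilon> / 2} + prob {\<omega> \<in> space M. \<bar>A n \<omega> - B n \<omega>\<bar> > \<delta> n}) \<longlonglongrightarrow> 0"
        by simp
      show "\<forall>\<^sub>F n in sequentially. norm (prob {\<omega> \<in> space M. \<bar>?T n \<omega> - 1\<bar> > \<epsilon>}) \<le>
          prob {\<omega> \<in> space M. \<bar>?T' n \<omega>\<bar> > \<epsilon> / 2} + prob {\<omega> \<in> space M. \<bar>A n \<omega> - B n \<omega>\<bar> > \<delta> n}"
        using T_eq T'_eq A_meas B_meas T'_meas k1
      proof eventually_elim
        case (elim n)
        note [measurable] = elim(3,4,5)
        have pos: "0 < real (k n) * G n" using elim(6) G0[of n] by simp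
        have "prob {\<omega> \<in> space M. \<bar>?T n \<omega> - 1\<bar> > \<epsilon>} \<le>
            prob ({\<omega> \<in> space M. \<bar>?T' n \<omega>\<bar> > \<epsilon> / 2} \<union> {\<omega> \<in> space M. \<bar>A n \<omega> - B n \<omega>\<bar> > \<delta> n})"
        proof (rule finite_measure_mono)
          show "{\<omega> \<in> space M. \<bar>?T n \<omega> - 1\<bar> > \<epsilon>} \<subseteq>
              {\<omega> \<in> space M. \<bar>?T' n \<omega>\<bar> > \<epsilon> / 2} \<union> {\<omega> \<in> space M. \<bar>A n \<omega> - B n \<omega>\<bar> > \<delta> n}"
          proof (rule subsetI, rule ccontr)
            fix \<omega> assume \<omega>: "\<omega> \<in> {\<omega> \<in> space M. \<bar>?T n \<omega> - 1\<bar> > \<epsilon>}"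
              and n: "\<omega> \<notin> {\<omega> \<in> space M. \<bar>?T' n \<omega>\<bar> > \<epsilon> / 2} \<union> {\<omega> \<in> space M. \<bar>A n \<omega> - B n \<omega>\<bar> > \<delta> n}"
            have "\<bar>A n \<omega> - B n \<omega>\<bar> \<le> \<epsilon> / 2 * (real (k n) * G n)" and t': "\<bar>?T' n \<omega>\<bar> \<le> \<epsilon> / 2"
              using \<omega> n by (auto simp: \<delta>_def)
            then have "\<bar>(A n \<omega> - B n \<omega>) / (real (k n) * G n)\<bar> \<le> \<epsilon> / 2"
              using pos by (simp add: abs_divide pos_divide_le_eq abs_of_pos del: mult_pos_pos)
            moreover have "?T n \<omega> - 1 = ?T' n \<omega> + (A n \<omega> - B n \<omega>) / (real (k n) * G n)"
              unfolding elim(1)[rule_format] elim(2)[rule_format] by (simp add: diff_divide_distrib)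
            moreover have "\<bar>?T n \<omega> - 1\<bar> > \<epsilon>" using \<omega> by blast
            moreover have "\<not> e < \<bar>x - 1\<bar>" if "\<bar>z\<bar> \<le> e / 2" "x - 1 = y + z" "\<bar>y\<bar> \<le> e / 2" for e x y z :: real
              using that by linarith
            ultimately show False using t' by blast
          qed
        qed measurable
        also have "\<dots> \<le> prob {\<omega> \<in> space M. \<bar>?T' n \<omega>\<bar> > \<epsilon> / 2} + prob {\<omega> \<in> space M. \<bar>A n \<omega> - B n \<omega>\<bar> > \<delta> n}"
          by (rule measure_Un_le) measurable
        finally show ?case by simp
      qed
    qed
    then show ?thesis unfolding converges_in_probability_def using T_meas by blast
  qed

  \<comment> \<open>Central limit theorem\<close>
  have part2: "weak_conv_m (\<lambda>n. distr M borel (\<lambda>\<omega>. 1 / (sqrt (real (k n)) * sigma_const \<gamma> (p n)) *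
      (\<Sum>i=1..k n. log_excess Q (k n) n i \<omega> powr p n - m_const \<gamma> (p n)))) std_normal_distribution"
    if \<alpha>2: "2 < \<alpha>" and ls: "limsup (\<lambda>n. ereal (1 / p n * ln (sqrt (real (k n)) *
      (a (real (k n) / real n) / l (real (k n) / real n))))) < ereal (ln 2)"
  proof -
    let ?T = "\<lambda>n \<omega>. 1 / (sqrt (real (k n)) * sigma_const \<gamma> (p n)) *
      (\<Sum>i=1..k n. log_excess Q (k n) n i \<omega> powr p n - m_const \<gamma> (p n))"
    define d where "d n = sqrt (Gamma (2 * p' n + 1) - (G n)\<^sup>2)" for n
    have d: "0 < d n" "Gamma (2 * p' n + 1) \<le> 2 * (d n)\<^sup>2" for n
      using expo_powr_variance[OF p'5[of n]] by (simp_all add: d_def G_def)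
    let ?T' = "\<lambda>n \<omega>. (\<Sum>i=1..k n. (spacing (k n) n i \<omega> powr p' n - G n) / d n) / sqrt (real (k n))"
    have "ereal 2 < liminf (\<lambda>n. ereal (ln (real (k n)) / p n))"
      using \<alpha>2 alpha by simp
    from eventually_growth_of_liminf[OF this p_ev]
    obtain \<beta> where \<beta>: "2 < \<beta>" "\<forall>\<^sub>F n in sequentially. \<beta> * p n \<le> ln (real (k n))" by blast
    have growth: "\<forall>\<^sub>F n in sequentially. \<beta> * p' n \<le> ln (real (k n))"
      using \<beta>(2) p'_eq by eventually_elim simp
    have conv: "weak_conv_m (\<lambda>n. distr M borel (?T' n)) std_normal_distribution"
      using char_powr_CLT[OF p'5 p'_inf k_inf growth \<beta>(1)]
      by (intro weak_conv_sum_spacing[OF real_dist_normal_dist _ kn'])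
        (auto simp: G_def d_def char_std_normal_distribution exp_of_real)
    have T'_eq: "?T' n \<omega> = (B n \<omega> - real (k n) * G n) / (sqrt (real (k n)) * d n)" for n \<omega>
      by (simp add: B_def sum_subtractf mult.commute flip: sum_divide_distrib)
    have T'_meas: "\<forall>\<^sub>F n in sequentially. ?T' n \<in> borel_measurable M"
      unfolding T'_eq using B_meas by eventually_elim simp
    have T_eq: "\<forall>\<^sub>F n in sequentially. \<forall>\<omega>. ?T n \<omega> = (A n \<omega> - real (k n) * G n) / (sqrt (real (k n)) * d n)"
      using p'_eq
    proof eventually_elim
      case (elim n)
      have g0: "0 < \<gamma> powr p' n" using gamma by simp
      \<comment> \<open>The factor \<open>\<gamma> powr p'\<close> comes out of the standard
        deviation as it does out of the sum and of the mean, so it cancels.\<close>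
      have "\<gamma> powr (2 * p' n) = (\<gamma> powr p' n)\<^sup>2"
        by (simp add: power2_eq_square flip: powr_add)
      then have s: "sigma_const \<gamma> (p n) = \<gamma> powr p' n * d n"
        unfolding sigma_const_def elim[symmetric] d_def G_def by (simp add: real_sqrt_mult)
      have "?T n \<omega> = (A n \<omega> - real (k n) * G n) / (sqrt (real (k n)) * d n)" for \<omega>
      proof -
        have "(\<Sum>i=1..k n. log_excess Q (k n) n i \<omega> powr p n - m_const \<gamma> (p n)) =
            \<gamma> powr p' n * (A n \<omega> - real (k n) * G n)"
          using g0 by (simp add: A_def sum_subtractf m_const_def G_def elim field_simps)
        then show ?thesis unfolding s using g0 by simp
      qed
      then show ?case by blast
    qed
    have T_meas: "\<forall>\<^sub>F n in sequentially. ?T n \<in> borel_measurable M"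
      using T_eq A_meas
    proof eventually_elim
      case (elim n)
      then have "?T n = (\<lambda>\<omega>. (A n \<omega> - real (k n) * G n) / (sqrt (real (k n)) * d n))" by (intro ext) blast
      then show ?case using elim(2) by simp
    qed
    have "\<forall>\<^sub>F n in sequentially. 0 < sqrt (real (k n)) * \<eta> n"
      using k1 \<eta>_pos by eventually_elim simp
    from eventually_le_exp_of_limsup[OF ls[folded v_def, folded \<eta>_def] p_ev this]
    obtain L where L: "L < ln 2" "\<forall>\<^sub>F n in sequentially. sqrt (real (k n)) * \<eta> n \<le> exp (L * p n)" by blast
    \<comment> \<open>Picks the loss constant \<open>\<theta>\<close> for the Gamma ratio: close
      enough to 1 that \<open>exp L < 2 \<theta>\<close>, which is possible because
      \<open>L < ln 2\<close>.\<close>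
    have "max 0 (exp L / 2) < 1" using L(1) by (simp add: ln_less_cancel_iff flip: exp_less_cancel_iff[of L])
    then obtain \<theta> where \<theta>: "max 0 (exp L / 2) < \<theta>" "\<theta> < 1" using dense by blast
    have \<theta>0: "0 < \<theta>" using \<theta>(1) by (rule le_less_trans[OF max.cobounded1])
    then have "exp L < exp (ln (2 * \<theta>))" using \<theta>(1) by (subst exp_ln) auto
    then have L\<theta>: "L < ln (2 * \<theta>)" by (simp only: exp_less_cancel_iff)
    \<comment> \<open>Size of the perturbation on the scale of the standard deviation:
      \<open>sqrt k * \<eta>\<close> is at most \<open>exp (L p)\<close>, \<open>G / d\<close> is at
      most a constant times \<open>(2 \<theta>) powr (- p)\<close>, and
      \<open>L < ln (2 \<theta>)\<close>.\<close>
    have bias: "(\<lambda>n. sqrt (real (k n)) * c n * G n / d n) \<longlonglongrightarrow> 0"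
    proof (rule Lim_null_comparison)
      let ?K = "C / \<gamma> * (sqrt 2 / (1 - \<theta>))"
      have "filterlim (\<lambda>n. (L - ln (2 * \<theta>)) * p' n) at_bot sequentially"
        using L\<theta> by (intro filterlim_tendsto_neg_mult_at_bot[OF tendsto_const _ p'_inf]) auto
      then have "(\<lambda>n. exp ((L - ln (2 * \<theta>)) * p' n)) \<longlonglongrightarrow> 0"
        by (rule filterlim_compose[OF exp_at_bot])
      then show "(\<lambda>n. ?K * exp ((L - ln (2 * \<theta>)) * p' n)) \<longlonglongrightarrow> 0"
        by (rule tendsto_mult_right_zero)
      show "\<forall>\<^sub>F n in sequentially. norm (sqrt (real (k n)) * c n * G n / d n) \<le>
          ?K * exp ((L - ln (2 * \<theta>)) * p' n)"
        using L(2) p'_eq \<eta>_pos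
      proof eventually_elim
        case (elim n)
        have "sqrt (Gamma (2 * p' n + 1)) \<le> sqrt (2 * (d n)\<^sup>2)"
          using d(2)[of n] by simp
        also have "\<dots> = sqrt 2 * d n" using d(1)[of n] by (simp add: real_sqrt_mult)
        finally have "sqrt (Gamma (2 * p' n + 1)) / sqrt 2 \<le> d n" by (simp add: field_simps)
        then have "G n / d n \<le> G n / (sqrt (Gamma (2 * p' n + 1)) / sqrt 2)"
          using G0[of n] G2[of n] d(1)[of n] by (intro divide_left_mono) auto
        also have "\<dots> = sqrt 2 * (G n / sqrt (Gamma (2 * p' n + 1)))" by simp
        also have "\<dots> \<le> sqrt 2 * ((2 * \<theta>) powr (- p' n) / (1 - \<theta>))"
          unfolding G_def using p'5[of n] \<theta>0 \<theta>(2)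
          by (intro mult_left_mono Gamma_square_ratio_bound) auto
        finally have Gd: "G n / d n \<le> sqrt 2 / (1 - \<theta>) * (2 * \<theta>) powr (- p' n)" by simp
        have "(sqrt (real (k n)) * \<eta> n) * (G n / d n) \<le>
            exp (L * p' n) * (sqrt 2 / (1 - \<theta>) * (2 * \<theta>) powr (- p' n))"
          using elim Gd G0[of n] d(1)[of n] by (intro mult_mono) auto
        also have "(2 * \<theta>) powr (- p' n) = exp (- (ln (2 * \<theta>) * p' n))"
          using \<theta>0 by (simp add: powr_def mult.commute)
        finally have "C / \<gamma> * ((sqrt (real (k n)) * \<eta> n) * (G n / d n)) \<le>
            C / \<gamma> * (exp (L * p' n) * (sqrt 2 / (1 - \<theta>) * exp (- (ln (2 * \<theta>) * p' n))))"
          using C(1) gamma by (intro mult_left_mono) auto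
        also have "\<dots> = ?K * (exp (L * p' n) * exp (- (ln (2 * \<theta>) * p' n)))"
          by (simp add: mult_ac)
        also have "exp (L * p' n) * exp (- (ln (2 * \<theta>) * p' n)) = exp ((L - ln (2 * \<theta>)) * p' n)"
          by (simp add: exp_add[symmetric] algebra_simps)
        finally have "C / \<gamma> * ((sqrt (real (k n)) * \<eta> n) * (G n / d n)) \<le> ?K * exp ((L - ln (2 * \<theta>)) * p' n)" .
        moreover have "sqrt (real (k n)) * c n * G n / d n = C / \<gamma> * ((sqrt (real (k n)) * \<eta> n) * (G n / d n))"
          by (simp add: c_def mult_ac)
        moreover have "0 \<le> C / \<gamma> * ((sqrt (real (k n)) * \<eta> n) * (G n / d n))"
          using C(1) gamma elim(3) G0[of n] d(1)[of n] by (intro mult_nonneg_nonneg) auto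
        ultimately show ?case by simp
      qed
    qed
    show ?thesis
    proof (rule slutsky[OF conv isCont_cdf_std_normal T_meas T'_meas])
      fix \<epsilon> :: real assume \<epsilon>: "0 < \<epsilon>"
      \<comment> \<open>With this scale the events for \<open>A - B\<close> and for the normalised
        difference coincide, as both sums have the same centring.\<close>
      define \<delta> where "\<delta> n = \<epsilon> * (sqrt (real (k n)) * d n)" for n
      have \<delta>: "\<forall>\<^sub>F n in sequentially. 0 < \<delta> n"
        using k1 by eventually_elim (use \<epsilon> d(1) in \<open>simp add: \<delta>_def\<close>)
      have "(\<lambda>n. (sqrt (real (k n)) * c n * G n / d n) / \<epsilon>) \<longlonglongrightarrow> 0 / \<epsilon>"
        using \<epsilon> by (intro tendsto_intros bias) auto
      moreover have "\<forall>\<^sub>F n in sequentially. (sqrt (real (k n)) * c n * G n / d n) / \<epsilon> = real (k n) * c n * G n / \<delta> n"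
        using k1
      proof eventually_elim
        case (elim n)
        have "real (k n) = sqrt (real (k n)) * sqrt (real (k n))" by simp
        then have "real (k n) * c n * G n / \<delta> n =
            (sqrt (real (k n)) * (sqrt (real (k n)) * c n * G n)) / (sqrt (real (k n)) * (d n * \<epsilon>))"
          unfolding \<delta>_def by (metis (no_types, opaque_lifting) mult.assoc mult.commute)
        then show ?case using elim by simp
      qed
      ultimately have "(\<lambda>n. real (k n) * c n * G n / \<delta> n) \<longlonglongrightarrow> 0"
        by (simp add: tendsto_cong)
      note AB' = AB[OF \<delta> this]
      show "(\<lambda>n. prob {\<omega> \<in> space M. \<bar>?T n \<omega> - ?T' n \<omega>\<bar> > \<epsilon>}) \<longlonglongrightarrow> 0"
      proof (rule Lim_transform_eventually[OF AB'])
        show "\<forall>\<^sub>F n in sequentially. prob {\<omega> \<in> space M. \<bar>A n \<omega> - B n \<omega>\<bar> > \<delta> n} =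
            prob {\<omega> \<in> space M. \<bar>?T n \<omega> - ?T' n \<omega>\<bar> > \<epsilon>}"
          using T_eq k1
        proof eventually_elim
          case (elim n)
          have pos: "0 < sqrt (real (k n)) * d n" using elim(2) d(1)[of n] by simp
          have "\<delta> n < \<bar>A n \<omega> - B n \<omega>\<bar> \<longleftrightarrow> \<epsilon> < \<bar>?T n \<omega> - ?T' n \<omega>\<bar>" for \<omega>
          proof -
            have "?T n \<omega> - ?T' n \<omega> = (A n \<omega> - B n \<omega>) / (sqrt (real (k n)) * d n)"
              unfolding elim(1)[rule_format] T'_eq by (simp add: diff_divide_distrib)
            then have "\<bar>?T n \<omega> - ?T' n \<omega>\<bar> = \<bar>A n \<omega> - B n \<omega>\<bar> / (sqrt (real (k n)) * d n)"
              using abs_of_pos[OF pos] by (simp only: abs_divide)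
            then show ?thesis unfolding \<delta>_def by (simp only: pos_less_divide_eq[OF pos])
          qed
          then show ?case by simp
        qed
      qed
    qed
  qed
  show ?thesis
    unfolding log_excess_def[symmetric] using part1 part2 by blast
qed

end
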